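(* Let $(X,d)$ be a finite metric space, let $\Bbbk$ be a field, let $I=\{1<2<\cdots<m\}$ be a finite totally ordered index set, and let $\mathcal{T}_1\supseteq\mathcal{T}_2\supseteq\cdots\supseteq\mathcal{T}_m$ be a family of topologies on the underlying set $X$. Let $\mathbb{X}\colon I\to\mathbf{Top}$ be the functor with $\mathbb{X}(i)=(X,\mathcal{T}_i)$ which sends each morphism $i\le j$ to the continuous identity map $\mathrm{id}_X\colon (X,\mathcal{T}_i)\to(X,\mathcal{T}_j)$. Let $\mathbb{K}\colon I\to\mathbf{Simp}$ be the functor with $\mathbb{K}(i)=K_i:=\Delta(\mathcal{P}_i)$, where $\mathcal{P}_i$ is the finite poset associated with $(X,\mathcal{T}_i)$, and which sends $i\le j$ to the simplicial map $K_i\to K_j$ induced by $\mathrm{id}_X$. Then for every integer $n\ge 0$ the persistence modules $$H_n(\mathbb{X})\colon i\mapsto H_n\bigl((X,\mathcal{T}_i);\Bbbk\bigr)\qquad\text{and}\qquad H_n(\mathbb{K})\colon i\mapsto H_n(K_i;\Bbbk)$$ are naturally isomorphic as functors $I\to\mathbf{Vect}_{\Bbbk}$.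
   Context: A totally ordered set $I$ is viewed as a category with a unique morphism $i\to j$ whenever $i\le j$. A persistence module indexed by $I$ is a functor $I\to\mathbf{Vect}_{\Bbbk}$, where $\mathbf{Vect}_{\Bbbk}$ is the category of vector spaces over the field $\Bbbk$. $\mathbf{Top}$ is the category of topological spaces and continuous maps, and $\mathbf{Simp}$ is the category of (abstract) simplicial complexes and simplicial maps. $H_n(-;\Bbbk)$ is singular homology for topological spaces, and for a simplicial complex it is simplicial homology (equivalently, singular homology of the geometric realization). Associated poset: for a topology $\mathcal{T}$ on the finite set $X$ and $y\in X$, let $U_y$ be the intersection of all $\mathcal{T}$-open sets containing $y$. Define a preorder on $X$ by $x\le y$ if and only if $x\in U_y$, and an equivalence relation by $x\sim y$ if and only if $x\le y$ and $y\le x$. The preorder descends to a partial order on $X/{\sim}$, and the resulting finite poset $\mathcal{P}$ is the poset associated with $(X,\mathcal{T})$. A continuous map between finite spaces is order preserving for these preorders, hence induces an order-preserving map between the associated posets. Order complex: for a finite poset $\mathcal{P}$, $\Delta(\mathcal{P})$ is the simplicial complex with vertex set $\mathcal{P}$ whose simplices are the nonempty finite chains of $\mathcal{P}$. An order-preserving map $\mathcal{P}\to\mathcal{Q}$ induces a simplicial map $\Delta(\mathcal{P})\to\Delta(\mathcal{Q})$. The map $K_i\to K_j$ is the one obtained in this way from $\mathrm{id}_X\colon (X,\mathcal{T}_i)\to(X,\mathcal{T}_j)$, i.e. on vertices it sends the class of $x$ in $\mathcal{P}_i$ to the class of $x$ in $\mathcal{P}_j$. *)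

theory Defs
  imports
    "HOL-Analysis.Analysis"
    "HOL-Homology.Homology"
    "HOL-Algebra.Module"
    "HOL-Combinatorics.Permutations"
    "HOL-Library.Set_Algebras"
begin

section \<open>Diagrams, vector spaces and persistence modules\<close>

text \<open>
  The data of a functor out of a totally ordered index set: the value on objects, and the value
  \<open>dmor F i j\<close> on the unique morphism from \<open>i\<close> to \<open>j\<close>.  Only \<open>i \<le> j\<close> in the index set is relevant.
\<close>

record ('i, 'o, 'm) diagram =
  dob :: "'i \<Rightarrow> 'o"
  dmor :: "'i \<Rightarrow> 'i \<Rightarrow> 'm"

text \<open>
  Vector spaces over the field \<open>'k\<close> are modules, in the sense of HOL-Algebra, over the
  type \<open>'k\<close> regarded as a ring record.
\<close>

definition field_ring :: "'k::field ring" where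
  "field_ring = \<lparr> carrier = UNIV, mult = (*), one = 1, zero = 0, add = (+) \<rparr>"

lemma field_field_ring: "Ring.field (field_ring :: 'k::field ring)"
proof -
  have "\<exists>y. x + y = 0" for x :: 'k
    by (rule exI[of _ "- x"]) simp
  moreover have "\<exists>y. x * y = 1" if "x \<noteq> 0" for x :: 'k
    using right_inverse[OF that] by blast
  ultimately show ?thesis
    by unfold_locales (auto simp: field_ring_def Units_def algebra_simps)
qed

definition vect :: "('k::field, 'v) module \<Rightarrow> bool" where
  "vect V \<longleftrightarrow> Module.module (field_ring :: 'k ring) V"

definition vect_hom :: "('k::field, 'v) module \<Rightarrow> ('k, 'w) module \<Rightarrow> ('v \<Rightarrow> 'w) set" where
  "vect_hom V W = {h \<in> carrier V \<rightarrow> carrier W.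
     (\<forall>x \<in> carrier V. \<forall>y \<in> carrier V. h (x \<oplus>\<^bsub>V\<^esub> y) = h x \<oplus>\<^bsub>W\<^esub> h y) \<and>
     (\<forall>a. \<forall>x \<in> carrier V. h (a \<odot>\<^bsub>V\<^esub> x) = a \<odot>\<^bsub>W\<^esub> h x)}"

definition vect_iso :: "('k::field, 'v) module \<Rightarrow> ('k, 'w) module \<Rightarrow> ('v \<Rightarrow> 'w) set" where
  "vect_iso V W = {h \<in> vect_hom V W. bij_betw h (carrier V) (carrier W)}"

type_synonym ('i, 'k, 'v) persistence = "('i, ('k, 'v) module, 'v \<Rightarrow> 'v) diagram"

definition persistence_module :: "'i::linorder set \<Rightarrow> ('i, 'k::field, 'v) persistence \<Rightarrow> bool" where
  "persistence_module I F \<longleftrightarrow>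
     (\<forall>i\<in>I. vect (dob F i)) \<and>
     (\<forall>i\<in>I. \<forall>j\<in>I. i \<le> j \<longrightarrow> dmor F i j \<in> vect_hom (dob F i) (dob F j)) \<and>
     (\<forall>i\<in>I. \<forall>v \<in> carrier (dob F i). dmor F i i v = v) \<and>
     (\<forall>i\<in>I. \<forall>j\<in>I. \<forall>k\<in>I. i \<le> j \<longrightarrow> j \<le> k \<longrightarrow>
        (\<forall>v \<in> carrier (dob F i). dmor F j k (dmor F i j v) = dmor F i k v))"

definition naturally_isomorphic ::
  "'i::linorder set \<Rightarrow> ('i, 'k::field, 'v) persistence \<Rightarrow> ('i, 'k, 'w) persistence \<Rightarrow> bool" where
  "naturally_isomorphic I F G \<longleftrightarrow>
     persistence_module I F \<and> persistence_module I G \<and>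
     (\<exists>\<eta>. (\<forall>i\<in>I. \<eta> i \<in> vect_iso (dob F i) (dob G i)) \<and>
          (\<forall>i\<in>I. \<forall>j\<in>I. i \<le> j \<longrightarrow>
             (\<forall>v \<in> carrier (dob F i). \<eta> j (dmor F i j v) = dmor G i j (\<eta> i v))))"

section \<open>Chains with coefficients in a field and subquotients\<close>

definition chain_scale :: "'k::field \<Rightarrow> ('b \<Rightarrow>\<^sub>0 'k) \<Rightarrow> ('b \<Rightarrow>\<^sub>0 'k)" where
  "chain_scale a c = Poly_Mapping.map (\<lambda>x. a * x) c"

lemma lookup_chain_scale [simp]:
  "Poly_Mapping.lookup (chain_scale a c) b = a * Poly_Mapping.lookup c b"
  by (simp add: chain_scale_def Poly_Mapping.map.rep_eq when_def)

lemma vector_space_chain_scale: "vector_space chain_scale"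
  by standard (auto intro!: poly_mapping_eqI simp: Poly_Mapping.lookup_add algebra_simps)

text \<open>The linear extension of a map defined on the basis.\<close>

definition chain_extend :: "('b \<Rightarrow> ('c \<Rightarrow>\<^sub>0 'k)) \<Rightarrow> ('b \<Rightarrow>\<^sub>0 'k::field) \<Rightarrow> ('c \<Rightarrow>\<^sub>0 'k)" where
  "chain_extend f c =
     (\<Sum>b \<in> Poly_Mapping.keys c. chain_scale (Poly_Mapping.lookup c b) (f b))"

text \<open>
  The quotient \<open>Z / B\<close> for subspaces \<open>B \<subseteq> Z\<close> of a space of chains; its vectors are the
  cosets of \<open>B\<close>.  The ring multiplication and unit, present in the \<open>module\<close> record,
  are not used by the notion of a module.
\<close>

definition subquotient ::
  "('b \<Rightarrow>\<^sub>0 'k::field) set \<Rightarrow> ('b \<Rightarrow>\<^sub>0 'k) set \<Rightarrow> ('k, ('b \<Rightarrow>\<^sub>0 'k) set) module" where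
  "subquotient Z B =
     \<lparr> carrier = (\<lambda>z. z +o B) ` Z, mult = undefined, one = undefined,
       zero = B, add = (\<lambda>S T. S + T), smult = (\<lambda>a S. chain_scale a ` S + B) \<rparr>"

text \<open>The map into a quotient by \<open>B'\<close> induced by a map of chains: \<open>z + B\<close> goes to \<open>f z + B'\<close>.\<close>

definition subquotient_map ::
  "('c \<Rightarrow>\<^sub>0 'k::field) set \<Rightarrow> (('b \<Rightarrow>\<^sub>0 'k) \<Rightarrow> ('c \<Rightarrow>\<^sub>0 'k)) \<Rightarrow> ('b \<Rightarrow>\<^sub>0 'k) set \<Rightarrow> ('c \<Rightarrow>\<^sub>0 'k) set" where
  "subquotient_map B' f S = f ` S + B'"

section \<open>Singular homology\<close>

type_synonym ('a, 'k) schain = "((nat \<Rightarrow> real) \<Rightarrow> 'a) \<Rightarrow>\<^sub>0 'k"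

definition schains :: "nat \<Rightarrow> 'a topology \<Rightarrow> ('a, 'k::field) schain set" where
  "schains n X = {c. Poly_Mapping.keys c \<subseteq> singular_simplex_set n X}"

definition sboundary :: "nat \<Rightarrow> ('a, 'k::field) schain \<Rightarrow> ('a, 'k) schain" where
  "sboundary n c =
     (if n = 0 then 0
      else chain_extend (\<lambda>\<sigma>. \<Sum>k\<le>n. Poly_Mapping.single (singular_face n k \<sigma>) ((-1) ^ k)) c)"

definition scycles :: "nat \<Rightarrow> 'a topology \<Rightarrow> ('a, 'k::field) schain set" where
  "scycles n X = {c \<in> schains n X. sboundary n c = 0}"

definition sboundaries :: "nat \<Rightarrow> 'a topology \<Rightarrow> ('a, 'k::field) schain set" where
  "sboundaries n X = sboundary (Suc n) ` schains (Suc n) X"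

definition singular_homology ::
  "nat \<Rightarrow> 'a topology \<Rightarrow> ('k::field, ('a, 'k) schain set) module" where
  "singular_homology n X = subquotient (scycles n X) (sboundaries n X)"

definition singular_homology_map ::
  "nat \<Rightarrow> 'b topology \<Rightarrow> ('a \<Rightarrow> 'b) \<Rightarrow> ('a, 'k::field) schain set \<Rightarrow> ('b, 'k) schain set" where
  "singular_homology_map n Y f =
     subquotient_map (sboundaries n Y)
       (chain_extend (\<lambda>\<sigma>. Poly_Mapping.single (simplex_map n f \<sigma>) 1))"

definition singular_persistence ::
  "nat \<Rightarrow> ('i, 'a topology, 'a \<Rightarrow> 'a) diagram \<Rightarrow> ('i, 'k::field, ('a, 'k) schain set) persistence" where
  "singular_persistence n F =
     \<lparr> dob = (\<lambda>i. singular_homology n (dob F i)),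
       dmor = (\<lambda>i j. singular_homology_map n (dob F j) (dmor F i j)) \<rparr>"

section \<open>Simplicial complexes and simplicial homology\<close>

definition simplicial_complex :: "'v set set \<Rightarrow> bool" where
  "simplicial_complex K \<longleftrightarrow>
     (\<forall>s\<in>K. finite s \<and> s \<noteq> {}) \<and> (\<forall>s\<in>K. \<forall>t. t \<subseteq> s \<longrightarrow> t \<noteq> {} \<longrightarrow> t \<in> K)"

definition simplicial_map :: "'v set set \<Rightarrow> 'w set set \<Rightarrow> ('v \<Rightarrow> 'w) \<Rightarrow> bool" where
  "simplicial_map K L f \<longleftrightarrow> (\<forall>s\<in>K. f ` s \<in> L)"

text \<open>
  Simplicial homology is the homology of the complex of oriented chains.  Its \<open>n\<close>-th term is the
  vector space generated by the tuples \<open>(v\<^sub>0, \<dots>, v\<^sub>n)\<close> of vertices spanning a simplex, subject to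
  the relations that a tuple with a repeated vertex is zero, and that permuting the entries of a
  tuple multiplies it by the sign of the permutation.  Thus it is \<open>simpchains n K\<close> modulo
  \<open>simprels n K\<close>, and, as for relative homology in HOL-Homology, cycles and boundaries
  of this quotient complex are represented by their preimages in \<open>simpchains n K\<close>.
\<close>

type_synonym ('v, 'k) simpchain = "'v list \<Rightarrow>\<^sub>0 'k"

definition simplex_tuples :: "nat \<Rightarrow> 'v set set \<Rightarrow> 'v list set" where
  "simplex_tuples n K = {l. length l = Suc n \<and> set l \<in> K}"

definition simpchains :: "nat \<Rightarrow> 'v set set \<Rightarrow> ('v, 'k::field) simpchain set" where
  "simpchains n K = {c. Poly_Mapping.keys c \<subseteq> simplex_tuples n K}"

definition simprels :: "nat \<Rightarrow> 'v set set \<Rightarrow> ('v, 'k::field) simpchain set" where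
  "simprels n K = module.span chain_scale
     ({Poly_Mapping.single l 1 | l. l \<in> simplex_tuples n K \<and> \<not> distinct l} \<union>
      {Poly_Mapping.single (permute_list p l) 1 - Poly_Mapping.single l (of_int (sign p)) | p l.
         l \<in> simplex_tuples n K \<and> p permutes {..<length l}})"

definition simpboundary :: "nat \<Rightarrow> ('v, 'k::field) simpchain \<Rightarrow> ('v, 'k) simpchain" where
  "simpboundary n c =
     (if n = 0 then 0
      else chain_extend (\<lambda>l. \<Sum>k\<le>n. Poly_Mapping.single (take k l @ drop (Suc k) l) ((-1) ^ k)) c)"

definition simpcycles :: "nat \<Rightarrow> 'v set set \<Rightarrow> ('v, 'k::field) simpchain set" where
  "simpcycles n K = {c \<in> simpchains n K. simpboundary n c \<in> simprels (n - 1) K}"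

definition simpboundaries :: "nat \<Rightarrow> 'v set set \<Rightarrow> ('v, 'k::field) simpchain set" where
  "simpboundaries n K = simpboundary (Suc n) ` simpchains (Suc n) K + simprels n K"

definition simplicial_homology ::
  "nat \<Rightarrow> 'v set set \<Rightarrow> ('k::field, ('v, 'k) simpchain set) module" where
  "simplicial_homology n K = subquotient (simpcycles n K) (simpboundaries n K)"

definition simplicial_homology_map ::
  "nat \<Rightarrow> 'w set set \<Rightarrow> ('v \<Rightarrow> 'w) \<Rightarrow> ('v, 'k::field) simpchain set \<Rightarrow> ('w, 'k) simpchain set" where
  "simplicial_homology_map n L f =
     subquotient_map (simpboundaries n L)
       (chain_extend (\<lambda>l. Poly_Mapping.single (map f l) 1))"

definition simplicial_persistence ::
  "nat \<Rightarrow> ('i, 'v set set, 'v \<Rightarrow> 'v) diagram \<Rightarrow> ('i, 'k::field, ('v, 'k) simpchain set) persistence" where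
  "simplicial_persistence n F =
     \<lparr> dob = (\<lambda>i. simplicial_homology n (dob F i)),
       dmor = (\<lambda>i j. simplicial_homology_map n (dob F j) (dmor F i j)) \<rparr>"

section \<open>The poset and the order complex of a finite space\<close>

definition minimal_open :: "'a topology \<Rightarrow> 'a \<Rightarrow> 'a set" where
  "minimal_open T y = \<Inter> {U. openin T U \<and> y \<in> U}"

definition point_preorder :: "'a topology \<Rightarrow> 'a rel" where
  "point_preorder T = {(x, y). x \<in> topspace T \<and> y \<in> topspace T \<and> x \<in> minimal_open T y}"

definition point_equiv :: "'a topology \<Rightarrow> 'a rel" where
  "point_equiv T = point_preorder T \<inter> (point_preorder T)\<inverse>"

definition point_class :: "'a topology \<Rightarrow> 'a \<Rightarrow> 'a set" where
  "point_class T x = point_equiv T `` {x}"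

text \<open>A poset is given by its reflexive order relation, whose field is the underlying set.\<close>

definition associated_poset :: "'a topology \<Rightarrow> 'a set rel" where
  "associated_poset T = {(A, B). A \<in> topspace T // point_equiv T \<and> B \<in> topspace T // point_equiv T \<and>
     (\<exists>x\<in>A. \<exists>y\<in>B. (x, y) \<in> point_preorder T)}"

text \<open>The map of associated posets induced by a continuous map \<open>f\<close> into the space \<open>T'\<close>.\<close>

definition associated_map :: "'b topology \<Rightarrow> ('a \<Rightarrow> 'b) \<Rightarrow> 'a set \<Rightarrow> 'b set" where
  "associated_map T' f A = the_elem ((\<lambda>x. point_class T' (f x)) ` A)"

definition order_complex :: "'p rel \<Rightarrow> 'p set set" where
  "order_complex r = {C \<in> Chains r. finite C \<and> C \<noteq> {}}"

definition identity_diagram :: "('i \<Rightarrow> 'a topology) \<Rightarrow> ('i, 'a topology, 'a \<Rightarrow> 'a) diagram" where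
  "identity_diagram T = \<lparr> dob = T, dmor = (\<lambda>i j. id) \<rparr>"

definition order_complex_diagram ::
  "('i, 'a topology, 'a \<Rightarrow> 'a) diagram \<Rightarrow> ('i, 'a set set set, 'a set \<Rightarrow> 'a set) diagram" where
  "order_complex_diagram F =
     \<lparr> dob = (\<lambda>i. order_complex (associated_poset (dob F i))),
       dmor = (\<lambda>i j. associated_map (dob F j) (dmor F i j)) \<rparr>"

subsection \<open>Order complexes are simplicial complexes and induced maps are simplicial\<close>

lemma refl_point_preorder: "x \<in> topspace T \<Longrightarrow> (x, x) \<in> point_preorder T"
  by (auto simp: point_preorder_def minimal_open_def)

lemma trans_point_preorder: "trans (point_preorder T)"
  by (rule transI) (auto simp: point_preorder_def minimal_open_def)

lemma equiv_point_equiv: "equiv (topspace T) (point_equiv T)"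
proof (rule equivI)
  show "point_equiv T \<subseteq> topspace T \<times> topspace T"
    by (auto simp: point_equiv_def point_preorder_def)
  show "refl_on (topspace T) (point_equiv T)"
    by (auto simp: refl_on_def point_equiv_def refl_point_preorder)
  show "sym (point_equiv T)"
    by (auto simp: sym_def point_equiv_def)
  show "trans (point_equiv T)"
    unfolding point_equiv_def using trans_point_preorder[of T]
    by (auto simp: trans_def)
qed

lemma associated_poset_class_iff:
  assumes "x \<in> topspace T" "y \<in> topspace T"
  shows "(point_class T x, point_class T y) \<in> associated_poset T \<longleftrightarrow> (x, y) \<in> point_preorder T"
proof
  assume "(x, y) \<in> point_preorder T"
  then show "(point_class T x, point_class T y) \<in> associated_poset T"
    using assms equiv_class_self[OF equiv_point_equiv assms(1)]
      equiv_class_self[OF equiv_point_equiv assms(2)]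
    unfolding associated_poset_def point_class_def by (blast intro: quotientI)
next
  assume "(point_class T x, point_class T y) \<in> associated_poset T"
  then obtain x' y' where "(x, x') \<in> point_equiv T" "(y, y') \<in> point_equiv T"
    "(x', y') \<in> point_preorder T"
    by (auto simp: associated_poset_def point_class_def)
  then show "(x, y) \<in> point_preorder T"
    using trans_point_preorder[of T] by (auto simp: point_equiv_def dest: transD)
qed

lemma Field_associated_poset: "Field (associated_poset T) = topspace T // point_equiv T"
proof
  show "Field (associated_poset T) \<subseteq> topspace T // point_equiv T"
    by (auto simp: associated_poset_def Field_def)
  show "topspace T // point_equiv T \<subseteq> Field (associated_poset T)"
    using associated_poset_class_iff[of _ T] refl_point_preorder[of _ T]
    unfolding quotient_def point_class_def by (blast intro: FieldI1)
qed

lemma partial_order_associated_poset: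
  "partial_order_on (Field (associated_poset T)) (associated_poset T)"
proof -
  have Q: "\<exists>x\<in>topspace T. A = point_class T x" if "A \<in> Field (associated_poset T)" for A
    using that by (auto simp: Field_associated_poset quotient_def point_class_def)
  have "antisym (associated_poset T)"
  proof (rule antisymI)
    fix A B assume h: "(A, B) \<in> associated_poset T" "(B, A) \<in> associated_poset T"
    obtain x y where "x \<in> topspace T" "y \<in> topspace T" "A = point_class T x" "B = point_class T y"
      using Q[OF FieldI1[OF h(1)]] Q[OF FieldI2[OF h(1)]] by auto
    moreover from this h have "(x, y) \<in> point_equiv T"
      by (auto simp: point_equiv_def associated_poset_class_iff)
    ultimately show "A = B"
      by (simp add: point_class_def equiv_class_eq[OF equiv_point_equiv])
  qed
  moreover have "trans (associated_poset T)"
  proof (rule transI)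
    fix A B C assume h: "(A, B) \<in> associated_poset T" "(B, C) \<in> associated_poset T"
    obtain x y z where xyz: "x \<in> topspace T" "y \<in> topspace T" "z \<in> topspace T"
      "A = point_class T x" "B = point_class T y" "C = point_class T z"
      using Q[OF FieldI1[OF h(1)]] Q[OF FieldI2[OF h(1)]] Q[OF FieldI2[OF h(2)]] by auto
    with h show "(A, C) \<in> associated_poset T"
      using trans_point_preorder[of T] by (auto simp: associated_poset_class_iff dest: transD)
  qed
  moreover have "refl_on (Field (associated_poset T)) (associated_poset T)"
    using Q associated_poset_class_iff[of _ T] refl_point_preorder[of _ T]
    by (metis refl_onI)
  moreover have "associated_poset T \<subseteq> Field (associated_poset T) \<times> Field (associated_poset T)"
    by (auto intro: FieldI1 FieldI2)
  ultimately show ?thesis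
    by (simp add: partial_order_on_def preorder_on_def)
qed

lemma point_preorder_continuous:
  assumes "continuous_map T T' f" "(x, y) \<in> point_preorder T"
  shows "(f x, f y) \<in> point_preorder T'"
proof -
  have xy: "x \<in> topspace T" "y \<in> topspace T"
    and m: "\<And>U. openin T U \<Longrightarrow> y \<in> U \<Longrightarrow> x \<in> U"
    using assms(2) by (auto simp: point_preorder_def minimal_open_def)
  have "f x \<in> V" if "openin T' V" "f y \<in> V" for V
    using m[OF openin_continuous_map_preimage[OF assms(1) that(1)]] xy that by auto
  moreover have "f x \<in> topspace T'" "f y \<in> topspace T'"
    using xy assms(1) continuous_map_image_subset_topspace by fastforce+
  ultimately show ?thesis
    by (auto simp: point_preorder_def minimal_open_def)
qed

lemma associated_map_class:
  assumes "continuous_map T T' f" "x \<in> topspace T"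
  shows "associated_map T' f (point_class T x) = point_class T' (f x)"
proof -
  have "x \<in> point_class T x"
    using assms(2) equiv_class_self[OF equiv_point_equiv] by (auto simp: point_class_def)
  have "point_class T' (f y) = point_class T' (f x)" if "y \<in> point_class T x" for y
  proof -
    have "(f y, f x) \<in> point_equiv T'"
      using that point_preorder_continuous[OF assms(1)]
      by (auto simp: point_class_def point_equiv_def)
    then show ?thesis
      by (simp add: point_class_def equiv_class_eq[OF equiv_point_equiv])
  qed
  then have "(\<lambda>y. point_class T' (f y)) ` point_class T x =
      (\<lambda>y. point_class T' (f x)) ` point_class T x"
    by (intro image_cong refl)
  also from \<open>x \<in> point_class T x\<close> have "(\<lambda>y. point_class T' (f x)) ` point_class T x = {point_class T' (f x)}"
    by (rule image_constant)
  finally have "(\<lambda>y. point_class T' (f y)) ` point_class T x = {point_class T' (f x)}" .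
  then show ?thesis
    by (simp add: associated_map_def)
qed

lemma simplicial_complex_order_complex: "simplicial_complex (order_complex r)"
  by (auto simp: simplicial_complex_def order_complex_def Chains_def intro: finite_subset)

lemma simplicial_map_associated_map:
  assumes "continuous_map T T' f"
  shows "simplicial_map (order_complex (associated_poset T)) (order_complex (associated_poset T'))
           (associated_map T' f)"
proof -
  have fT: "f x \<in> topspace T'" if "x \<in> topspace T" for x
    using that assms continuous_map_image_subset_topspace by fastforce
  have "(associated_map T' f A, associated_map T' f B) \<in> associated_poset T'"
    if h: "(A, B) \<in> associated_poset T" for A B
  proof -
    obtain x y where "x \<in> topspace T" "y \<in> topspace T" "A = point_class T x" "B = point_class T y"
      using h by (auto simp: associated_poset_def quotient_def point_class_def)
    then show ?thesis
      using h by (simp add: associated_map_class[OF assms] associated_poset_class_iff fT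
          point_preorder_continuous[OF assms])
  qed
  then show ?thesis
    by (fastforce simp: simplicial_map_def order_complex_def Chains_def)
qed

end

theory Submission
  imports Defs
begin

text \<open>
  For a finite poset with the topology of down-sets, McCord's map from tuples of comparable points to
  singular simplices is a natural chain map.  Its mapping cone is acyclic over principal down-sets,
  where both complexes can be coned off from the top element, and a Mayer--Vietoris argument passes
  from two down-sets and their intersection to their union; on the singular side this uses
  barycentric subdivision.  The same induction shows that a finite space and its associated poset have
  the same singular homology, and that the orientation relations form an acyclic complex, so that
  tuples and oriented simplices have the same homology.  Choosing representatives of the classes would
  not be natural in the topology, which is why the comparison is the zigzag
  \<open>S(X) \<rightarrow> S(P) \<leftarrow> C(P) \<rightarrow> C(P)/R\<close> of natural chain maps.
\<close>

section \<open>Linear algebra of chains\<close>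

text \<open>There is no direct chain map from oriented simplices to singular simplices: permuting a
  tuple permutes the coordinates of its singular simplex, and the two singular simplices do not
  cancel. All tuples are therefore kept until the relations are divided out by their acyclicity.
  Tuples also survive maps that merge vertices. In characteristic two the sign relations do not kill
  tuples with a repeated entry, so these get arguments of their own.

  A statement about isomorphisms on homology would call for a five lemma at each union. Acyclicity
  of the mapping cone is a single statement about elements, and it passes from two pieces and their
  intersection to the union once the quotient of the chains on the union by the sums of chains on
  the pieces is acyclic. This property, \<open>excisive\<close>, is trivial for tuples and for
  relations, is excision for singular chains, and is inherited by cones.

  Subdivision and its homotopy come from integral chains; extending their values on single simplices
  linearly carries them over to any field.\<close>

interpretation chain: vector_space chain_scale
  by (rule vector_space_chain_scale)

text \<open>Singular chains and tuple chains are both of this form, so splitting and mapping chains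
  is treated once.\<close>

definition chains_on :: "'b set \<Rightarrow> ('b \<Rightarrow>\<^sub>0 'k::field) set" where
  "chains_on S = {c. Poly_Mapping.keys c \<subseteq> S}"

lemma keys_chain_scale: "Poly_Mapping.keys (chain_scale a c) \<subseteq> Poly_Mapping.keys c"
  by (auto simp: in_keys_iff)

lemma chain_scale_single [simp]: "chain_scale a (Poly_Mapping.single b x) = Poly_Mapping.single b (a * x)"
  by (rule poly_mapping_eqI) (simp add: lookup_single when_def)

lemma subspace_chains_on: "chain.subspace (chains_on S)"
proof (rule chain.subspaceI)
  show "0 \<in> chains_on S"
    by (simp add: chains_on_def)
  show "x + y \<in> chains_on S" if "x \<in> chains_on S" "y \<in> chains_on S" for x y
    using that keys_add[of x y] by (auto simp: chains_on_def)
  show "chain_scale c x \<in> chains_on S" if "x \<in> chains_on S" for c x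
    using that keys_chain_scale[of c x] by (auto simp: chains_on_def)
qed

lemma chains_on_Int: "chains_on S \<inter> chains_on T = chains_on (S \<inter> T)"
  by (auto simp: chains_on_def)

lemma single_in_chains_on: "b \<in> S \<Longrightarrow> Poly_Mapping.single b a \<in> chains_on S"
  by (auto simp: chains_on_def)

lemma chain_extend_superset:
  assumes "finite S" "Poly_Mapping.keys c \<subseteq> S"
  shows "chain_extend f c = (\<Sum>b\<in>S. chain_scale (Poly_Mapping.lookup c b) (f b))"
  unfolding chain_extend_def
  by (rule sum.mono_neutral_left) (use assms in \<open>auto simp: in_keys_iff\<close>)

lemma chain_extend_add: "chain_extend f (c + d) = chain_extend f c + chain_extend f d"
proof -
  let ?S = "Poly_Mapping.keys c \<union> Poly_Mapping.keys d"
  have "Poly_Mapping.keys (c + d) \<subseteq> ?S"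
    by (rule keys_add)
  then show ?thesis
    by (simp add: chain_extend_superset[of ?S] lookup_add chain.scale_left_distrib sum.distrib)
qed

lemma chain_extend_scale: "chain_extend f (chain_scale a c) = chain_scale a (chain_extend f c)"
  by (simp add: chain_extend_superset[OF finite_keys keys_chain_scale] chain.scale_sum_right)
     (simp add: chain_extend_def chain.scale_sum_right)

lemma module_hom_chain_extend: "module_hom chain_scale chain_scale (chain_extend f)"
  by unfold_locales (simp_all add: chain_extend_add chain_extend_scale)

lemma chain_extend_0 [simp]: "chain_extend f 0 = 0"
  by (simp add: chain_extend_def)

lemma chain_extend_diff: "chain_extend f (c - d) = chain_extend f c - chain_extend f d"
  by (rule module_hom.diff[OF module_hom_chain_extend])

lemma chain_extend_sum: "chain_extend f (\<Sum>i\<in>I. g i) = (\<Sum>i\<in>I. chain_extend f (g i))"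
  by (rule module_hom.sum[OF module_hom_chain_extend])

lemma chain_extend_single [simp]: "chain_extend f (Poly_Mapping.single b a) = chain_scale a (f b)"
  by (cases "a = 0") (simp_all add: chain_extend_def)

lemma chain_extend_cong:
  assumes "\<And>b. b \<in> Poly_Mapping.keys c \<Longrightarrow> f b = g b"
  shows "chain_extend f c = chain_extend g c"
  unfolding chain_extend_def by (rule sum.cong) (simp_all add: assms)

lemma chain_extend_compose:
  "chain_extend f (chain_extend g c) = chain_extend (\<lambda>b. chain_extend f (g b)) c"
  by (simp add: chain_extend_def[of g] chain_extend_def[of "\<lambda>b. chain_extend f (g b)"]
      chain_extend_sum chain_extend_scale)

lemma chain_extend_fun_diff: "chain_extend (\<lambda>b. f b - g b) c = chain_extend f c - chain_extend g c"
  by (simp add: chain_extend_def chain.scale_right_diff_distrib sum_subtractf)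

lemma chain_extend_fun_add: "chain_extend (\<lambda>b. f b + g b) c = chain_extend f c + chain_extend g c"
  by (simp add: chain_extend_def chain.scale_right_distrib sum.distrib)

lemma chain_extend_fun_0 [simp]: "chain_extend (\<lambda>b. 0) c = 0"
  by (simp add: chain_extend_def)

lemma chain_extend_ident [simp]: "chain_extend (\<lambda>b. Poly_Mapping.single b 1) c = c"
proof (rule poly_mapping_eqI)
  fix k
  have "(\<Sum>b\<in>Poly_Mapping.keys c. Poly_Mapping.lookup c b when b = k) = Poly_Mapping.lookup c k"
    by (simp add: when_def in_keys_iff)
  then show "Poly_Mapping.lookup (chain_extend (\<lambda>b. Poly_Mapping.single b 1) c) k = Poly_Mapping.lookup c k"
    by (simp add: chain_extend_def lookup_sum lookup_single)
qed

lemma chain_extend_in_subspace: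
  assumes "chain.subspace W" "\<And>b. b \<in> Poly_Mapping.keys c \<Longrightarrow> f b \<in> W"
  shows "chain_extend f c \<in> W"
  unfolding chain_extend_def
  by (intro chain.subspace_sum chain.subspace_scale assms)

lemma chain_extend_in_chains_on:
  assumes "c \<in> chains_on S" "\<And>b. b \<in> S \<Longrightarrow> f b \<in> chains_on T"
  shows "chain_extend f c \<in> chains_on T"
  by (rule chain_extend_in_subspace[OF subspace_chains_on]) (use assms in \<open>auto simp: chains_on_def\<close>)

text \<open>Each basis element goes to one side; those in both sets are assigned to
  \<open>S\<close>.\<close>

lemma chains_on_UnE:
  assumes "c \<in> chains_on (S \<union> T)"
  obtains u v where "u \<in> chains_on S" "v \<in> chains_on T" "c = u + v"
proof
  let ?u = "chain_extend (\<lambda>b. if b \<in> S then Poly_Mapping.single b 1 else 0) c"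
  let ?v = "chain_extend (\<lambda>b. if b \<in> S then 0 else Poly_Mapping.single b 1) c"
  show "?u \<in> chains_on S"
    by (rule chain_extend_in_subspace[OF subspace_chains_on])
       (auto simp: chain.subspace_0[OF subspace_chains_on] single_in_chains_on)
  show "?v \<in> chains_on T"
    by (rule chain_extend_in_subspace[OF subspace_chains_on])
       (use assms in \<open>auto simp: chains_on_def\<close>)
  have "c = chain_extend (\<lambda>b. Poly_Mapping.single b 1) c"
    by simp
  also have "\<dots> = chain_extend (\<lambda>b. (if b \<in> S then Poly_Mapping.single b 1 else 0)
      + (if b \<in> S then 0 else Poly_Mapping.single b 1)) c"
    by (rule chain_extend_cong) auto
  finally show "c = ?u + ?v"
    by (simp add: chain_extend_fun_add)
qed

text \<open>Used to check on generators that a linear map carries relations to relations.\<close>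

lemma span_image_subset:
  assumes "module_hom chain_scale chain_scale h" "chain.subspace W" "\<And>x. x \<in> S \<Longrightarrow> h x \<in> W"
    and "x \<in> chain.span S"
  shows "h x \<in> W"
proof -
  have "h ` chain.span S = chain.span (h ` S)"
    by (rule module_hom.span_image[OF assms(1), symmetric])
  also have "\<dots> \<subseteq> W"
    by (rule chain.span_minimal) (use assms in auto)
  finally show ?thesis
    using assms(4) by auto
qed

section \<open>Families of chain complexes indexed by sets\<close>

text \<open>All groups \<open>G D n\<close> lie in one ambient group, so sums and common parts of
  two of them are literal. \<open>Int_subset\<close> is the exactness needed for Mayer-Vietoris: a
  chain supported on both pieces is supported on their intersection. By \<open>d_0\<close>, degree 0
  consists of cycles.\<close>

locale complex_family =
  fixes G :: "'p set \<Rightarrow> nat \<Rightarrow> 'g::ab_group_add set" and d :: "nat \<Rightarrow> 'g \<Rightarrow> 'g"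
  assumes zero_in: "0 \<in> G D n"
    and diff_in: "a \<in> G D n \<Longrightarrow> b \<in> G D n \<Longrightarrow> a - b \<in> G D n"
    and mono: "D \<subseteq> E \<Longrightarrow> G D n \<subseteq> G E n"
    and Int_subset: "G D n \<inter> G E n \<subseteq> G (D \<inter> E) n"
    and d_diff: "d n (a - b) = d n a - d n b"
    and d_in: "a \<in> G D (Suc n) \<Longrightarrow> d (Suc n) a \<in> G D n"
    and d_d: "a \<in> G D (Suc n) \<Longrightarrow> d n (d (Suc n) a) = 0"
    and d_0: "d 0 a = 0"
begin

lemma minus_in: "a \<in> G D n \<Longrightarrow> - a \<in> G D n"
  using diff_in[OF zero_in, of a D n] by simp

lemma add_in: "a \<in> G D n \<Longrightarrow> b \<in> G D n \<Longrightarrow> a + b \<in> G D n"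
  using diff_in[OF _ minus_in, of a D n b] by simp

lemma d_zero [simp]: "d n 0 = 0"
  using d_diff[of n 0 0] by simp

lemma d_minus: "d n (- a) = - d n a"
  using d_diff[of n 0 a] by simp

lemma d_add: "d n (a + b) = d n a + d n b"
  using d_diff[of n a "- b"] by (simp add: d_minus)

lemma mono_in: "a \<in> G D n \<Longrightarrow> D \<subseteq> E \<Longrightarrow> a \<in> G E n"
  using mono by blast

end

text \<open>Degree 0 is included, where every chain of a complex family is a cycle, so this is
  unreduced acyclicity. It suits cones and the relations, but not the singular chains of a nonempty
  space.\<close>

definition acyclic_at :: "('p set \<Rightarrow> nat \<Rightarrow> 'g::zero set) \<Rightarrow> (nat \<Rightarrow> 'g \<Rightarrow> 'g) \<Rightarrow> 'p set \<Rightarrow> bool" where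
  "acyclic_at G d D \<longleftrightarrow> (\<forall>n. \<forall>z\<in>G D n. d n z = 0 \<longrightarrow> (\<exists>w\<in>G D (Suc n). d (Suc n) w = z))"

text \<open>Equivalently, the quotient of the complex on \<open>E \<union> F\<close> by the sums of
  chains on \<open>E\<close> and on \<open>F\<close> is acyclic. For \<open>n = 0\<close> the
  truncated \<open>n - 1\<close> is harmless, because \<open>d 0\<close> vanishes in a complex
  family and 0 is such a sum.\<close>

definition excisive ::
  "('p set \<Rightarrow> nat \<Rightarrow> 'g::ab_group_add set) \<Rightarrow> (nat \<Rightarrow> 'g \<Rightarrow> 'g) \<Rightarrow> 'p set \<Rightarrow> 'p set \<Rightarrow> bool" where
  "excisive G d E F \<longleftrightarrow>
     (\<forall>n. \<forall>b\<in>G (E \<union> F) n. (\<exists>u\<in>G E (n - 1). \<exists>v\<in>G F (n - 1). d n b = u + v) \<longrightarrow>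
        (\<exists>w\<in>G (E \<union> F) (Suc n). \<exists>u\<in>G E n. \<exists>v\<in>G F n. b + d (Suc n) w = u + v))"

text \<open>Mayer-Vietoris on elements: the cycle is first made a sum of chains on the two pieces,
  and then the summands are made cycles separately.\<close>

lemma (in complex_family) acyclic_at_Un:
  assumes "excisive G d E F" and acE: "acyclic_at G d E" and acF: "acyclic_at G d F"
    and acEF: "acyclic_at G d (E \<inter> F)"
  shows "acyclic_at G d (E \<union> F)"
  unfolding acyclic_at_def
proof (intro allI ballI impI)
  fix n z assume z: "z \<in> G (E \<union> F) n" "d n z = 0"
  have "\<exists>u\<in>G E (n - 1). \<exists>v\<in>G F (n - 1). d n z = u + v"
    using z zero_in by force
  then obtain w u v where w: "w \<in> G (E \<union> F) (Suc n)" and uv: "u \<in> G E n" "v \<in> G F n" "z + d (Suc n) w = u + v"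
    using assms(1) z unfolding excisive_def by meson
  have "d n (z + d (Suc n) w) = 0"
    using z w by (simp add: d_add d_d)
  then have duv: "d n u = - d n v"
    by (simp add: uv d_add add_eq_0_iff)
  \<comment> \<open>The boundaries of \<open>u\<close> and \<open>v\<close> agree up to sign, hence
    lie on the intersection, and being cycles there they come from a chain \<open>e\<close> on it.
    Moving \<open>e\<close> from \<open>u\<close> to \<open>v\<close> turns both into
    cycles.\<close>
  have "\<exists>e\<in>G (E \<inter> F) n. d n e = d n u"
  proof (cases n)
    case 0
    then show ?thesis using d_0 zero_in by metis
  next
    case (Suc m)
    have "d n u \<in> G E m" "d n u \<in> G F m"
      using uv d_in[of u E m] d_in[of v F m] minus_in duv Suc by auto
    then have "d n u \<in> G (E \<inter> F) m"
      using Int_subset by blast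
    moreover have "d m (d n u) = 0"
      using uv d_d Suc by auto
    ultimately show ?thesis
      using acEF Suc unfolding acyclic_at_def by blast
  qed
  then obtain e where e: "e \<in> G (E \<inter> F) n" "d n e = d n u"
    by blast
  have "u - e \<in> G E n" "d n (u - e) = 0" "v + e \<in> G F n" "d n (v + e) = 0"
    using uv e mono_in[of e "E \<inter> F" n] by (auto intro!: diff_in add_in simp: d_diff d_add duv)
  then obtain a b where "a \<in> G E (Suc n)" "d (Suc n) a = u - e" "b \<in> G F (Suc n)" "d (Suc n) b = v + e"
    using acE acF unfolding acyclic_at_def by meson
  \<comment> \<open>The sum of \<open>u\<close> and \<open>v\<close> is \<open>z\<close> plus the
    boundary of \<open>w\<close>, so \<open>w\<close> is subtracted again.\<close>
  then have "a + b - w \<in> G (E \<union> F) (Suc n)" "d (Suc n) (a + b - w) = z"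
    using uv w mono_in[of _ _ "Suc n" "E \<union> F"]
    by (auto intro!: diff_in add_in simp: d_diff d_add algebra_simps)
  then show "\<exists>w\<in>G (E \<union> F) (Suc n). d (Suc n) w = z"
    by blast
qed

subsection \<open>Mapping cones\<close>

text \<open>The source of the map is shifted up by one degree against its target, so in degree 0 it
  contributes only 0.\<close>

definition cone_carrier ::
  "('p set \<Rightarrow> nat \<Rightarrow> 'g::zero set) \<Rightarrow> ('p set \<Rightarrow> nat \<Rightarrow> 'h set) \<Rightarrow> 'p set \<Rightarrow> nat \<Rightarrow> ('g \<times> 'h) set" where
  "cone_carrier G H D n = (case n of 0 \<Rightarrow> {0} | Suc m \<Rightarrow> G D m) \<times> H D n"

text \<open>The minus sign makes the two mixed terms of the squared differential cancel. Degree 0 is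
  separate because \<open>n - 1\<close> truncates.\<close>

definition cone_d ::
  "(nat \<Rightarrow> 'g::ab_group_add \<Rightarrow> 'g) \<Rightarrow> (nat \<Rightarrow> 'h::ab_group_add \<Rightarrow> 'h) \<Rightarrow> (nat \<Rightarrow> 'g \<Rightarrow> 'h) \<Rightarrow>
    nat \<Rightarrow> 'g \<times> 'h \<Rightarrow> 'g \<times> 'h" where
  "cone_d dG dH f n =
     (\<lambda>(a, b). if n = 0 then 0 else (- dG (n - 1) a, dH n b + f (n - 1) a))"

locale family_map = G: complex_family G dG + H: complex_family H dH
  for G :: "'p set \<Rightarrow> nat \<Rightarrow> 'g::ab_group_add set" and dG
    and H :: "'p set \<Rightarrow> nat \<Rightarrow> 'h::ab_group_add set" and dH +
  fixes f :: "nat \<Rightarrow> 'g \<Rightarrow> 'h"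
  assumes f_diff: "f n (a - b) = f n a - f n b"
    and f_in: "a \<in> G D n \<Longrightarrow> f n a \<in> H D n"
    and f_d: "a \<in> G D (Suc n) \<Longrightarrow> f n (dG (Suc n) a) = dH (Suc n) (f (Suc n) a)"
begin

abbreviation "mcone \<equiv> cone_carrier G H"
abbreviation "dmcone \<equiv> cone_d dG dH f"

lemma f_zero [simp]: "f n 0 = 0"
  using f_diff[of n 0 0] by simp

lemma f_minus: "f n (- a) = - f n a"
  using f_diff[of n 0 a] by simp

lemma f_add: "f n (a + b) = f n a + f n b"
  using f_diff[of n a "- b"] by (simp add: f_minus)

lemma complex_family_cone: "complex_family mcone dmcone"
proof
  fix D E :: "'p set" and n and a b :: "'g \<times> 'h"
  show "0 \<in> mcone D n"
    using G.zero_in H.zero_in by (auto simp: cone_carrier_def zero_prod_def split: nat.split)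
  show "a - b \<in> mcone D n" if "a \<in> mcone D n" "b \<in> mcone D n"
    using that G.diff_in H.diff_in by (auto simp: cone_carrier_def split: nat.splits)
  show "mcone D n \<subseteq> mcone E n" if "D \<subseteq> E"
    using G.mono[OF that] H.mono[OF that] by (cases n) (auto simp: cone_carrier_def)
  show "mcone D n \<inter> mcone E n \<subseteq> mcone (D \<inter> E) n"
    using G.Int_subset[of D "n - 1" E] H.Int_subset[of D n E]
    by (cases n) (auto simp: cone_carrier_def)
  show "dmcone n (a - b) = dmcone n a - dmcone n b"
    by (auto simp: cone_d_def G.d_diff H.d_diff f_diff split: prod.splits)
  show "dmcone (Suc n) a \<in> mcone D n" if "a \<in> mcone D (Suc n)"
    using that G.d_in H.d_in f_in
    by (cases n) (auto simp: cone_carrier_def cone_d_def G.d_0 intro!: G.minus_in H.add_in)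
  show "dmcone n (dmcone (Suc n) a) = 0" if "a \<in> mcone D (Suc n)"
    using that
    by (cases n) (auto simp: cone_carrier_def cone_d_def G.d_minus H.d_add G.d_d H.d_d f_minus f_d zero_prod_def)
  show "dmcone 0 a = 0"
    by (cases a) (simp add: cone_d_def)
qed

text \<open>The quotient of the cone by the small chains is the cone of the map between the two
  quotients, both acyclic. Concretely, the source component is made small first, because its image
  enters the boundary of the target component.\<close>

lemma excisive_cone:
  assumes "excisive G dG E F" "excisive H dH E F"
  shows "excisive mcone dmcone E F"
  unfolding excisive_def
proof (intro allI ballI impI)
  fix n z assume z: "z \<in> mcone (E \<union> F) n"
    and ex: "\<exists>u\<in>mcone E (n - 1). \<exists>v\<in>mcone F (n - 1). dmcone n z = u + v"
  show "\<exists>w\<in>mcone (E \<union> F) (Suc n). \<exists>u\<in>mcone E n. \<exists>v\<in>mcone F n. z + dmcone (Suc n) w = u + v"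
  proof (cases n)
    case 0
    then obtain b where b: "z = (0, b)" "b \<in> H (E \<union> F) 0"
      using z by (auto simp: cone_carrier_def)
    have "\<exists>u\<in>H E (0 - 1). \<exists>v\<in>H F (0 - 1). dH 0 b = u + v"
      using H.zero_in by (force simp: H.d_0)
    then obtain w u v where "w \<in> H (E \<union> F) 1" "u \<in> H E 0" "v \<in> H F 0" "b + dH 1 w = u + v"
      using assms(2) b(2) unfolding excisive_def by (metis One_nat_def)
    then show ?thesis
      by (intro bexI[of _ "(0, w)"] bexI[of _ "(0, u)"] bexI[of _ "(0, v)"])
         (auto simp: b 0 cone_carrier_def cone_d_def G.zero_in)
  next
    case (Suc m)
    then obtain a b where ab: "z = (a, b)" "a \<in> G (E \<union> F) m" "b \<in> H (E \<union> F) (Suc m)"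
      using z by (auto simp: cone_carrier_def)
    obtain u1 u2 v1 v2 where uv: "(u1, u2) \<in> mcone E m" "(v1, v2) \<in> mcone F m"
      and da: "- dG m a = u1 + v1" and db: "dH (Suc m) b + f m a = u2 + v2"
      using ex Suc ab(1) by (auto simp: cone_d_def)
    have "\<exists>u\<in>G E (m - 1). \<exists>v\<in>G F (m - 1). dG m a = u + v"
    proof (intro bexI)
      show "dG m a = - u1 + - v1"
        using da by (metis add.commute minus_add_distrib minus_minus)
      show "- u1 \<in> G E (m - 1)" "- v1 \<in> G F (m - 1)"
        using uv by (cases m; auto simp: cone_carrier_def G.zero_in G.minus_in)+
    qed
    then obtain w1 p1 q1 where w1: "w1 \<in> G (E \<union> F) (Suc m)"
      and p1: "p1 \<in> G E m" "q1 \<in> G F m" and eq1: "a + dG (Suc m) w1 = p1 + q1"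
      using assms(1) ab(2) unfolding excisive_def by meson
    text \<open>Subtracting the boundary of \<open>(w1, 0)\<close> replaces the first component by the small chain \<open>p1 + q1\<close>.\<close>
    define b' where "b' = b - f (Suc m) w1"
    have b': "b' \<in> H (E \<union> F) (Suc m)"
      unfolding b'_def using ab w1 by (intro H.diff_in f_in)
    have "f m (dG (Suc m) w1) = dH (Suc m) (f (Suc m) w1)"
      using w1 f_d by blast
    \<comment> \<open>The map \<open>f\<close> sends sums of chains on \<open>E\<close> and
      \<open>F\<close> to such sums, so once the source component is \<open>p1 + q1\<close> the
      boundary of \<open>b'\<close> is small and excision in the target applies.\<close>
    then have "dH (Suc m) b' = (u2 + v2) - f m (a + dG (Suc m) w1)"
      by (simp add: b'_def H.d_diff f_add flip: db)
    also have "\<dots> = (u2 - f m p1) + (v2 - f m q1)"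
      by (simp add: eq1 f_add)
    finally have "\<exists>u\<in>H E (Suc m - 1). \<exists>v\<in>H F (Suc m - 1). dH (Suc m) b' = u + v"
      using uv p1 f_in by (intro bexI[of _ "u2 - f m p1"] bexI[of _ "v2 - f m q1"])
        (auto simp: cone_carrier_def intro!: H.diff_in)
    then obtain w2 p2 q2 where w2: "w2 \<in> H (E \<union> F) (Suc (Suc m))"
      and p2: "p2 \<in> H E (Suc m)" "q2 \<in> H F (Suc m)" and eq2: "b' + dH (Suc (Suc m)) w2 = p2 + q2"
      using assms(2) b' unfolding excisive_def by meson
    show ?thesis
    proof (intro bexI)
      \<comment> \<open>\<open>w1\<close> enters negatively because the cone differential negates
        the boundary on the source component.\<close>
      show "z + dmcone (Suc n) (- w1, w2) = (p1, p2) + (q1, q2)"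
        using eq1 eq2 by (simp add: Suc ab cone_d_def G.d_minus f_minus b'_def algebra_simps)
      show "(- w1, w2) \<in> mcone (E \<union> F) (Suc n)"
        using w1 w2 G.minus_in by (simp add: Suc cone_carrier_def)
    qed (use p1 p2 in \<open>auto simp: Suc cone_carrier_def\<close>)
  qed
qed

text \<open>The pair \<open>(0, b)\<close> is a cycle of the cone. A chain bounding it consists of a
  cycle \<open>a\<close> of the source and a chain showing that \<open>b\<close> is homologous to
  the image of \<open>a\<close>.\<close>

lemma acyclic_cone_surj:
  assumes "acyclic_at mcone dmcone D" "b \<in> H D n" "dH n b = 0"
  obtains a w where "a \<in> G D n" "dG n a = 0" "w \<in> H D (Suc n)" "b = dH (Suc n) w + f n a"
proof -
  have "(0, b) \<in> mcone D n" "dmcone n (0, b) = 0"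
    using assms by (auto simp: cone_carrier_def cone_d_def G.zero_in zero_prod_def split: nat.split)
  then obtain a w where "(a, w) \<in> mcone D (Suc n)" "dmcone (Suc n) (a, w) = (0, b)"
    using assms(1) unfolding acyclic_at_def by (metis surj_pair)
  then show ?thesis
    by (intro that[of a w]) (auto simp: cone_carrier_def cone_d_def)
qed

text \<open>A chain \<open>w\<close> that exhibits the image of \<open>a\<close> as a boundary
  completes \<open>a\<close> to the cycle \<open>(a, - w)\<close> of the cone. The source component
  of a chain bounding it, negated, bounds \<open>a\<close>.\<close>

lemma acyclic_cone_inj:
  assumes "acyclic_at mcone dmcone D" "a \<in> G D n" "dG n a = 0" "w \<in> H D (Suc n)" "dH (Suc n) w = f n a"
  obtains v where "v \<in> G D (Suc n)" "dG (Suc n) v = a"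
proof -
  have "(a, - w) \<in> mcone D (Suc n)" "dmcone (Suc n) (a, - w) = 0"
    using assms by (auto simp: cone_carrier_def cone_d_def H.minus_in H.d_minus zero_prod_def)
  then obtain v w' where "(v, w') \<in> mcone D (Suc (Suc n))" "dmcone (Suc (Suc n)) (v, w') = (a, - w)"
    using assms(1) unfolding acyclic_at_def by (metis surj_pair)
  then show ?thesis
    by (intro that[of "- v"]) (auto simp: cone_carrier_def cone_d_def G.minus_in G.d_minus)
qed

end

text \<open>Vanishing of reduced homology: in degree 0 the kernel of the augmentation replaces the
  cycles.\<close>

definition aug_acyclic_at ::
  "('p set \<Rightarrow> nat \<Rightarrow> 'g::zero set) \<Rightarrow> (nat \<Rightarrow> 'g \<Rightarrow> 'g) \<Rightarrow> ('g \<Rightarrow> 'e::zero) \<Rightarrow> 'p set \<Rightarrow> bool" where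
  "aug_acyclic_at G d \<epsilon> D \<longleftrightarrow>
     (\<forall>n. \<forall>a\<in>G D n. (if n = 0 then \<epsilon> a = 0 else d n a = 0) \<longrightarrow> (\<exists>b\<in>G D (Suc n). d (Suc n) b = a))"

text \<open>The reduced homology of both complexes vanishes, and the augmentations, taking values in
  one common group, identify what remains in degree 0.\<close>

lemma (in family_map) acyclic_at_coneI:
  fixes \<epsilon>G :: "'g \<Rightarrow> 'e::ab_group_add" and \<epsilon>H :: "'h \<Rightarrow> 'e"
  assumes G: "aug_acyclic_at G dG \<epsilon>G D" and H: "aug_acyclic_at H dH \<epsilon>H D"
    and \<epsilon>f: "\<And>a. a \<in> G D 0 \<Longrightarrow> \<epsilon>H (f 0 a) = \<epsilon>G a"
    and \<epsilon>d: "\<And>b. b \<in> H D 1 \<Longrightarrow> \<epsilon>H (dH 1 b) = 0"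
    and \<epsilon>_diff: "\<And>a b. \<epsilon>H (a - b) = \<epsilon>H a - \<epsilon>H b"
    and surj: "\<And>b. b \<in> H D 0 \<Longrightarrow> \<exists>a\<in>G D 0. \<epsilon>G a = \<epsilon>H b"
  shows "acyclic_at mcone dmcone D"
  unfolding acyclic_at_def
proof (intro allI ballI impI)
  fix n z assume z: "z \<in> mcone D n" "dmcone n z = 0"
  have Gn: "\<exists>b\<in>G D (Suc n). dG (Suc n) b = a" if "a \<in> G D n" "if n = 0 then \<epsilon>G a = 0 else dG n a = 0" for a n
    using G that unfolding aug_acyclic_at_def by blast
  have Hn: "\<exists>b\<in>H D (Suc n). dH (Suc n) b = a" if "a \<in> H D n" "if n = 0 then \<epsilon>H a = 0 else dH n a = 0" for a n
    using H that unfolding aug_acyclic_at_def by blast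
  show "\<exists>w\<in>mcone D (Suc n). dmcone (Suc n) w = z"
  proof (cases n)
    case 0
    then obtain b where b: "z = (0, b)" "b \<in> H D 0"
      using z by (auto simp: cone_carrier_def)
    \<comment> \<open>Subtracting the image of a chain with the same augmentation puts
      \<open>b\<close> into the kernel of \<open>\<epsilon>H\<close>, where reduced acyclicity
      applies.\<close>
    obtain a where a: "a \<in> G D 0" "\<epsilon>G a = \<epsilon>H b"
      using surj[OF b(2)] by blast
    obtain w where "w \<in> H D 1" "dH 1 w = b - f 0 a"
      using Hn[of "b - f 0 a" 0] a b f_in[of a D 0] by (auto simp: \<epsilon>_diff \<epsilon>f H.diff_in)
    then show ?thesis
      using a by (intro bexI[of _ "(a, w)"]) (auto simp: b 0 cone_carrier_def cone_d_def G.d_0)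
  next
    case (Suc m)
    then obtain a b where ab: "z = (a, b)" "a \<in> G D m" "b \<in> H D (Suc m)"
      and da: "dG m a = 0" and db: "dH (Suc m) b = - f m a"
      using z by (auto simp: cone_carrier_def cone_d_def zero_prod_def add_eq_0_iff2)
    \<comment> \<open>For \<open>m = 0\<close> the cycle condition on \<open>a\<close> is empty; its
      augmentation vanishes because \<open>f 0 a\<close> is, up to sign, the boundary of
      \<open>b\<close>.\<close>
    have "if m = 0 then \<epsilon>G a = 0 else dG m a = 0"
    proof (cases "m = 0")
      case True
      have "\<epsilon>H (- f 0 a) = 0"
        using \<epsilon>d[of b] ab db True by simp
      then have "\<epsilon>H (f 0 a) = 0"
        using \<epsilon>_diff[of 0 "f 0 a"] \<epsilon>_diff[of 0 0] by simp
      then show ?thesis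
        using True ab \<epsilon>f[of a] by simp
    qed (use da in auto)
    then obtain a' where a': "a' \<in> G D (Suc m)" "dG (Suc m) a' = a"
      using Gn ab by blast
    have "b + f (Suc m) a' \<in> H D (Suc m)" "dH (Suc m) (b + f (Suc m) a') = 0"
      using ab a' f_in f_d[OF a'(1)] by (auto simp: H.add_in H.d_add db)
    then obtain w where "w \<in> H D (Suc (Suc m))" "dH (Suc (Suc m)) w = b + f (Suc m) a'"
      using Hn[of _ "Suc m"] by auto
    then show ?thesis
      using a' by (intro bexI[of _ "(- a', w)"])
        (auto simp: ab Suc cone_carrier_def cone_d_def G.minus_in G.d_minus f_minus)
  qed
qed

subsection \<open>Induction over down-sets of a finite poset\<close>

definition down_sets :: "'p rel \<Rightarrow> 'p set set" where
  "down_sets r = {U. U \<subseteq> Field r \<and> (\<forall>x\<in>U. \<forall>y. (y, x) \<in> r \<longrightarrow> y \<in> U)}"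

lemma down_sets_Int: "E \<in> down_sets r \<Longrightarrow> F \<in> down_sets r \<Longrightarrow> E \<inter> F \<in> down_sets r"
  by (auto simp: down_sets_def)

text \<open>A maximal point \<open>x\<close> of \<open>D\<close> is split off: \<open>D\<close> is
  the union of the principal down-set of \<open>x\<close> and of \<open>D - {x}\<close>. Both of
  these, and their intersection, have fewer points unless \<open>D\<close> is itself
  principal.\<close>

lemma down_sets_induct [consumes 3, case_names empty principal Un]:
  assumes "finite (Field r)" "partial_order_on (Field r) r" "D \<in> down_sets r"
    and empty: "P {}"
    and principal: "\<And>x. x \<in> Field r \<Longrightarrow> P (r\<inverse> `` {x})"
    and Un: "\<And>E F. E \<in> down_sets r \<Longrightarrow> F \<in> down_sets r \<Longrightarrow> P E \<Longrightarrow> P F \<Longrightarrow> P (E \<inter> F) \<Longrightarrow> P (E \<union> F)"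
  shows "P D"
  using assms(3)
proof (induction "card D" arbitrary: D rule: less_induct)
  case less
  have r: "refl_on (Field r) r" "trans r" "antisym r"
    using assms(2) by (auto simp: partial_order_on_def preorder_on_def)
  have fin: "finite D"
    using less.prems assms(1) by (auto simp: down_sets_def intro: finite_subset)
  show ?case
  proof (cases "D = {}")
    case False
    \<comment> \<open>On the finite set \<open>D\<close> the reversed strict order is well-founded,
      which provides a maximal element.\<close>
    have "wf ((r - Id)\<inverse> \<inter> D \<times> D)"
    proof (rule finite_acyclic_wf)
      show "finite ((r - Id)\<inverse> \<inter> D \<times> D)"
        using fin by auto
      have "trans (r - Id)"
        using r by (auto simp: trans_def antisym_def)
      then have "acyclic ((r - Id)\<inverse>)"
        unfolding acyclic_converse by (simp add: acyclic_def)
      then show "acyclic ((r - Id)\<inverse> \<inter> D \<times> D)"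
        by (rule acyclic_subset) auto
    qed
    then obtain x where "x \<in> D" "\<And>y. (y, x) \<in> (r - Id)\<inverse> \<inter> D \<times> D \<Longrightarrow> y \<notin> D"
      using False by (meson wfE_min')
    then have x: "x \<in> D" "\<And>y. y \<in> D \<Longrightarrow> (x, y) \<in> r \<Longrightarrow> y = x"
      by blast+
    let ?U = "r\<inverse> `` {x}"
    have xF: "x \<in> Field r"
      using x(1) less.prems unfolding down_sets_def by blast
    have "x \<in> ?U"
      using r(1) xF by (auto simp: refl_on_def)
    moreover have "?U \<subseteq> D"
      using x(1) less.prems unfolding down_sets_def by blast
    moreover have "?U \<in> down_sets r"
      unfolding down_sets_def using transD[OF r(2)] by (blast intro: FieldI1)
    ultimately have U: "?U \<in> down_sets r" "?U \<subseteq> D" "x \<in> ?U"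
      by blast+
    have F: "D - {x} \<in> down_sets r"
      using x less.prems unfolding down_sets_def by blast
    have D: "D = ?U \<union> (D - {x})"
      using U by auto
    show ?thesis
    proof (cases "?U = D")
      case True
      then show ?thesis
        using principal[OF xF] by simp
    next
      case False
      then have cU: "card ?U < card D"
        by (intro psubset_card_mono fin) (use U(2) in blast)
      have cF: "card (D - {x}) < card D"
        by (rule card_Diff1_less[OF fin x(1)])
      have "card (?U \<inter> (D - {x})) \<le> card (D - {x})"
        by (rule card_mono) (use fin in auto)
      from le_less_trans[OF this cF] have "P (?U \<inter> (D - {x}))"
        by (rule less.hyps[OF _ down_sets_Int[OF U(1) F]])
      with less.hyps[OF cU U(1)] less.hyps[OF cF F] have "P (?U \<union> (D - {x}))"
        by (intro Un[OF U(1) F])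
      then show ?thesis
        by (subst D)
    qed
qed (use empty in simp)
qed

lemma (in complex_family) acyclic_on_down_sets:
  assumes "finite (Field r)" "partial_order_on (Field r) r" "D \<in> down_sets r"
    and "\<And>n. G {} n \<subseteq> {0}"
    and "\<And>x. x \<in> Field r \<Longrightarrow> acyclic_at G d (r\<inverse> `` {x})"
    and "\<And>E F. E \<in> down_sets r \<Longrightarrow> F \<in> down_sets r \<Longrightarrow> excisive G d E F"
  shows "acyclic_at G d D"
  using assms(1-3)
proof (induction D rule: down_sets_induct)
  case empty
  have "G {} n = {0}" for n
    using assms(4)[of n] zero_in[of "{}" n] by blast
  then show ?case
    by (simp add: acyclic_at_def)
qed (use assms acyclic_at_Un in blast)+

section \<open>Singular chains over a field\<close>

subsection \<open>Base change of integral chains\<close>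

text \<open>Base change along the ring map from the integers, through which operators on integral
  singular chains and their identities are transported to \<open>'k\<close>.\<close>

definition of_int_chain :: "('b \<Rightarrow>\<^sub>0 int) \<Rightarrow> ('b \<Rightarrow>\<^sub>0 'k::field)" where
  "of_int_chain c = Poly_Mapping.map of_int c"

lemma lookup_of_int_chain [simp]:
  "Poly_Mapping.lookup (of_int_chain c) b = of_int (Poly_Mapping.lookup c b)"
  by (simp add: of_int_chain_def Poly_Mapping.map.rep_eq when_def)

lemma keys_of_int_chain: "Poly_Mapping.keys (of_int_chain c) \<subseteq> Poly_Mapping.keys c"
  by (auto simp: in_keys_iff)

lemma of_int_chain_0 [simp]: "of_int_chain 0 = 0"
  by (rule poly_mapping_eqI) simp

lemma of_int_chain_add: "of_int_chain (c + d) = of_int_chain c + of_int_chain d"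
  by (rule poly_mapping_eqI) (simp add: lookup_add)

lemma of_int_chain_diff: "of_int_chain (c - d) = of_int_chain c - of_int_chain d"
  by (rule poly_mapping_eqI) (simp add: lookup_minus)

lemma of_int_chain_sum: "of_int_chain (\<Sum>i\<in>I. f i) = (\<Sum>i\<in>I. of_int_chain (f i))"
  by (induction I rule: infinite_finite_induct) (simp_all add: of_int_chain_add)

lemma of_int_chain_cmul: "of_int_chain (frag_cmul a c) = chain_scale (of_int a) (of_int_chain c)"
  by (rule poly_mapping_eqI) simp

lemma of_int_chain_of [simp]: "of_int_chain (frag_of b) = Poly_Mapping.single b 1"
  by (rule poly_mapping_eqI) (simp add: lookup_single when_def)

lemma chain_extend_of_int_chain:
  assumes "\<And>b. b \<in> Poly_Mapping.keys c \<Longrightarrow> F b = of_int_chain (f b)"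
  shows "chain_extend F (of_int_chain c) = of_int_chain (frag_extend f c)"
  by (simp add: chain_extend_superset[OF finite_keys keys_of_int_chain] frag_extend_def
      of_int_chain_sum of_int_chain_cmul assms)

text \<open>Integral chains form a free abelian group, so an additive map is determined on basis
  elements.\<close>

lemma frag_extend_additive:
  assumes "\<And>c1 c2. h (c1 - c2) = h c1 - h c2"
  shows "h c = frag_extend (\<lambda>b. h (frag_of b)) c"
proof -
  have "Poly_Mapping.keys c \<subseteq> UNIV"
    by simp
  then show ?thesis
  proof (induction c rule: frag_induction)
    case zero
    then show ?case
      using assms[of 0 0] by simp
  qed (simp_all add: assms frag_extend_diff)
qed

text \<open>Linear over \<open>'k\<close> by construction; additivity of \<open>h\<close> is what
  makes it agree with \<open>h\<close> on integral chains.\<close>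

definition base_change ::
  "(('b \<Rightarrow>\<^sub>0 int) \<Rightarrow> ('c \<Rightarrow>\<^sub>0 int)) \<Rightarrow> ('b \<Rightarrow>\<^sub>0 'k::field) \<Rightarrow> ('c \<Rightarrow>\<^sub>0 'k)" where
  "base_change h = chain_extend (\<lambda>b. of_int_chain (h (frag_of b)))"

lemma base_change_of_int_chain:
  assumes "\<And>c1 c2. h (c1 - c2) = h c1 - h c2"
  shows "base_change h (of_int_chain c) = of_int_chain (h c)"
  unfolding base_change_def
  by (subst frag_extend_additive[of h c]) (simp_all add: assms chain_extend_of_int_chain)

subsection \<open>The boundary operator\<close>

definition sboundary_simplex :: "nat \<Rightarrow> ((nat \<Rightarrow> real) \<Rightarrow> 'a) \<Rightarrow> ('a, 'k::field) schain" where
  "sboundary_simplex n \<sigma> =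
     (if n = 0 then 0 else \<Sum>k\<le>n. Poly_Mapping.single (singular_face n k \<sigma>) ((-1) ^ k))"

lemma sboundary_eq: "sboundary n = chain_extend (sboundary_simplex n)"
  by (rule ext) (simp add: sboundary_def sboundary_simplex_def[abs_def] del: sum.atMost_Suc)

lemma sboundary_simplex_eq_of_int_chain:
  "sboundary_simplex n \<sigma> = of_int_chain (chain_boundary n (frag_of \<sigma>))"
  by (simp add: sboundary_simplex_def chain_boundary_of of_int_chain_sum of_int_chain_cmul)

lemma sboundary_eq_base_change: "sboundary n = base_change (chain_boundary n)"
  by (simp add: sboundary_eq base_change_def flip: sboundary_simplex_eq_of_int_chain)

lemma sboundary_of_int_chain: "sboundary n (of_int_chain c) = of_int_chain (chain_boundary n c)"
  by (simp add: sboundary_eq_base_change base_change_of_int_chain chain_boundary_diff)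

lemma sboundary_diff: "sboundary n (a - b) = sboundary n a - sboundary n b"
  by (simp add: sboundary_eq chain_extend_diff)

lemma schains_eq: "schains n X = chains_on (singular_simplex_set n X)"
  by (simp add: schains_def chains_on_def)

lemma subspace_schains: "chain.subspace (schains n X)"
  by (simp add: schains_eq subspace_chains_on)

lemma of_int_chain_in_schains: "singular_chain n X c \<Longrightarrow> of_int_chain c \<in> schains n X"
  using keys_of_int_chain[of c] by (auto simp: singular_chain_def schains_def)

lemma sboundary_in_schains: "c \<in> schains (Suc n) X \<Longrightarrow> sboundary (Suc n) c \<in> schains n X"
  unfolding sboundary_eq
proof (rule chain_extend_in_subspace[OF subspace_schains])
  fix \<sigma> assume "c \<in> schains (Suc n) X" "\<sigma> \<in> Poly_Mapping.keys c"
  then have "singular_chain (Suc n) X (frag_of \<sigma>)"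
    by (auto simp: schains_def singular_chain_of)
  then show "sboundary_simplex (Suc n) \<sigma> \<in> schains n X"
    by (simp add: sboundary_simplex_eq_of_int_chain of_int_chain_in_schains singular_chain_boundary_alt)
qed

lemma sboundary_sboundary: "c \<in> schains (Suc n) X \<Longrightarrow> sboundary n (sboundary (Suc n) c) = 0"
proof -
  assume c: "c \<in> schains (Suc n) X"
  have "sboundary n (sboundary (Suc n) c) = chain_extend (\<lambda>\<sigma>. sboundary n (sboundary_simplex (Suc n) \<sigma>)) c"
    by (simp add: sboundary_eq chain_extend_compose)
  also have "\<dots> = chain_extend (\<lambda>\<sigma>. 0) c"
  proof (rule chain_extend_cong)
    fix \<sigma> assume "\<sigma> \<in> Poly_Mapping.keys c"
    then have "singular_chain (Suc n) X (frag_of \<sigma>)"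
      using c by (auto simp: schains_def singular_chain_of)
    then show "sboundary n (sboundary_simplex (Suc n) \<sigma>) = 0"
      by (simp add: sboundary_simplex_eq_of_int_chain sboundary_of_int_chain chain_boundary_boundary_alt)
  qed
  finally show ?thesis
    by simp
qed

definition schain_map :: "nat \<Rightarrow> ('a \<Rightarrow> 'b) \<Rightarrow> ('a, 'k::field) schain \<Rightarrow> ('b, 'k) schain" where
  "schain_map n f = chain_extend (\<lambda>\<sigma>. Poly_Mapping.single (simplex_map n f \<sigma>) 1)"

lemma schain_map_in_schains:
  "c \<in> schains n X \<Longrightarrow> continuous_map X Y f \<Longrightarrow> schain_map n f c \<in> schains n Y"
  unfolding schain_map_def schains_eq
  by (rule chain_extend_in_chains_on) (auto intro!: single_in_chains_on singular_simplex_simplex_map)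

lemma singular_face_simplex_map_eq:
  "k \<le> Suc n \<Longrightarrow> singular_face (Suc n) k (simplex_map (Suc n) f \<sigma>) = simplex_map n f (singular_face (Suc n) k \<sigma>)"
  by (simp add: singular_face_simplex_map) (auto simp: simplex_map_def singular_face_def)

lemma schain_map_sboundary:
  "schain_map n f (sboundary (Suc n) c) = sboundary (Suc n) (schain_map (Suc n) f c)"
  unfolding schain_map_def sboundary_eq chain_extend_compose
  by (rule chain_extend_cong)
     (simp add: sboundary_simplex_def chain_extend_sum singular_face_simplex_map_eq del: sum.atMost_Suc)

subsection \<open>Excision\<close>

text \<open>Let \<open>s\<close> be the subdivided chain and \<open>h\<close> the subdivision
  homotopy. Then \<open>c\<close> plus the boundary of \<open>h c\<close> equals \<open>s\<close>
  minus \<open>h\<close> of the boundary of \<open>c\<close>. The first term splits after enough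
  subdivisions; the second splits because the boundary of \<open>c\<close> does and \<open>h\<close>
  respects subspaces.\<close>

lemma schains_excision:
  assumes "openin X A" "openin X B" "topspace X \<subseteq> A \<union> B"
    and c: "c \<in> schains n X"
    and u: "u \<in> schains (n - 1) (subtopology X A)" and v: "v \<in> schains (n - 1) (subtopology X B)"
    and duv: "sboundary n c = u + v"
  obtains w p q where "w \<in> schains (Suc n) X" "p \<in> schains n (subtopology X A)"
    "q \<in> schains n (subtopology X B)" "c + sboundary (Suc n) w = p + q"
proof -
  have "\<exists>N. \<forall>m\<ge>N. \<forall>\<tau>\<in>Poly_Mapping.keys ((singular_subdivision n ^^ m) (frag_of \<sigma>)).
      \<exists>V\<in>{A, B}. \<tau> \<in> standard_simplex n \<rightarrow> V"
    if \<sigma>: "\<sigma> \<in> Poly_Mapping.keys c" for \<sigma>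
  proof -
    have "singular_chain n X (frag_of \<sigma>)"
      using that c by (auto simp: schains_def singular_chain_of)
    then show ?thesis
      using assms(1-3) sufficient_iterated_singular_subdivision_exists[of "{A, B}" X n "frag_of \<sigma>"]
      by (metis Union_insert Union_empty Un_empty_right insert_iff singletonD)
  qed
  then obtain N where N: "\<And>\<sigma> m \<tau>. \<sigma> \<in> Poly_Mapping.keys c \<Longrightarrow> N \<sigma> \<le> m \<Longrightarrow>
      \<tau> \<in> Poly_Mapping.keys ((singular_subdivision n ^^ m) (frag_of \<sigma>)) \<Longrightarrow>
      \<exists>V\<in>{A, B}. \<tau> \<in> standard_simplex n \<rightarrow> V"
    by metis
  \<comment> \<open>The sum bounds every \<open>N \<sigma>\<close>, giving one number of
    subdivisions that works for all simplices of \<open>c\<close>.\<close>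
  define M where "M = (\<Sum>\<sigma>\<in>Poly_Mapping.keys c. N \<sigma>)"
  have M: "N \<sigma> \<le> M" if "\<sigma> \<in> Poly_Mapping.keys c" for \<sigma>
    unfolding M_def using that by (intro member_le_sum) auto
  \<comment> \<open>One operator \<open>h\<close> serves all spaces at once, which is why it keeps
    chains of a subspace inside that subspace.\<close>
  obtain h where "\<And>p. h p 0 = (0 :: 'a chain)"
    and h_diff: "\<And>p c1 c2. h p (c1 - c2) = h p c1 - h p c2"
    and h_in: "\<And>p X c. singular_chain p X c \<Longrightarrow> singular_chain (Suc p) X (h p c)"
    and h_eq: "\<And>p X c. singular_chain p X c \<Longrightarrow>
        chain_boundary (Suc p) (h p c) + h (p - Suc 0) (chain_boundary p c) =
        (singular_subdivision p ^^ M) c - c"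
    by (rule chain_homotopic_iterated_singular_subdivision[where n = M and 'a = 'a]; rule that)
  define w where "w = base_change (h n) c"
  define s where "s = base_change (singular_subdivision n ^^ M) c"
  have bh: "base_change (h m) z \<in> schains (Suc m) Y" if "z \<in> schains m Y" for m Y and z :: "('a, 'b) schain"
    unfolding base_change_def
  proof (rule chain_extend_in_subspace[OF subspace_schains])
    fix \<sigma> assume "\<sigma> \<in> Poly_Mapping.keys z"
    then have "singular_chain m Y (frag_of \<sigma>)"
      using that by (auto simp: schains_def singular_chain_of)
    then show "of_int_chain (h m (frag_of \<sigma>)) \<in> schains (Suc m) Y"
      by (intro of_int_chain_in_schains h_in)
  qed
  have w: "w \<in> schains (Suc n) X"
    unfolding w_def by (rule bh[OF c])
  have eq: "c + sboundary (Suc n) w = s - base_change (h (n - 1)) (sboundary n c)"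
  proof -
    have "sboundary (Suc n) w = chain_extend (\<lambda>\<sigma>. sboundary (Suc n) (of_int_chain (h n (frag_of \<sigma>)))) c"
      by (simp add: w_def base_change_def sboundary_eq chain_extend_compose)
    also have "\<dots> = chain_extend (\<lambda>\<sigma>. (of_int_chain ((singular_subdivision n ^^ M) (frag_of \<sigma>)) - Poly_Mapping.single \<sigma> 1)
        - base_change (h (n - 1)) (sboundary_simplex n \<sigma>)) c"
    proof (rule chain_extend_cong)
      fix \<sigma> assume "\<sigma> \<in> Poly_Mapping.keys c"
      then have "singular_chain n X (frag_of \<sigma>)"
        using c by (auto simp: schains_def singular_chain_of)
      from h_eq[OF this] have "chain_boundary (Suc n) (h n (frag_of \<sigma>)) =
          (singular_subdivision n ^^ M) (frag_of \<sigma>) - frag_of \<sigma> - h (n - 1) (chain_boundary n (frag_of \<sigma>))"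
        by (simp add: algebra_simps)
      then show "sboundary (Suc n) (of_int_chain (h n (frag_of \<sigma>))) =
          (of_int_chain ((singular_subdivision n ^^ M) (frag_of \<sigma>)) - Poly_Mapping.single \<sigma> 1)
          - base_change (h (n - 1)) (sboundary_simplex n \<sigma>)"
        by (simp add: sboundary_of_int_chain of_int_chain_diff sboundary_simplex_eq_of_int_chain
            base_change_of_int_chain h_diff)
    qed
    also have "\<dots> = s - c - base_change (h (n - 1)) (sboundary n c)"
      unfolding chain_extend_fun_diff
      by (simp add: s_def base_change_def sboundary_eq chain_extend_compose)
    finally show ?thesis
      by simp
  qed
  have "s \<in> chains_on (singular_simplex_set n (subtopology X A) \<union> singular_simplex_set n (subtopology X B))"
    unfolding s_def base_change_def
  proof (rule chain_extend_in_subspace[OF subspace_chains_on])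
    fix \<sigma> assume \<sigma>: "\<sigma> \<in> Poly_Mapping.keys c"
    have "singular_chain n X ((singular_subdivision n ^^ m) (frag_of \<sigma>))" for m
      by (induction m) (use \<sigma> c in \<open>auto simp: schains_def singular_chain_of singular_chain_singular_subdivision\<close>)
    then have "Poly_Mapping.keys ((singular_subdivision n ^^ M) (frag_of \<sigma>)) \<subseteq> singular_simplex_set n X"
      by (simp add: singular_chain_def)
    then have "Poly_Mapping.keys ((singular_subdivision n ^^ M) (frag_of \<sigma>)) \<subseteq>
        singular_simplex_set n (subtopology X A) \<union> singular_simplex_set n (subtopology X B)"
      using N[OF \<sigma> M[OF \<sigma>]] unfolding singular_simplex_subtopology image_subset_iff_funcset by blast
    then show "of_int_chain ((singular_subdivision n ^^ M) (frag_of \<sigma>)) \<in>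
        chains_on (singular_simplex_set n (subtopology X A) \<union> singular_simplex_set n (subtopology X B))"
      unfolding chains_on_def by (intro CollectI subset_trans[OF keys_of_int_chain])
  qed
  then obtain p q where pq: "p \<in> schains n (subtopology X A)" "q \<in> schains n (subtopology X B)" "s = p + q"
    unfolding schains_eq by (rule chains_on_UnE)
  \<comment> \<open>In degree 0 the boundary of \<open>c\<close> vanishes and with it the correction
    term; in higher degrees \<open>u\<close> and \<open>v\<close> live one degree below
    \<open>c\<close>, and \<open>h\<close> lifts them back to degree \<open>n\<close>.\<close>
  show ?thesis
  proof (cases n)
    case 0
    then show ?thesis
      using that[of w p q] w pq eq by (simp add: sboundary_def base_change_def)
  next
    case (Suc m)
    let ?u = "base_change (h m) u" and ?v = "base_change (h m) v"
    have "?u \<in> schains n (subtopology X A)" "?v \<in> schains n (subtopology X B)"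
      using bh u v Suc by auto
    moreover have "base_change (h (n - 1)) (sboundary n c) = ?u + ?v"
      using duv Suc by (simp add: base_change_def chain_extend_add)
    ultimately show ?thesis
      using that[of w "p - ?u" "q - ?v"] w pq eq
      by (simp add: chain.subspace_diff[OF subspace_schains])
  qed
qed

subsection \<open>Coning\<close>

text \<open>The sum of the coefficients. It takes values in chains on a one-element basis, a copy of
  the field, so that it is itself a \<open>chain_extend\<close>.\<close>

definition augment :: "('b \<Rightarrow>\<^sub>0 'k::field) \<Rightarrow> (unit \<Rightarrow>\<^sub>0 'k)" where
  "augment = chain_extend (\<lambda>_. Poly_Mapping.single () 1)"

lemma augment_diff: "augment (a - b) = augment a - augment b"
  by (simp add: augment_def chain_extend_diff)

lemma augment_chain_extend_single: "augment (chain_extend (\<lambda>b. Poly_Mapping.single (f b) 1) c) = augment c"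
  by (simp add: augment_def chain_extend_compose)

text \<open>Coning off basis elements is a contracting homotopy: the boundary of a cone is its base
  minus the cone on the boundary of the base. In degree 0 the subtracted term is the apex
  \<open>v\<close>, counted by the augmentation. The instances are joins of singular simplices and
  prepending an entry to tuples.\<close>

lemma acyclic_by_coning:
  fixes bd :: "nat \<Rightarrow> 'b \<Rightarrow> ('b \<Rightarrow>\<^sub>0 'k::field)"
  assumes \<kappa>: "\<And>n b. b \<in> B n \<Longrightarrow> \<kappa> n b \<in> B (Suc n)"
    and bd0: "\<And>b. b \<in> B 0 \<Longrightarrow> bd (Suc 0) (\<kappa> 0 b) = Poly_Mapping.single b 1 - Poly_Mapping.single v 1"
    and bd: "\<And>n b. b \<in> B (Suc n) \<Longrightarrow> bd (Suc (Suc n)) (\<kappa> (Suc n) b) =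
        Poly_Mapping.single b 1 - chain_extend (\<lambda>b. Poly_Mapping.single (\<kappa> n b) 1) (bd (Suc n) b)"
    and a: "a \<in> chains_on (B n)" "if n = 0 then augment a = 0 else chain_extend (bd n) a = 0"
  shows "\<exists>b\<in>chains_on (B (Suc n)). chain_extend (bd (Suc n)) b = a"
proof
  let ?h = "\<lambda>n. chain_extend (\<lambda>b. Poly_Mapping.single (\<kappa> n b) (1::'k))"
  have keys: "b \<in> B n" if "b \<in> Poly_Mapping.keys a" for b
    using a(1) that by (auto simp: chains_on_def)
  show "?h n a \<in> chains_on (B (Suc n))"
    by (rule chain_extend_in_chains_on[OF a(1)]) (simp add: \<kappa> single_in_chains_on)
  show "chain_extend (bd (Suc n)) (?h n a) = a"
  proof (cases n)
    case 0
    have "chain_extend (bd (Suc n)) (?h n a) =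
        chain_extend (\<lambda>b. Poly_Mapping.single b 1 - Poly_Mapping.single v 1) a"
      unfolding chain_extend_compose by (rule chain_extend_cong) (use keys in \<open>simp add: bd0 0\<close>)
    also have "\<dots> = a - chain_extend (\<lambda>_. Poly_Mapping.single v 1) (augment a)"
      by (simp add: chain_extend_fun_diff augment_def chain_extend_compose)
    finally show ?thesis
      using a(2) 0 by simp
  next
    case (Suc m)
    have "chain_extend (bd (Suc n)) (?h n a) =
        chain_extend (\<lambda>b. Poly_Mapping.single b 1 - ?h m (bd n b)) a"
      unfolding chain_extend_compose by (rule chain_extend_cong) (use keys in \<open>simp add: bd Suc\<close>)
    also have "\<dots> = a - ?h m (chain_extend (bd n) a)"
      by (simp add: chain_extend_fun_diff chain_extend_compose)
    finally show ?thesis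
      using a(2) Suc by simp
  qed
qed

text \<open>The apex is vertex 0, so that face 0 returns \<open>\<sigma>\<close> with a plus sign.
  Away from the apex the other barycentric coordinates are rescaled to sum to 1.\<close>

definition simplex_join :: "'a \<Rightarrow> nat \<Rightarrow> ((nat \<Rightarrow> real) \<Rightarrow> 'a) \<Rightarrow> (nat \<Rightarrow> real) \<Rightarrow> 'a" where
  "simplex_join v n \<sigma> =
     restrict (\<lambda>t. if t 0 = 1 then v else \<sigma> (\<lambda>i. t (Suc i) / (1 - t 0))) (standard_simplex (Suc n))"

lemma standard_simplex_shrink:
  assumes t: "t \<in> standard_simplex (Suc n)" "t 0 \<noteq> 1"
  shows "(\<lambda>i. t (Suc i) / (1 - t 0)) \<in> standard_simplex n"
proof -
  have nonneg: "0 \<le> t i" for i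
    using t by (auto simp: standard_simplex_def)
  have t0: "t 0 < 1"
    using t by (auto simp: standard_simplex_def order.strict_iff_order)
  have "(\<Sum>i\<le>Suc n. t i) = 1"
    using t by (simp add: standard_simplex_def)
  then have sum: "(\<Sum>i\<le>n. t (Suc i)) = 1 - t 0"
    by (simp add: sum.atMost_Suc_shift del: sum.atMost_Suc)
  have zero: "t (Suc i) = 0" if "i > n" for i
    using t that by (auto simp: standard_simplex_def)
  have "t (Suc i) \<le> 1 - t 0" for i
  proof (cases "i \<le> n")
    case True
    then show ?thesis
      unfolding sum[symmetric] by (intro member_le_sum) (auto simp: nonneg)
  qed (use zero t0 in auto)
  then show ?thesis
    using t0 by (auto simp: standard_simplex_def nonneg zero sum simp flip: sum_divide_distrib)
qed

text \<open>Continuity at the apex costs nothing, since every open set containing \<open>v\<close>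
  is the whole space. Elsewhere the join is \<open>\<sigma>\<close> after a continuous rescaling,
  defined on the open set where coordinate 0 differs from 1.\<close>

lemma singular_simplex_join:
  assumes \<sigma>: "singular_simplex n X \<sigma>" and v: "v \<in> topspace X"
    and only: "\<And>U. openin X U \<Longrightarrow> v \<in> U \<Longrightarrow> U = topspace X"
  shows "singular_simplex (Suc n) X (simplex_join v n \<sigma>)"
proof -
  let ?S = "subtopology (powertop_real UNIV) (standard_simplex (Suc n))"
  let ?W = "{t \<in> topspace ?S. t 0 \<in> - {1}}"
  let ?\<rho> = "\<lambda>t i. t (Suc i) / (1 - t 0)"
  have proj: "continuous_map ?S euclideanreal (\<lambda>t. t i)" for i
    by (intro continuous_map_from_subtopology continuous_map_product_projection) auto
  have W: "openin ?S ?W"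
    by (rule openin_continuous_map_preimage[OF proj]) auto
  have "continuous_map (subtopology ?S ?W) (powertop_real UNIV) ?\<rho>"
    unfolding continuous_map_componentwise_UNIV
    by (intro allI continuous_map_real_divide continuous_map_diff continuous_map_from_subtopology proj) auto
  then have "continuous_map (subtopology ?S ?W)
      (subtopology (powertop_real UNIV) (standard_simplex n)) ?\<rho>"
    by (auto simp: continuous_map_in_subtopology intro!: standard_simplex_shrink)
  then have \<sigma>\<rho>: "continuous_map (subtopology ?S ?W) X (\<sigma> \<circ> ?\<rho>)"
    by (rule continuous_map_compose) (use \<sigma> in \<open>simp add: singular_simplex_def\<close>)
  have in_X: "\<sigma> (?\<rho> t) \<in> topspace X" if "t \<in> standard_simplex (Suc n)" "t 0 \<noteq> 1" for t
    using \<sigma> standard_simplex_shrink[OF that] by (auto simp: singular_simplex_def continuous_map_def)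
  have "continuous_map ?S X (simplex_join v n \<sigma>)"
    unfolding continuous_map_def
  proof (intro conjI allI impI)
    show "simplex_join v n \<sigma> \<in> topspace ?S \<rightarrow> topspace X"
      using v in_X by (auto simp: simplex_join_def)
    fix U assume U: "openin X U"
    show "openin ?S {t \<in> topspace ?S. simplex_join v n \<sigma> t \<in> U}"
    proof (cases "v \<in> U")
      case True
      then have "{t \<in> topspace ?S. simplex_join v n \<sigma> t \<in> U} = topspace ?S"
        using only[OF U] v in_X by (auto simp: simplex_join_def)
      then show ?thesis
        by (metis openin_topspace)
    next
      case False
      then have "{t \<in> topspace ?S. simplex_join v n \<sigma> t \<in> U} =
          {t \<in> topspace (subtopology ?S ?W). (\<sigma> \<circ> ?\<rho>) t \<in> U}"
        by (auto simp: simplex_join_def)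
      then have "openin (subtopology ?S ?W) {t \<in> topspace ?S. simplex_join v n \<sigma> t \<in> U}"
        using openin_continuous_map_preimage[OF \<sigma>\<rho> U] by (simp only:)
      then show ?thesis
        by (rule openin_trans_full[OF _ W])
    qed
  qed
  then show ?thesis
    by (simp add: singular_simplex_def simplex_join_def)
qed

lemma singular_face_join_0:
  assumes "\<sigma> \<in> extensional (standard_simplex n)"
  shows "singular_face (Suc n) 0 (simplex_join v n \<sigma>) = \<sigma>"
proof (rule extensionalityI[of _ "standard_simplex n"])
  fix t :: "nat \<Rightarrow> real" assume t: "t \<in> standard_simplex n"
  have "simplical_face 0 t \<in> standard_simplex (Suc n)"
    using t by (intro simplical_face_in_standard_simplex) auto
  moreover have "simplical_face 0 t 0 = 0" "(\<lambda>i. simplical_face 0 t (Suc i)) = t"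
    by (simp_all add: simplical_face_def)
  ultimately show "singular_face (Suc n) 0 (simplex_join v n \<sigma>) t = \<sigma> t"
    using t by (simp add: singular_face_def simplex_join_def)
qed (use assms in \<open>auto simp: singular_face_def\<close>)

lemma singular_face_join_Suc:
  assumes "k \<le> Suc n"
  shows "singular_face (Suc (Suc n)) (Suc k) (simplex_join v (Suc n) \<sigma>) =
    simplex_join v n (singular_face (Suc n) k \<sigma>)"
proof (rule extensionalityI[of _ "standard_simplex (Suc n)"])
  fix t :: "nat \<Rightarrow> real" assume t: "t \<in> standard_simplex (Suc n)"
  have "simplical_face (Suc k) t \<in> standard_simplex (Suc (Suc n))"
    using t assms by (intro simplical_face_in_standard_simplex) auto
  moreover have "(\<lambda>i. simplical_face (Suc k) t (Suc i) / (1 - t 0)) =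
      simplical_face k (\<lambda>i. t (Suc i) / (1 - t 0))"
    by (auto simp: simplical_face_def fun_eq_iff)
  moreover have "simplical_face (Suc k) t 0 = t 0"
    by (simp add: simplical_face_def)
  ultimately show "singular_face (Suc (Suc n)) (Suc k) (simplex_join v (Suc n) \<sigma>) t =
      simplex_join v n (singular_face (Suc n) k \<sigma>) t"
    using t standard_simplex_shrink[OF t] by (auto simp: singular_face_def simplex_join_def)
qed (auto simp: singular_face_def simplex_join_def)

text \<open>Deleting the only vertex of the base leaves the apex; this constant simplex is the
  \<open>v\<close> in degree 0 of the coning argument.\<close>

lemma singular_face_join_1:
  "singular_face (Suc 0) (Suc 0) (simplex_join v 0 \<sigma>) = restrict (\<lambda>t. v) (standard_simplex 0)"
proof (rule extensionalityI[of _ "standard_simplex 0"])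
  fix t :: "nat \<Rightarrow> real" assume t: "t \<in> standard_simplex 0"
  have "simplical_face (Suc 0) t \<in> standard_simplex (Suc 0)"
    using t by (intro simplical_face_in_standard_simplex) auto
  moreover have "simplical_face (Suc 0) t 0 = 1"
    using t by (simp add: simplical_face_def standard_simplex_0)
  ultimately show "singular_face (Suc 0) (Suc 0) (simplex_join v 0 \<sigma>) t = restrict (\<lambda>t. v) (standard_simplex 0) t"
    using t by (simp add: singular_face_def simplex_join_def)
qed (auto simp: singular_face_def)

lemma schains_acyclic:
  assumes v: "v \<in> topspace X" and only: "\<And>U. openin X U \<Longrightarrow> v \<in> U \<Longrightarrow> U = topspace X"
    and a: "a \<in> schains n X" "if n = 0 then augment a = 0 else sboundary n a = 0"
  shows "\<exists>b\<in>schains (Suc n) X. sboundary (Suc n) b = a"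
  unfolding schains_eq sboundary_eq
proof (rule acyclic_by_coning[where \<kappa> = "simplex_join v"])
  show "simplex_join v n \<sigma> \<in> singular_simplex_set (Suc n) X" if "\<sigma> \<in> singular_simplex_set n X" for n \<sigma>
    using singular_simplex_join[OF _ v only] that by simp
  show "sboundary_simplex (Suc 0) (simplex_join v 0 \<sigma>) =
      Poly_Mapping.single \<sigma> 1 - Poly_Mapping.single (restrict (\<lambda>t. v) (standard_simplex 0)) 1"
    if "\<sigma> \<in> singular_simplex_set 0 X" for \<sigma>
    using that by (simp add: sboundary_simplex_def singular_face_join_0 singular_face_join_1 singular_simplex_def single_uminus)
  show "sboundary_simplex (Suc (Suc n)) (simplex_join v (Suc n) \<sigma>) = Poly_Mapping.single \<sigma> 1 -
      chain_extend (\<lambda>b. Poly_Mapping.single (simplex_join v n b) 1) (sboundary_simplex (Suc n) \<sigma>)"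
    if "\<sigma> \<in> singular_simplex_set (Suc n) X" for n \<sigma>
    using that
    by (simp add: sboundary_simplex_def sum.atMost_Suc_shift[of _ "Suc n"] singular_face_join_0
        singular_face_join_Suc singular_simplex_def chain_extend_sum single_uminus sum_negf del: sum.atMost_Suc)
qed (use a in \<open>auto simp: schains_eq sboundary_eq\<close>)

section \<open>Chains of tuples and the orientation relations\<close>

definition cons_chain :: "'v \<Rightarrow> ('v, 'k::field) simpchain \<Rightarrow> ('v, 'k) simpchain" where
  "cons_chain x = chain_extend (\<lambda>l. Poly_Mapping.single (x # l) 1)"

lemma cons_chain_single [simp]: "cons_chain x (Poly_Mapping.single l a) = Poly_Mapping.single (x # l) a"
  by (simp add: cons_chain_def)

lemma cons_chain_diff: "cons_chain x (a - b) = cons_chain x a - cons_chain x b"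
  by (simp add: cons_chain_def chain_extend_diff)

lemma cons_chain_add: "cons_chain x (a + b) = cons_chain x a + cons_chain x b"
  by (simp add: cons_chain_def chain_extend_add)

lemma cons_chain_0 [simp]: "cons_chain x 0 = 0"
  by (simp add: cons_chain_def)

text \<open>
  Unlike the boundary of the unaugmented complex, the following recursion treats the empty tuple
  on the same footing as the others, so that no low degree is exceptional.
\<close>

primrec tuple_boundary :: "'v list \<Rightarrow> ('v, 'k::field) simpchain" where
  "tuple_boundary [] = 0"
| "tuple_boundary (x # l) = Poly_Mapping.single l 1 - cons_chain x (tuple_boundary l)"

lemma tuple_boundary_eq_sum:
  "tuple_boundary l = (\<Sum>k<length l. Poly_Mapping.single (take k l @ drop (Suc k) l) ((-1) ^ k))"
proof (induction l)
  case (Cons x l)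
  then show ?case
    by (simp add: sum.lessThan_Suc_shift cons_chain_def chain_extend_sum single_uminus sum_negf
        del: sum.lessThan_Suc)
qed simp

lemma keys_tuple_boundary:
  "l' \<in> Poly_Mapping.keys (tuple_boundary l :: ('v, 'k::field) simpchain) \<Longrightarrow>
    Suc (length l') = length l \<and> set l' \<subseteq> set l"
proof -
  assume l': "l' \<in> Poly_Mapping.keys (tuple_boundary l :: ('v, 'k) simpchain)"
  have "Poly_Mapping.keys (tuple_boundary l :: ('v, 'k) simpchain) \<subseteq>
      (\<Union>k<length l. Poly_Mapping.keys (Poly_Mapping.single (take k l @ drop (Suc k) l) ((-1) ^ k :: 'k)))"
    unfolding tuple_boundary_eq_sum by (rule keys_sum)
  then obtain k where "k < length l" "l' = take k l @ drop (Suc k) l"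
    using l' by (auto split: if_splits)
  then show ?thesis
    using set_take_subset[of k l] set_drop_subset[of "Suc k" l] by auto
qed

lemma chain_extend_tuple_boundary_cons:
  "chain_extend tuple_boundary (cons_chain x c) = c - cons_chain x (chain_extend tuple_boundary c)"
  by (simp add: cons_chain_def chain_extend_compose chain_extend_fun_diff)

text \<open>The boundary of a prepended chain is the chain minus the prepended boundary, so in the
  double boundary the two copies of the boundary of the shorter tuple cancel.\<close>

lemma tuple_boundary_tuple_boundary: "chain_extend tuple_boundary (tuple_boundary l) = 0"
  by (induction l) (simp_all add: chain_extend_diff chain_extend_tuple_boundary_cons)

lemma simpchains_eq: "simpchains n K = chains_on (simplex_tuples n K)"
  by (simp add: simpchains_def chains_on_def)

lemma simpboundary_eq_0: "simpboundary 0 c = 0"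
  by (simp add: simpboundary_def)

text \<open>Degree 0 is left out: on a one-entry tuple \<open>tuple_boundary\<close> yields the
  empty tuple, whereas \<open>simpboundary 0\<close> is zero.\<close>

lemma simpboundary_Suc:
  assumes "\<And>l. l \<in> Poly_Mapping.keys c \<Longrightarrow> length l = Suc (Suc n)"
  shows "simpboundary (Suc n) c = chain_extend tuple_boundary c"
  unfolding simpboundary_def if_not_P[OF nat.distinct(2)]
  by (rule chain_extend_cong) (simp add: assms tuple_boundary_eq_sum lessThan_Suc_atMost del: sum.lessThan_Suc sum.atMost_Suc)

lemma simpboundary_simpchains:
  "c \<in> simpchains (Suc n) K \<Longrightarrow> simpboundary (Suc n) c = chain_extend tuple_boundary c"
  by (rule simpboundary_Suc) (auto simp: simpchains_def simplex_tuples_def)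

lemma simpboundary_eq:
  "simpboundary n = chain_extend (\<lambda>l. if n = 0 then 0 else
     \<Sum>k\<le>n. Poly_Mapping.single (take k l @ drop (Suc k) l) ((-1) ^ k))"
  by (rule ext) (simp add: simpboundary_def del: sum.atMost_Suc)

lemma simpboundary_diff: "simpboundary n (a - b) = simpboundary n a - simpboundary n b"
  by (simp add: simpboundary_eq chain_extend_diff)

lemma subspace_simpchains: "chain.subspace (simpchains n K)"
  by (simp add: simpchains_eq subspace_chains_on)

lemma tuple_boundary_in_simpchains:
  assumes "simplicial_complex K" "l \<in> simplex_tuples (Suc n) K"
  shows "tuple_boundary l \<in> simpchains n K"
proof -
  have "l' \<in> simplex_tuples n K" if "Suc (length l') = length l \<and> set l' \<subseteq> set l" for l'
    using assms that unfolding simplicial_complex_def simplex_tuples_def by (cases l') auto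
  then show ?thesis
    using keys_tuple_boundary unfolding simpchains_def by blast
qed

lemma simpboundary_in_simpchains:
  assumes K: "simplicial_complex K" and c: "c \<in> simpchains (Suc n) K"
  shows "simpboundary (Suc n) c \<in> simpchains n K"
  unfolding simpboundary_simpchains[OF c]
  by (rule chain_extend_in_subspace[OF subspace_simpchains])
     (use tuple_boundary_in_simpchains[OF K] c in \<open>auto simp: simpchains_def\<close>)

lemma simpboundary_simpboundary:
  assumes K: "simplicial_complex K" and c: "c \<in> simpchains (Suc n) K"
  shows "simpboundary n (simpboundary (Suc n) c) = 0"
proof (cases n)
  case (Suc m)
  show ?thesis
    using simpboundary_in_simpchains[OF K c] unfolding Suc
    by (simp add: simpboundary_simpchains simpboundary_simpchains[OF c[unfolded Suc]] chain_extend_compose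
        tuple_boundary_tuple_boundary)
qed (simp add: simpboundary_eq_0)

definition tuple_map :: "('v \<Rightarrow> 'w) \<Rightarrow> ('v, 'k::field) simpchain \<Rightarrow> ('w, 'k) simpchain" where
  "tuple_map f = chain_extend (\<lambda>l. Poly_Mapping.single (map f l) 1)"

lemma tuple_map_in_simpchains:
  "simplicial_map K L f \<Longrightarrow> c \<in> simpchains n K \<Longrightarrow> tuple_map f c \<in> simpchains n L"
  unfolding tuple_map_def simpchains_eq
  by (rule chain_extend_in_chains_on)
     (auto intro!: single_in_chains_on simp: simplex_tuples_def simplicial_map_def)

lemma tuple_map_simpboundary: "tuple_map f (simpboundary n c) = simpboundary n (tuple_map f c)"
  unfolding tuple_map_def simpboundary_eq chain_extend_compose
  by (rule chain_extend_cong) (simp add: chain_extend_sum take_map drop_map del: sum.atMost_Suc)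

subsection \<open>The boundary preserves the relations\<close>

text \<open>The generators of \<open>simprels\<close> with the set of tuples abstracted: the
  comparison with \<open>swap_rel_gens\<close> rests only on its closure under
  rearrangement.\<close>

definition list_rel_gens :: "'v list set \<Rightarrow> ('v, 'k::field) simpchain set" where
  "list_rel_gens A =
     {Poly_Mapping.single l 1 | l. l \<in> A \<and> \<not> distinct l} \<union>
     {Poly_Mapping.single (permute_list p l) 1 - Poly_Mapping.single l (of_int (sign p)) | p l.
        l \<in> A \<and> p permutes {..<length l}}"

lemma simprels_eq: "simprels n K = chain.span (list_rel_gens (simplex_tuples n K))"
  by (simp add: simprels_def list_rel_gens_def)

lemma permute_list_transpose_adjacent:
  "permute_list (Transposition.transpose (length xs) (Suc (length xs))) (xs @ a # b # ys) = xs @ b # a # ys"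
proof (rule nth_equalityI)
  let ?p = "Transposition.transpose (length xs) (Suc (length xs))" and ?l = "xs @ a # b # ys"
  fix i assume i: "i < length (permute_list ?p ?l)"
  have "?p permutes {..<length ?l}"
    by (rule permutes_swap_id) auto
  then have "permute_list ?p ?l ! i = ?l ! ?p i"
    using i by (simp add: permute_list_nth)
  also have "\<dots> = (xs @ b # a # ys) ! i"
  proof -
    consider "i < length xs" | "i = length xs" | "i = Suc (length xs)"
      | j where "i = Suc (Suc (length xs + j))"
      by (metis add_Suc_right less_imp_Suc_add linorder_neqE_nat not_less_eq)
    then show ?thesis
      by cases (simp_all add: transpose_apply_other nth_append)
  qed
  finally show "permute_list ?p ?l ! i = (xs @ b # a # ys) ! i" .
qed simp

text \<open>The relations are already generated by exchanges of adjacent entries and degenerate tuples.\<close>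

definition swap_rel_gens :: "'v list set \<Rightarrow> ('v, 'k::field) simpchain set" where
  "swap_rel_gens A =
     {Poly_Mapping.single l 1 | l. l \<in> A \<and> \<not> distinct l} \<union>
     {Poly_Mapping.single (xs @ b # a # ys) 1 + Poly_Mapping.single (xs @ a # b # ys) 1 | xs a b ys.
        xs @ a # b # ys \<in> A}"

lemma degenerate_in_swap_rel_gens: "l \<in> A \<Longrightarrow> \<not> distinct l \<Longrightarrow> Poly_Mapping.single l 1 \<in> swap_rel_gens A"
  unfolding swap_rel_gens_def by blast

lemma swap_in_swap_rel_gens:
  "xs @ a # b # ys \<in> A \<Longrightarrow>
    Poly_Mapping.single (xs @ b # a # ys) 1 + Poly_Mapping.single (xs @ a # b # ys) 1 \<in> swap_rel_gens A"
  unfolding swap_rel_gens_def by blast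

lemma swap_rel_gens_mono: "A \<subseteq> B \<Longrightarrow> swap_rel_gens A \<subseteq> swap_rel_gens B"
  unfolding swap_rel_gens_def by blast

text \<open>The permutations whose relation follows from adjacent exchanges are closed under
  composition. They contain the adjacent transpositions, by conjugation all transpositions, and
  hence every permutation.\<close>

lemma permute_in_span_swap_rel_gens:
  fixes A :: "'v list set"
  assumes closed: "\<And>l l'. l \<in> A \<Longrightarrow> mset l' = mset l \<Longrightarrow> l' \<in> A"
    and p: "p permutes {..<N}" and l: "l \<in> A" "length l = N"
  shows "Poly_Mapping.single (permute_list p l) 1 - Poly_Mapping.single l (of_int (sign p)) \<in>
    chain.span (swap_rel_gens A :: ('v, 'k::field) simpchain set)"
proof -
  let ?W = "chain.span (swap_rel_gens A :: ('v, 'k) simpchain set)"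
  define good where "good p \<longleftrightarrow> p permutes {..<N} \<and> (\<forall>l\<in>A. length l = N \<longrightarrow>
      Poly_Mapping.single (permute_list p l) 1 - Poly_Mapping.single l (of_int (sign p)) \<in> ?W)" for p
  have comp: "good (p \<circ> q)" if "good p" "good q" for p q
    unfolding good_def
  proof (intro conjI ballI impI)
    show pq: "p \<circ> q permutes {..<N}"
      using that permutes_compose unfolding good_def by blast
    fix l assume l: "l \<in> A" "length l = N"
    have perm: "p permutes {..<length l}" "q permutes {..<length l}"
      using that l by (auto simp: good_def)
    have "permute_list p l \<in> A"
      by (rule closed[OF l(1)]) (simp add: mset_permute_list perm)
    then have q: "Poly_Mapping.single (permute_list (p \<circ> q) l) 1
        - Poly_Mapping.single (permute_list p l) (of_int (sign q)) \<in> ?W"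
      using \<open>good q\<close> l perm by (simp add: good_def permute_list_compose)
    \<comment> \<open>The relation for \<open>q\<close> at the permuted tuple and the relation for
      \<open>p\<close> scaled by the sign of \<open>q\<close> telescope to the relation for the
      composite.\<close>
    have "chain_scale (of_int (sign q))
        (Poly_Mapping.single (permute_list p l) 1 - Poly_Mapping.single l (of_int (sign p))) \<in> ?W"
      using \<open>good p\<close> l by (auto simp: good_def intro!: chain.span_scale)
    from chain.span_add[OF q this]
    show "Poly_Mapping.single (permute_list (p \<circ> q) l) 1 - Poly_Mapping.single l (of_int (sign (p \<circ> q))) \<in> ?W"
      using perm[THEN permutes_imp_permutation[OF finite_lessThan]]
      by (simp add: chain.scale_right_diff_distrib sign_compose mult.commute)
  qed
  have good_id: "good id"
    by (simp add: good_def permutes_id chain.span_zero)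
  have adjacent: "good (Transposition.transpose i (Suc i))" if i: "Suc i < N" for i
    unfolding good_def
  proof (intro conjI ballI impI)
    show "Transposition.transpose i (Suc i) permutes {..<N}"
      using i by (intro permutes_swap_id) auto
    fix l assume l: "l \<in> A" "length l = N"
    have eq: "l = take i l @ l ! i # l ! Suc i # drop (Suc (Suc i)) l"
      using i l by (simp add: Cons_nth_drop_Suc Suc_lessD)
    obtain xs a b ys where xs: "l = xs @ a # b # ys" "length xs = i"
      by (rule that[OF eq]) (use i l in simp)
    then show "Poly_Mapping.single (permute_list (Transposition.transpose i (Suc i)) l) 1
        - Poly_Mapping.single l (of_int (sign (Transposition.transpose i (Suc i)))) \<in> ?W"
      using chain.span_base[OF swap_in_swap_rel_gens[of xs a b ys A]] l
      by (simp add: permute_list_transpose_adjacent[of xs, unfolded xs(2)] sign_swap_id single_uminus)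
  qed
  have less: "good (Transposition.transpose i (Suc (i + k)))" if "Suc (i + k) < N" for i k
    using that
  proof (induction k)
    case 0
    then show ?case by (simp add: adjacent)
  next
    case (Suc k)
    let ?j = "Suc (i + k)"
    \<comment> \<open>Conjugating by an adjacent transposition stretches the exchange of
      \<open>i\<close> and \<open>?j\<close> by one place.\<close>
    have "Transposition.transpose i (Suc ?j) =
        Transposition.transpose ?j (Suc ?j) \<circ> Transposition.transpose i ?j \<circ> Transposition.transpose ?j (Suc ?j)"
      by (auto simp: Transposition.transpose_def fun_eq_iff)
    moreover have "good (Transposition.transpose i ?j)" "good (Transposition.transpose ?j (Suc ?j))"
      using Suc adjacent[of ?j] by simp_all
    ultimately show ?case
      unfolding add_Suc_right by (simp only: comp)
  qed
  have transp: "good (Transposition.transpose i j)" if "i < N" "j < N" "i \<noteq> j" for i j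
  proof (cases "i < j")
    case True
    then show ?thesis
      using less[of i "j - Suc i"] that by simp
  next
    case False
    then show ?thesis
      using less[of j "i - Suc j"] that by (simp add: transpose_commute)
  qed
  have "good p"
    using p finite_lessThan
  proof (induction p rule: permutes_induct)
    case id
    show ?case by (rule good_id)
  next
    case (swap a b p)
    then show ?case by (intro comp transp) simp_all
  qed
  then show ?thesis
    using l by (simp add: good_def)
qed

lemma span_swap_rel_gens:
  fixes A :: "'v list set"
  assumes closed: "\<And>l l'. l \<in> A \<Longrightarrow> mset l' = mset l \<Longrightarrow> l' \<in> A"
  shows "chain.span (list_rel_gens A :: ('v, 'k::field) simpchain set) = chain.span (swap_rel_gens A)"
proof (rule chain.span_eq[THEN iffD2], intro conjI subsetI)
  fix g :: "('v, 'k) simpchain" assume "g \<in> list_rel_gens A"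
  then consider l where "l \<in> A" "\<not> distinct l" "g = Poly_Mapping.single l 1"
    | p l where "l \<in> A" "p permutes {..<length l}"
      "g = Poly_Mapping.single (permute_list p l) 1 - Poly_Mapping.single l (of_int (sign p))"
    unfolding list_rel_gens_def by blast
  then show "g \<in> chain.span (swap_rel_gens A)"
  proof cases
    case 1
    then show ?thesis
      by (simp add: chain.span_base degenerate_in_swap_rel_gens)
  next
    case 2
    show ?thesis
      unfolding 2(3) by (rule permute_in_span_swap_rel_gens[OF closed 2(2,1) refl])
  qed
next
  fix g :: "('v, 'k) simpchain" assume "g \<in> swap_rel_gens A"
  then consider l where "l \<in> A" "\<not> distinct l" "g = Poly_Mapping.single l 1"
    | xs a b ys where "xs @ a # b # ys \<in> A"
      "g = Poly_Mapping.single (xs @ b # a # ys) 1 + Poly_Mapping.single (xs @ a # b # ys) 1"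
    unfolding swap_rel_gens_def by blast
  then show "g \<in> chain.span (list_rel_gens A)"
  proof cases
    case 1
    then show ?thesis
      unfolding list_rel_gens_def by (intro chain.span_base UnI1) blast
  next
    case 2
    let ?p = "Transposition.transpose (length xs) (Suc (length xs))" and ?l = "xs @ a # b # ys"
    have "?p permutes {..<length ?l}"
      by (rule permutes_swap_id) auto
    then have "Poly_Mapping.single (permute_list ?p ?l) 1 - Poly_Mapping.single ?l (of_int (sign ?p)) \<in>
        list_rel_gens A"
      unfolding list_rel_gens_def using 2(1) by (intro UnI2) blast
    then show ?thesis
      by (intro chain.span_base) (simp add: 2(2) permute_list_transpose_adjacent sign_swap_id single_uminus)
  qed
qed

lemma simprels_eq_span_swap: "simprels n K = chain.span (swap_rel_gens (simplex_tuples n K))"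
  unfolding simprels_eq
proof (rule span_swap_rel_gens)
  show "l' \<in> simplex_tuples n K" if "l \<in> simplex_tuples n K" "mset l' = mset l" for l l'
    using that mset_eq_setD[of l' l] mset_eq_length[of l' l] by (simp add: simplex_tuples_def)
qed

lemma swap_rel_gens_image:
  assumes g: "g \<in> swap_rel_gens A"
    and degenerate: "\<And>l. l \<in> A \<Longrightarrow> \<not> distinct l \<Longrightarrow> h (Poly_Mapping.single l 1) \<in> W"
    and swap: "\<And>xs a b ys. xs @ a # b # ys \<in> A \<Longrightarrow>
      h (Poly_Mapping.single (xs @ b # a # ys) 1 + Poly_Mapping.single (xs @ a # b # ys) 1) \<in> W"
  shows "h g \<in> W"
  using g degenerate swap unfolding swap_rel_gens_def by blast

lemma cons_chain_in_span_swap_rel_gens: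
  assumes "c \<in> chain.span (swap_rel_gens A)" "\<And>l. l \<in> A \<Longrightarrow> x # l \<in> B"
  shows "cons_chain x c \<in> chain.span (swap_rel_gens B)"
proof (rule span_image_subset[OF _ chain.subspace_span _ assms(1)])
  show "module_hom chain_scale chain_scale (cons_chain x)"
    unfolding cons_chain_def by (rule module_hom_chain_extend)
  show "cons_chain x g \<in> chain.span (swap_rel_gens B)" if "g \<in> swap_rel_gens A" for g
  proof (rule swap_rel_gens_image[OF that])
    show "cons_chain x (Poly_Mapping.single l 1) \<in> chain.span (swap_rel_gens B)"
      if "l \<in> A" "\<not> distinct l" for l
      using that assms(2) by (simp add: chain.span_base degenerate_in_swap_rel_gens)
    show "cons_chain x (Poly_Mapping.single (xs @ b # a # ys) 1 + Poly_Mapping.single (xs @ a # b # ys) 1)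
        \<in> chain.span (swap_rel_gens B)" if "xs @ a # b # ys \<in> A" for xs a b ys
      using chain.span_base[OF swap_in_swap_rel_gens[of "x # xs" a b ys B]] assms(2)[OF that]
      by (simp add: cons_chain_add)
  qed
qed

section \<open>Boundaries of relations, confined to the tuples on one simplex\<close>

abbreviation tuples_over :: "nat \<Rightarrow> 'v set \<Rightarrow> 'v list set" where
  "tuples_over m V \<equiv> {l. length l = m \<and> set l \<subseteq> V}"

text \<open>The terms in which one of the exchanged entries is deleted cancel in pairs; deleting any
  other entry leaves an exchange relation. The induction runs over the prefix, down to an exchange
  at the front.\<close>

lemma tuple_boundary_swap:
  assumes "Suc m = length (xs @ a # b # ys)" "set (xs @ a # b # ys) \<subseteq> V"
  shows "tuple_boundary (xs @ b # a # ys) + tuple_boundary (xs @ a # b # ys) \<in>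
    chain.span (swap_rel_gens (tuples_over m V) :: ('v, 'k::field) simpchain set)"
  using assms
proof (induction xs arbitrary: m)
  case Nil
  have "tuple_boundary (b # a # ys) + tuple_boundary (a # b # ys) =
      cons_chain a (cons_chain b (tuple_boundary ys)) + cons_chain b (cons_chain a (tuple_boundary ys))"
    by (simp add: cons_chain_diff)
  also have "\<dots> = chain_extend (\<lambda>l. Poly_Mapping.single ([] @ a # b # l) 1 + Poly_Mapping.single ([] @ b # a # l) 1)
      (tuple_boundary ys)"
    by (simp add: cons_chain_def chain_extend_compose chain_extend_fun_add)
  also have "\<dots> \<in> chain.span (swap_rel_gens (tuples_over m V) :: ('v, 'k::field) simpchain set)"
  proof (rule chain_extend_in_subspace[OF chain.subspace_span])
    fix l assume "l \<in> Poly_Mapping.keys (tuple_boundary ys :: ('v, 'k) simpchain)"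
    then show "Poly_Mapping.single ([] @ a # b # l) 1 + Poly_Mapping.single ([] @ b # a # l) 1
        \<in> chain.span (swap_rel_gens (tuples_over m V) :: ('v, 'k::field) simpchain set)"
      using keys_tuple_boundary[of l ys] Nil by (intro chain.span_base swap_in_swap_rel_gens) auto
  qed
  finally show ?case
    by simp
next
  case (Cons x xs)
  then obtain m' where m': "m = Suc m'" "Suc m' = length (xs @ a # b # ys)"
    by auto
  have "cons_chain x (tuple_boundary (xs @ b # a # ys) + tuple_boundary (xs @ a # b # ys)) \<in>
      chain.span (swap_rel_gens (tuples_over m V) :: ('v, 'k::field) simpchain set)"
    using Cons m' by (intro cons_chain_in_span_swap_rel_gens[OF Cons.IH[OF m'(2)]]) auto
  moreover have "Poly_Mapping.single (xs @ b # a # ys) 1 + Poly_Mapping.single (xs @ a # b # ys) 1 \<in>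
      chain.span (swap_rel_gens (tuples_over m V) :: ('v, 'k::field) simpchain set)"
    using Cons.prems m' by (intro chain.span_base swap_in_swap_rel_gens) auto
  ultimately have "(Poly_Mapping.single (xs @ b # a # ys) 1 + Poly_Mapping.single (xs @ a # b # ys) 1)
      - cons_chain x (tuple_boundary (xs @ b # a # ys) + tuple_boundary (xs @ a # b # ys)) \<in>
      chain.span (swap_rel_gens (tuples_over m V) :: ('v, 'k::field) simpchain set)"
    by (rule chain.span_diff[rotated])
  then show ?case
    by (simp add: cons_chain_add algebra_simps)
qed

text \<open>The two deletions of a copy of \<open>a\<close> cancel, and every other term is
  degenerate. Putting \<open>a = b\<close> in \<open>tuple_boundary_swap\<close> would only give
  twice this boundary, which says nothing in characteristic two.\<close>

lemma tuple_boundary_adjacent_equal: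
  assumes "Suc m = length (xs @ a # a # ys)" "set (xs @ a # a # ys) \<subseteq> V"
  shows "tuple_boundary (xs @ a # a # ys) \<in> chain.span (swap_rel_gens (tuples_over m V) :: ('v, 'k::field) simpchain set)"
  using assms
proof (induction xs arbitrary: m)
  case Nil
  have "tuple_boundary (a # a # ys) =
      chain_extend (\<lambda>l. Poly_Mapping.single (a # a # l) 1) (tuple_boundary ys)"
    by (simp add: cons_chain_diff) (simp add: cons_chain_def chain_extend_compose)
  also have "\<dots> \<in> chain.span (swap_rel_gens (tuples_over m V) :: ('v, 'k::field) simpchain set)"
  proof (rule chain_extend_in_subspace[OF chain.subspace_span])
    fix l assume "l \<in> Poly_Mapping.keys (tuple_boundary ys :: ('v, 'k) simpchain)"
    then show "Poly_Mapping.single (a # a # l) 1 \<in> chain.span (swap_rel_gens (tuples_over m V) :: ('v, 'k::field) simpchain set)"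
      using keys_tuple_boundary[of l ys] Nil by (intro chain.span_base degenerate_in_swap_rel_gens) auto
  qed
  finally show ?case
    by simp
next
  case (Cons x xs)
  then obtain m' where m': "m = Suc m'" "Suc m' = length (xs @ a # a # ys)"
    by auto
  have "cons_chain x (tuple_boundary (xs @ a # a # ys)) \<in> chain.span (swap_rel_gens (tuples_over m V) :: ('v, 'k::field) simpchain set)"
    using Cons m' by (intro cons_chain_in_span_swap_rel_gens[OF Cons.IH[OF m'(2)]]) auto
  moreover have "Poly_Mapping.single (xs @ a # a # ys) 1 \<in> chain.span (swap_rel_gens (tuples_over m V) :: ('v, 'k::field) simpchain set)"
    using Cons.prems m' by (intro chain.span_base degenerate_in_swap_rel_gens) auto
  ultimately show ?case
    by (simp add: chain.span_diff)
qed

text \<open>Adjacent exchanges move the entries out from between the two copies of \<open>a\<close>,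
  each changing the boundary by a sign modulo relations.\<close>

lemma tuple_boundary_degenerate:
  assumes "Suc m = length (xs @ a # ys @ a # zs)" "set (xs @ a # ys @ a # zs) \<subseteq> V"
  shows "tuple_boundary (xs @ a # ys @ a # zs) \<in> chain.span (swap_rel_gens (tuples_over m V) :: ('v, 'k::field) simpchain set)"
  using assms
proof (induction ys arbitrary: xs)
  case Nil
  then show ?case
    using tuple_boundary_adjacent_equal[of m xs a zs V] by simp
next
  case (Cons y ys)
  have "tuple_boundary ((xs @ [y]) @ a # ys @ a # zs) \<in> chain.span (swap_rel_gens (tuples_over m V) :: ('v, 'k::field) simpchain set)"
    by (rule Cons.IH) (use Cons.prems in auto)
  moreover have "tuple_boundary (xs @ y # a # ys @ a # zs) + tuple_boundary (xs @ a # y # ys @ a # zs) \<in>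
      chain.span (swap_rel_gens (tuples_over m V) :: ('v, 'k::field) simpchain set)"
    using tuple_boundary_swap[of m xs a y "ys @ a # zs" V] Cons.prems by simp
  ultimately show ?case
    using chain.span_diff by fastforce
qed

lemma simprels_subset_simpchains: "simprels n K \<subseteq> simpchains n K"
  unfolding simprels_eq_span_swap
proof (rule chain.span_minimal[OF _ subspace_simpchains], rule subsetI)
  fix g assume "g \<in> swap_rel_gens (simplex_tuples n K)"
  then show "g \<in> simpchains n K"
  proof (rule swap_rel_gens_image[where h = "\<lambda>g. g"])
    show "Poly_Mapping.single l 1 \<in> simpchains n K" if "l \<in> simplex_tuples n K" for l
      using that by (simp add: simpchains_eq single_in_chains_on)
    show "Poly_Mapping.single (xs @ b # a # ys) 1 + Poly_Mapping.single (xs @ a # b # ys) 1 \<in> simpchains n K"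
      if "xs @ a # b # ys \<in> simplex_tuples n K" for xs a b ys
      using that by (intro chain.subspace_add[OF subspace_simpchains])
        (auto simp: simpchains_eq simplex_tuples_def insert_commute intro!: single_in_chains_on)
  qed
qed

lemma tuples_over_subset:
  "simplicial_complex K \<Longrightarrow> set l \<in> K \<Longrightarrow> tuples_over (Suc n) (set l) \<subseteq> simplex_tuples n K"
proof
  fix l' assume K: "simplicial_complex K" "set l \<in> K" and l': "l' \<in> tuples_over (Suc n) (set l)"
  then have "set l' \<noteq> {}"
    by auto
  with K l' show "l' \<in> simplex_tuples n K"
    unfolding simplicial_complex_def simplex_tuples_def by blast
qed

lemma subspace_simprels: "chain.subspace (simprels n K)"
  unfolding simprels_eq by (rule chain.subspace_span)

text \<open>Each generator lives on a single simplex, so its boundary is a relation among tuples on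
  that simplex, and these span faces of the complex.\<close>

lemma simpboundary_in_simprels:
  assumes K: "simplicial_complex K" and c: "c \<in> (simprels (Suc n) K :: ('v, 'k::field) simpchain set)"
  shows "simpboundary (Suc n) c \<in> simprels n K"
proof -
  let ?W = "simprels n K :: ('v, 'k) simpchain set"
  have mono: "chain.span (swap_rel_gens (tuples_over (Suc n) (set l))) \<subseteq> ?W" if "set l \<in> K" for l
    unfolding simprels_eq_span_swap
    by (intro chain.span_mono swap_rel_gens_mono tuples_over_subset[OF K that])
  have "chain_extend tuple_boundary c \<in> ?W"
  proof (rule span_image_subset[OF module_hom_chain_extend subspace_simprels _ c[unfolded simprels_eq_span_swap]])
    show "chain_extend tuple_boundary g \<in> ?W" if "g \<in> swap_rel_gens (simplex_tuples (Suc n) K)" for g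
    proof (rule swap_rel_gens_image[OF that])
      fix l assume l: "l \<in> simplex_tuples (Suc n) K" "\<not> distinct l"
      then obtain xs a ys zs where "l = xs @ [a] @ ys @ [a] @ zs"
        using not_distinct_decomp by blast
      then show "chain_extend tuple_boundary (Poly_Mapping.single l 1) \<in> ?W"
        using tuple_boundary_degenerate[of "Suc n" xs a ys zs "set l"] l mono[of l]
        by (auto simp: simplex_tuples_def)
    next
      fix xs a b ys assume l: "xs @ a # b # ys \<in> simplex_tuples (Suc n) K"
      show "chain_extend tuple_boundary
          (Poly_Mapping.single (xs @ b # a # ys) 1 + Poly_Mapping.single (xs @ a # b # ys) 1) \<in> ?W"
        using tuple_boundary_swap[of "Suc n" xs a b ys "set (xs @ a # b # ys)"] l mono[of "xs @ a # b # ys"]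
        by (auto simp: simplex_tuples_def chain_extend_add)
    qed
  qed
  then show ?thesis
    using simpboundary_simpchains[OF subsetD[OF simprels_subset_simpchains c]] by simp
qed

lemma tuple_map_in_simprels:
  assumes f: "simplicial_map K L f" and c: "c \<in> simprels n K"
  shows "tuple_map f c \<in> simprels n L"
proof (rule span_image_subset[OF _ subspace_simprels _ c[unfolded simprels_eq_span_swap]])
  show "module_hom chain_scale chain_scale (tuple_map f)"
    unfolding tuple_map_def by (rule module_hom_chain_extend)
  have f_in: "map f l \<in> simplex_tuples n L" if "l \<in> simplex_tuples n K" for l
    using that f by (simp add: simplex_tuples_def simplicial_map_def)
  show "tuple_map f g \<in> simprels n L" if "g \<in> swap_rel_gens (simplex_tuples n K)" for g
    unfolding simprels_eq_span_swap
  proof (rule swap_rel_gens_image[OF that])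
    show "tuple_map f (Poly_Mapping.single l 1) \<in> chain.span (swap_rel_gens (simplex_tuples n L))"
      if "l \<in> simplex_tuples n K" "\<not> distinct l" for l
      using that f_in by (auto simp: tuple_map_def distinct_map intro!: chain.span_base degenerate_in_swap_rel_gens)
    show "tuple_map f (Poly_Mapping.single (xs @ b # a # ys) 1 + Poly_Mapping.single (xs @ a # b # ys) 1)
        \<in> chain.span (swap_rel_gens (simplex_tuples n L))" if "xs @ a # b # ys \<in> simplex_tuples n K" for xs a b ys
      using f_in[OF that] by (auto simp: tuple_map_def chain_extend_add intro!: chain.span_base swap_in_swap_rel_gens)
  qed
qed

text \<open>One-entry tuples admit neither a repetition nor an exchange.\<close>

lemma simprels_0: "simprels 0 K \<subseteq> {0}"
  unfolding simprels_eq_span_swap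
proof (rule chain.span_minimal)
  show "swap_rel_gens (simplex_tuples 0 K) \<subseteq> {0}"
    by (auto simp: swap_rel_gens_def simplex_tuples_def length_Suc_conv)
qed (auto simp: chain.subspace_def)

section \<open>The down-set topology of a poset\<close>

text \<open>Down-sets rather than up-sets, since \<open>x\<close> is below \<open>y\<close> when
  \<open>x\<close> lies in the minimal open set of \<open>y\<close>.\<close>

definition down_topology :: "'p rel \<Rightarrow> 'p topology" where
  "down_topology r = topology (\<lambda>U. U \<in> down_sets r)"

lemma openin_down_topology [simp]: "openin (down_topology r) U \<longleftrightarrow> U \<in> down_sets r"
proof -
  have "istopology (\<lambda>U. U \<in> down_sets r)"
    unfolding istopology_def down_sets_def by blast
  then show ?thesis
    by (simp add: down_topology_def)
qed

lemma topspace_down_topology [simp]: "topspace (down_topology r) = Field r"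
proof -
  have "Field r \<in> down_sets r"
    by (auto simp: down_sets_def intro: FieldI1)
  then show ?thesis
    unfolding topspace_def by (auto simp: down_sets_def)
qed

text \<open>
  For such a \<open>g\<close> the preimage of each principal down-set contains a point that has no neighbourhood
  within the preimage other than the whole of it, so the preimage is contractible.
\<close>

definition poset_model :: "'p rel \<Rightarrow> 'a topology \<Rightarrow> ('a \<Rightarrow> 'p) \<Rightarrow> bool" where
  "poset_model r Y g \<longleftrightarrow> continuous_map Y (down_topology r) g \<and>
     (\<forall>p\<in>Field r. \<exists>v\<in>topspace Y. g v = p \<and>
        (\<forall>U. openin Y U \<longrightarrow> v \<in> U \<longrightarrow> {y \<in> topspace Y. (g y, p) \<in> r} \<subseteq> U))"

text \<open>The poset models itself, so one result on principal down-sets covers the finite space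
  and the poset alike.\<close>

lemma poset_model_id: "poset_model r (down_topology r) id"
  unfolding poset_model_def by (auto simp: down_sets_def)

lemma complex_family_schains:
  fixes g :: "'a \<Rightarrow> 'p"
  shows "complex_family (\<lambda>D n. schains n (subtopology Y (g -` D))) sboundary"
proof
  fix D E :: "'p set" and n and a b :: "('a, 'k::field) schain"
  show "0 \<in> schains n (subtopology Y (g -` D))"
    by (rule chain.subspace_0[OF subspace_schains])
  show "a - b \<in> schains n (subtopology Y (g -` D))"
    if "a \<in> schains n (subtopology Y (g -` D))" "b \<in> schains n (subtopology Y (g -` D))"
    using that by (rule chain.subspace_diff[OF subspace_schains])
  show "schains n (subtopology Y (g -` D)) \<subseteq> schains n (subtopology Y (g -` E))" if "D \<subseteq> E"
    using that by (auto simp: schains_def singular_simplex_subtopology subset_iff image_iff)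
  show "schains n (subtopology Y (g -` D)) \<inter> schains n (subtopology Y (g -` E)) \<subseteq>
      schains n (subtopology Y (g -` (D \<inter> E)))"
    by (auto simp: schains_def singular_simplex_subtopology subset_iff image_iff)
  show "sboundary n (a - b) = sboundary n a - sboundary n b"
    by (rule sboundary_diff)
  show "sboundary (Suc n) a \<in> schains n (subtopology Y (g -` D))"
    if "a \<in> schains (Suc n) (subtopology Y (g -` D))"
    using that by (rule sboundary_in_schains)
  show "sboundary n (sboundary (Suc n) a) = 0" if "a \<in> schains (Suc n) (subtopology Y (g -` D))"
    using that by (rule sboundary_sboundary)
  show "sboundary 0 a = 0"
    by (simp add: sboundary_def)
qed

text \<open>Preimages of down-sets are open in the preimage of the union, so they form a cover to
  which subdivision applies.\<close>

lemma excisive_schains: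
  assumes g: "continuous_map Y (down_topology r) g" and EF: "E \<in> down_sets r" "F \<in> down_sets r"
  shows "excisive (\<lambda>D n. schains n (subtopology Y (g -` D))) sboundary E F"
  unfolding excisive_def
proof (intro allI ballI impI)
  let ?Z = "subtopology Y (g -` (E \<union> F))"
  have op: "openin ?Z (topspace ?Z \<inter> g -` D)" if "D \<in> down_sets r" for D
  proof -
    have "openin Y {y \<in> topspace Y. g y \<in> D}"
      using openin_continuous_map_preimage[OF g, of D] that by simp
    moreover have "topspace ?Z \<inter> g -` D = {y \<in> topspace Y. g y \<in> D} \<inter> g -` (E \<union> F)"
      by auto
    ultimately show ?thesis
      unfolding openin_subtopology by blast
  qed
  have sub: "subtopology ?Z (topspace ?Z \<inter> g -` D) = subtopology Y (g -` D)" if "D \<subseteq> E \<union> F" for D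
  proof -
    have "g -` (E \<union> F) \<inter> g -` D = g -` D"
      using that by auto
    then show ?thesis
      by (simp only: subtopology_restrict subtopology_subtopology)
  qed
  have subE: "subtopology ?Z (topspace ?Z \<inter> g -` E) = subtopology Y (g -` E)"
    by (rule sub) simp
  have subF: "subtopology ?Z (topspace ?Z \<inter> g -` F) = subtopology Y (g -` F)"
    by (rule sub) simp
  fix n c
  assume c: "c \<in> schains n ?Z"
    and "\<exists>u\<in>schains (n - 1) (subtopology Y (g -` E)). \<exists>v\<in>schains (n - 1) (subtopology Y (g -` F)).
      sboundary n c = u + v"
  then obtain u v where "u \<in> schains (n - 1) (subtopology Y (g -` E))"
    "v \<in> schains (n - 1) (subtopology Y (g -` F))" "sboundary n c = u + v"
    by blast
  note uv = this[folded subE subF]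
  have cover: "topspace ?Z \<subseteq> topspace ?Z \<inter> g -` E \<union> topspace ?Z \<inter> g -` F"
    by auto
  obtain w p q where "w \<in> schains (Suc n) ?Z"
    "p \<in> schains n (subtopology ?Z (topspace ?Z \<inter> g -` E))"
    "q \<in> schains n (subtopology ?Z (topspace ?Z \<inter> g -` F))" "c + sboundary (Suc n) w = p + q"
    by (rule schains_excision[OF op[OF EF(1)] op[OF EF(2)] cover c uv])
  then show "\<exists>w\<in>schains (Suc n) ?Z. \<exists>u\<in>schains n (subtopology Y (g -` E)).
      \<exists>v\<in>schains n (subtopology Y (g -` F)). c + sboundary (Suc n) w = u + v"
    unfolding subE subF by blast
qed

lemma schains_vimage_empty: "schains n (subtopology Y (g -` {})) \<subseteq> {0}"
proof -
  have "singular_simplex_set n (subtopology Y (g -` {})) = {}"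
    by (auto simp: singular_simplex_empty)
  then have eq: "schains n (subtopology Y (g -` {})) = {c. Poly_Mapping.keys c \<subseteq> {}}"
    by (simp only: schains_def)
  show ?thesis
    unfolding eq by simp
qed

text \<open>Within the preimage of the principal down-set, the point \<open>v\<close> over
  \<open>p\<close> has the whole space as its only neighbourhood, so every singular simplex can be
  joined to it.\<close>

lemma aug_acyclic_schains:
  assumes Y: "poset_model r Y g" and p: "p \<in> Field r" "(p, p) \<in> r"
  shows "aug_acyclic_at (\<lambda>D n. schains n (subtopology Y (g -` D))) sboundary augment (r\<inverse> `` {p})"
proof -
  let ?X = "subtopology Y (g -` (r\<inverse> `` {p}))"
  obtain v where v: "v \<in> topspace Y" "g v = p"
    and nbhd: "\<And>U. openin Y U \<Longrightarrow> v \<in> U \<Longrightarrow> {y \<in> topspace Y. (g y, p) \<in> r} \<subseteq> U"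
    using Y p unfolding poset_model_def by blast
  have "v \<in> topspace ?X"
    using v p by auto
  moreover have "U = topspace ?X" if U: "openin ?X U" "v \<in> U" for U
  proof -
    obtain U' where U': "openin Y U'" "U = U' \<inter> g -` (r\<inverse> `` {p})"
      using U(1) unfolding openin_subtopology by blast
    have "v \<in> U'"
      using U(2) U'(2) by simp
    then have "{y \<in> topspace Y. (g y, p) \<in> r} \<subseteq> U'"
      by (rule nbhd[OF U'(1)])
    moreover have "U' \<subseteq> topspace Y"
      by (rule openin_subset[OF U'(1)])
    ultimately have "U' \<inter> g -` (r\<inverse> `` {p}) = topspace Y \<inter> g -` (r\<inverse> `` {p})"
      by auto
    then show ?thesis
      by (simp only: U'(2) topspace_subtopology)
  qed
  ultimately show ?thesis
    unfolding aug_acyclic_at_def using schains_acyclic[of v ?X] by blast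
qed

lemma augment_surj:
  assumes "s \<in> S"
  shows "\<exists>a\<in>chains_on S. augment a = b"
proof
  show "augment (Poly_Mapping.single s (Poly_Mapping.lookup b ())) = b"
    by (rule poly_mapping_eqI) (simp add: augment_def)
qed (use assms in \<open>rule single_in_chains_on\<close>)

lemma augment_sboundary: "augment (sboundary 1 b) = 0"
proof -
  have "augment (sboundary 1 b) = chain_extend (\<lambda>\<sigma>. augment (sboundary_simplex 1 \<sigma>)) b"
    by (simp add: augment_def sboundary_eq chain_extend_compose)
  also have "\<dots> = chain_extend (\<lambda>\<sigma>. 0) b"
    by (rule chain_extend_cong)
       (simp add: augment_def sboundary_simplex_def chain_extend_add chain_extend_diff single_uminus)
  finally show ?thesis
    by simp
qed

lemma schains_0_augment_surj:
  assumes "v \<in> topspace X"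
  shows "\<exists>a\<in>schains 0 X. augment a = b"
  unfolding schains_eq
  by (rule augment_surj[of "restrict (\<lambda>t. v) (standard_simplex 0)"])
     (use assms in \<open>auto simp: singular_simplex_def\<close>)

subsection \<open>Comparison of a finite space with its poset\<close>

locale finite_poset =
  fixes r :: "'p rel"
  assumes fin: "finite (Field r)" and po: "partial_order_on (Field r) r"
begin

lemma refl: "x \<in> Field r \<Longrightarrow> (x, x) \<in> r"
  using po by (auto simp: partial_order_on_def preorder_on_def refl_on_def)

lemma trans: "trans r"
  using po by (auto simp: partial_order_on_def preorder_on_def)

lemma antisym: "antisym r"
  using po by (auto simp: partial_order_on_def)

lemma Field_down_sets: "Field r \<in> down_sets r"
  by (auto simp: down_sets_def intro: FieldI1)

text \<open>The target is written as a preimage under \<open>id\<close>, so that source and target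
  are instances of the same family.\<close>

lemma family_map_schain_map:
  assumes "continuous_map Y (down_topology r) g"
  shows "family_map (\<lambda>D n. schains n (subtopology Y (g -` D))) sboundary
    (\<lambda>D n. schains n (subtopology (down_topology r) (id -` D))) sboundary (\<lambda>n. schain_map n g)"
proof (intro family_map.intro family_map_axioms.intro complex_family_schains)
  show "schain_map n g (a - b) = schain_map n g a - schain_map n g b" for n a b
    by (simp add: schain_map_def chain_extend_diff)
  show "schain_map n g a \<in> schains n (subtopology (down_topology r) (id -` D))"
    if "a \<in> schains n (subtopology Y (g -` D))" for a D n
    by (rule schain_map_in_schains[OF that])
       (use assms in \<open>auto simp: continuous_map_in_subtopology continuous_map_from_subtopology\<close>)
  show "schain_map n g (sboundary (Suc n) a) = sboundary (Suc n) (schain_map (Suc n) g a)" for a n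
    by (rule schain_map_sboundary)
qed

lemma acyclic_cone_schain_map:
  assumes Y: "poset_model r Y g" and D: "D \<in> down_sets r"
  shows "acyclic_at
    (cone_carrier (\<lambda>D n. schains n (subtopology Y (g -` D))) (\<lambda>D n. schains n (subtopology (down_topology r) (id -` D))))
    (cone_d sboundary sboundary (\<lambda>n. schain_map n g :: ('a, 'k::field) schain \<Rightarrow> ('p, 'k) schain)) D"
proof -
  have g: "continuous_map Y (down_topology r) g"
    using Y by (simp add: poset_model_def)
  interpret family_map "\<lambda>D n. schains n (subtopology Y (g -` D))" sboundary
    "\<lambda>D n. schains n (subtopology (down_topology r) (id -` D))" sboundary
    "\<lambda>n. schain_map n g :: ('a, 'k) schain \<Rightarrow> ('p, 'k) schain"
    by (rule family_map_schain_map[OF g])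
  interpret cone: complex_family mcone dmcone
    by (rule complex_family_cone)
  show ?thesis
  proof (rule cone.acyclic_on_down_sets[OF fin po D])
    show "mcone {} n \<subseteq> {0}" for n
      using schains_vimage_empty[of _ Y g] schains_vimage_empty[of _ "down_topology r" id]
      by (cases n) (fastforce simp: cone_carrier_def zero_prod_def)+
    show "excisive mcone dmcone E F" if "E \<in> down_sets r" "F \<in> down_sets r" for E F
      by (intro excisive_cone excisive_schains[of _ r] g that) auto
    fix x assume x: "x \<in> Field r"
    obtain v where v: "v \<in> topspace Y" "g v = x"
      using Y x unfolding poset_model_def by blast
    show "acyclic_at mcone dmcone (r\<inverse> `` {x})"
    proof (rule acyclic_at_coneI[where \<epsilon>G = augment and \<epsilon>H = augment])
      show "\<exists>a\<in>schains 0 (subtopology Y (g -` (r\<inverse> `` {x}))). augment a = augment b" for b :: "('p, 'k) schain"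
        by (rule schains_0_augment_surj[of v]) (use v x refl in auto)
      show "augment (schain_map 0 g a) = augment a" for a :: "('a, 'k) schain"
        by (simp add: schain_map_def augment_chain_extend_single)
    qed (rule aug_acyclic_schains[OF Y x refl[OF x]] aug_acyclic_schains[OF poset_model_id x refl[OF x]]
        augment_sboundary augment_diff)+
  qed
qed

text \<open>The acyclic cone over the whole poset, unfolded into bijectivity on homology in terms of
  representatives, as \<open>naturally_isomorphic_subquotient\<close> asks for it.\<close>

lemma
  fixes a :: "('a, 'k::field) schain" and b :: "('p, 'k) schain"
  assumes Y: "poset_model r Y g"
  shows schain_map_homology_surj: "b \<in> scycles n (down_topology r) \<Longrightarrow>
      \<exists>a\<in>scycles n Y. b - schain_map n g a \<in> sboundaries n (down_topology r)"
    and schain_map_homology_inj: "a \<in> scycles n Y \<Longrightarrow>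
      schain_map n g a \<in> sboundaries n (down_topology r) \<Longrightarrow> a \<in> sboundaries n Y"
proof -
  have g: "continuous_map Y (down_topology r) g"
    using Y by (simp add: poset_model_def)
  interpret family_map "\<lambda>D n. schains n (subtopology Y (g -` D))" sboundary
    "\<lambda>D n. schains n (subtopology (down_topology r) (id -` D))" sboundary
    "\<lambda>n. schain_map n g :: ('a, 'k) schain \<Rightarrow> ('p, 'k) schain"
    by (rule family_map_schain_map[OF g])
  have Y_eq: "subtopology Y (g -` Field r) = Y"
    using g by (intro subtopology_superset) (auto simp: continuous_map_def)
  have P_eq: "subtopology (down_topology r) (id -` Field r) = down_topology r"
    by (intro subtopology_superset) auto
  note ac = acyclic_cone_schain_map[OF Y Field_down_sets]
  show "\<exists>a\<in>scycles n Y. b - schain_map n g a \<in> sboundaries n (down_topology r)"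
    if b: "b \<in> scycles n (down_topology r)"
  proof -
    obtain a w where "a \<in> schains n Y" "sboundary n a = 0" "w \<in> schains (Suc n) (down_topology r)"
      "b = sboundary (Suc n) w + schain_map n g a"
      by (rule acyclic_cone_surj[OF ac, of b n, unfolded Y_eq P_eq])
         (use b in \<open>auto simp: scycles_def intro: that\<close>)
    then show ?thesis
      by (intro bexI[of _ a]) (auto simp: scycles_def sboundaries_def)
  qed
  show "a \<in> sboundaries n Y" if a: "a \<in> scycles n Y" "schain_map n g a \<in> sboundaries n (down_topology r)"
  proof -
    obtain w where "w \<in> schains (Suc n) (down_topology r)" "sboundary (Suc n) w = schain_map n g a"
      using a(2) by (auto simp: sboundaries_def)
    then obtain v where "v \<in> schains (Suc n) Y" "sboundary (Suc n) v = a"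
      by (rule acyclic_cone_inj[OF ac, of a n w, unfolded Y_eq P_eq, rotated 2])
         (use a(1) in \<open>auto simp: scycles_def intro: that\<close>)
    then show ?thesis
      by (auto simp: sboundaries_def)
  qed
qed

end

section \<open>Order complexes\<close>

definition chains_within :: "'p rel \<Rightarrow> 'p set \<Rightarrow> 'p set set" where
  "chains_within r D = {C \<in> order_complex r. C \<subseteq> D}"

lemma simplicial_complex_chains_within: "simplicial_complex (chains_within r D)"
  using simplicial_complex_order_complex[of r] unfolding simplicial_complex_def chains_within_def by blast

lemma chains_within_Field: "chains_within r (Field r) = order_complex r"
  by (auto simp: chains_within_def order_complex_def Chains_def intro: FieldI1)

text \<open>Suppose a chain had one element outside \<open>E\<close> and one outside
  \<open>F\<close>. They are comparable, and the smaller one would lie in the down-set that it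
  avoids. Hence tuples split over a union without any subdivision.\<close>

lemma chains_within_Un:
  assumes "E \<in> down_sets r" "F \<in> down_sets r"
  shows "chains_within r (E \<union> F) = chains_within r E \<union> chains_within r F"
proof -
  have "C \<subseteq> E \<or> C \<subseteq> F" if "C \<in> Chains r" "C \<subseteq> E \<union> F" for C
    using assms that unfolding down_sets_def Chains_def by blast
  then show ?thesis
    by (auto simp: chains_within_def order_complex_def)
qed

lemma insert_top_chains_within:
  assumes "C \<in> chains_within r (r\<inverse> `` {x})" "(x, x) \<in> r"
  shows "insert x C \<in> chains_within r (r\<inverse> `` {x})"
  using assms by (auto simp: chains_within_def order_complex_def Chains_def)

lemma simplex_tuples_mono: "K \<subseteq> L \<Longrightarrow> simplex_tuples n K \<subseteq> simplex_tuples n L"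
  by (auto simp: simplex_tuples_def)

lemma simplex_tuples_chains_within_Un:
  "E \<in> down_sets r \<Longrightarrow> F \<in> down_sets r \<Longrightarrow> simplex_tuples n (chains_within r (E \<union> F)) =
    simplex_tuples n (chains_within r E) \<union> simplex_tuples n (chains_within r F)"
  by (auto simp: chains_within_Un simplex_tuples_def)

lemma simplex_tuples_chains_within_Int:
  "simplex_tuples n (chains_within r D) \<inter> simplex_tuples n (chains_within r E) =
    simplex_tuples n (chains_within r (D \<inter> E))"
  by (auto simp: chains_within_def simplex_tuples_def)

lemma complex_family_simpchains:
  fixes r :: "'p rel"
  shows "complex_family (\<lambda>D n. simpchains n (chains_within r D)) simpboundary"
proof
  fix D E :: "'p set" and n and a b :: "('p, 'k::field) simpchain"
  show "0 \<in> simpchains n (chains_within r D)"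
    by (rule chain.subspace_0[OF subspace_simpchains])
  show "a - b \<in> simpchains n (chains_within r D)"
    if "a \<in> simpchains n (chains_within r D)" "b \<in> simpchains n (chains_within r D)"
    using that by (rule chain.subspace_diff[OF subspace_simpchains])
  show "simpchains n (chains_within r D) \<subseteq> simpchains n (chains_within r E)" if "D \<subseteq> E"
    using that by (auto simp: simpchains_def chains_within_def simplex_tuples_def)
  show "simpchains n (chains_within r D) \<inter> simpchains n (chains_within r E) \<subseteq> simpchains n (chains_within r (D \<inter> E))"
    unfolding simpchains_eq chains_on_Int simplex_tuples_chains_within_Int by simp
  show "simpboundary n (a - b) = simpboundary n a - simpboundary n b"
    by (rule simpboundary_diff)
  show "simpboundary (Suc n) a \<in> simpchains n (chains_within r D)" if "a \<in> simpchains (Suc n) (chains_within r D)"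
    by (rule simpboundary_in_simpchains[OF simplicial_complex_chains_within that])
  show "simpboundary n (simpboundary (Suc n) a) = 0" if "a \<in> simpchains (Suc n) (chains_within r D)"
    by (rule simpboundary_simpboundary[OF simplicial_complex_chains_within that])
  show "simpboundary 0 a = 0"
    by (rule simpboundary_eq_0)
qed

lemma excisive_simpchains:
  assumes "E \<in> down_sets r" "F \<in> down_sets r"
  shows "excisive (\<lambda>D n. simpchains n (chains_within r D)) simpboundary E F"
  unfolding excisive_def
proof (intro allI ballI impI)
  fix n b assume "b \<in> simpchains n (chains_within r (E \<union> F))"
  then have "b \<in> chains_on (simplex_tuples n (chains_within r E) \<union> simplex_tuples n (chains_within r F))"
    by (simp only: simpchains_eq simplex_tuples_chains_within_Un[OF assms])
  then obtain u v where "u \<in> simpchains n (chains_within r E)" "v \<in> simpchains n (chains_within r F)" "b = u + v"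
    unfolding simpchains_eq by (rule chains_on_UnE)
  then show "\<exists>w\<in>simpchains (Suc n) (chains_within r (E \<union> F)). \<exists>u\<in>simpchains n (chains_within r E).
      \<exists>v\<in>simpchains n (chains_within r F). b + simpboundary (Suc n) w = u + v"
    by (rule_tac bexI[of _ 0]) (auto simp: simpboundary_eq chain.subspace_0[OF subspace_simpchains])
qed

lemma simplex_tuples_empty: "simplex_tuples n (chains_within r {}) = {}"
  by (auto simp: simplex_tuples_def chains_within_def order_complex_def)

lemma simpchains_empty: "simpchains n (chains_within r {}) \<subseteq> {0}"
  by (simp add: simpchains_def simplex_tuples_empty)

lemma Cons_top_in_simplex_tuples:
  assumes "l \<in> simplex_tuples n (chains_within r (r\<inverse> `` {x}))" "(x, x) \<in> r"
  shows "x # l \<in> simplex_tuples (Suc n) (chains_within r (r\<inverse> `` {x}))"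
  using assms insert_top_chains_within by (auto simp: simplex_tuples_def)

text \<open>A chain below \<open>x\<close> stays a chain when \<open>x\<close> is added, and tuples
  may repeat \<open>x\<close>, so prepending \<open>x\<close> is always possible.\<close>

lemma aug_acyclic_simpchains:
  assumes "(x, x) \<in> r"
  shows "aug_acyclic_at (\<lambda>D n. simpchains n (chains_within r D)) simpboundary augment (r\<inverse> `` {x})"
  unfolding aug_acyclic_at_def
proof (intro allI ballI impI)
  let ?K = "chains_within r (r\<inverse> `` {x})"
  fix n a
  assume a: "a \<in> simpchains n ?K" "if n = 0 then augment a = 0 else simpboundary n a = 0"
  have "\<exists>b\<in>chains_on (simplex_tuples (Suc n) ?K). chain_extend tuple_boundary b = a"
  proof (rule acyclic_by_coning[where \<kappa> = "\<lambda>n l. x # l" and v = "[x]" and bd = "\<lambda>n. tuple_boundary"])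
    show "tuple_boundary (x # l) = Poly_Mapping.single l 1 - Poly_Mapping.single [x] 1"
      if "l \<in> simplex_tuples 0 ?K" for l
      using that by (auto simp: simplex_tuples_def length_Suc_conv)
    show "if n = 0 then augment a = 0 else chain_extend tuple_boundary a = 0"
      using a by (cases n) (auto simp: simpboundary_simpchains)
  qed (use a assms in \<open>auto simp: simpchains_eq cons_chain_def intro: Cons_top_in_simplex_tuples\<close>)
  then show "\<exists>b\<in>simpchains (Suc n) ?K. simpboundary (Suc n) b = a"
    by (metis simpboundary_simpchains simpchains_eq)
qed

subsection \<open>The orientation relations form an acyclic complex\<close>

lemma complex_family_simprels:
  fixes r :: "'p rel"
  shows "complex_family (\<lambda>D n. simprels n (chains_within r D)) simpboundary"
proof
  fix D E :: "'p set" and n and a b :: "('p, 'k::field) simpchain"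
  show "0 \<in> simprels n (chains_within r D)"
    by (rule chain.subspace_0[OF subspace_simprels])
  show "a - b \<in> simprels n (chains_within r D)"
    if "a \<in> simprels n (chains_within r D)" "b \<in> simprels n (chains_within r D)"
    using that by (rule chain.subspace_diff[OF subspace_simprels])
  show "simprels n (chains_within r D) \<subseteq> simprels n (chains_within r E)" if "D \<subseteq> E"
    unfolding simprels_eq_span_swap using that
    by (intro chain.span_mono swap_rel_gens_mono simplex_tuples_mono) (auto simp: chains_within_def)
  \<comment> \<open>An intersection of spans may in general exceed the span of the common
    generators; a projection that fixes the given chain closes the gap.\<close>
  show "simprels n (chains_within r D) \<inter> simprels n (chains_within r E) \<subseteq>
      (simprels n (chains_within r (D \<inter> E)) :: ('p, 'k) simpchain set)"
  proof
    text \<open>Restriction of chains to the tuples over \<open>E\<close> sends each generator to a generator or to 0.\<close>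
    let ?\<pi> = "chain_extend (\<lambda>l. if set l \<subseteq> E then Poly_Mapping.single l (1::'k) else 0)"
    fix c :: "('p, 'k) simpchain"
    assume c: "c \<in> simprels n (chains_within r D) \<inter> simprels n (chains_within r E)"
    then have "c \<in> simpchains n (chains_within r E)"
      using simprels_subset_simpchains by blast
    then have "set l \<subseteq> E" if "l \<in> Poly_Mapping.keys c" for l
      using that by (auto simp: simpchains_def simplex_tuples_def chains_within_def)
    then have "?\<pi> c = chain_extend (\<lambda>l. Poly_Mapping.single l 1) c"
      by (intro chain_extend_cong) simp
    moreover have "?\<pi> c \<in> simprels n (chains_within r (D \<inter> E))"
    proof (rule span_image_subset[OF module_hom_chain_extend subspace_simprels])
      show "c \<in> chain.span (swap_rel_gens (simplex_tuples n (chains_within r D)))"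
        using c by (simp add: simprels_eq_span_swap)
      show "?\<pi> g \<in> simprels n (chains_within r (D \<inter> E))"
        if "g \<in> swap_rel_gens (simplex_tuples n (chains_within r D))" for g
        unfolding simprels_eq_span_swap
      proof (rule swap_rel_gens_image[OF that])
        have DE: "l \<in> simplex_tuples n (chains_within r (D \<inter> E))"
          if "l \<in> simplex_tuples n (chains_within r D)" "set l \<subseteq> E" for l
          using that by (auto simp: simplex_tuples_def chains_within_def)
        show "?\<pi> (Poly_Mapping.single l 1) \<in> chain.span (swap_rel_gens (simplex_tuples n (chains_within r (D \<inter> E))))"
          if "l \<in> simplex_tuples n (chains_within r D)" "\<not> distinct l" for l
          using DE[of l] that by (auto intro!: chain.span_base degenerate_in_swap_rel_gens simp: chain.span_zero)
        show "?\<pi> (Poly_Mapping.single (xs @ b # a # ys) 1 + Poly_Mapping.single (xs @ a # b # ys) 1)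
            \<in> chain.span (swap_rel_gens (simplex_tuples n (chains_within r (D \<inter> E))))"
          if "xs @ a # b # ys \<in> simplex_tuples n (chains_within r D)" for xs a b ys
        proof (cases "set (xs @ a # b # ys) \<subseteq> E")
          case True
          then show ?thesis
            using chain.span_base[OF swap_in_swap_rel_gens[OF DE[OF that True]]] by (simp add: chain_extend_add)
        next
          case False
          then have "\<not> set (xs @ b # a # ys) \<subseteq> E"
            by auto
          with False show ?thesis
            by (simp add: chain_extend_add chain.span_zero del: set_append set_simps)
        qed
      qed
    qed
    ultimately show "c \<in> simprels n (chains_within r (D \<inter> E))"
      by simp
  qed
  show "simpboundary n (a - b) = simpboundary n a - simpboundary n b"
    by (rule simpboundary_diff)
  show "simpboundary (Suc n) a \<in> simprels n (chains_within r D)" if "a \<in> simprels (Suc n) (chains_within r D)"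
    by (rule simpboundary_in_simprels[OF simplicial_complex_chains_within that])
  show "simpboundary n (simpboundary (Suc n) a) = 0" if "a \<in> simprels (Suc n) (chains_within r D)"
    by (rule simpboundary_simpboundary[OF simplicial_complex_chains_within subsetD[OF simprels_subset_simpchains that]])
  show "simpboundary 0 a = 0"
    by (rule simpboundary_eq_0)
qed

lemma swap_rel_gens_Un: "swap_rel_gens (A \<union> B) = swap_rel_gens A \<union> swap_rel_gens B"
  unfolding swap_rel_gens_def by blast

lemma excisive_simprels:
  assumes "E \<in> down_sets r" "F \<in> down_sets r"
  shows "excisive (\<lambda>D n. simprels n (chains_within r D)) simpboundary E F"
  unfolding excisive_def
proof (intro allI ballI impI)
  fix n and b :: "('a, 'b) simpchain" assume "b \<in> simprels n (chains_within r (E \<union> F))"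
  then have "b \<in> {u + v | u v. u \<in> simprels n (chains_within r E) \<and> v \<in> simprels n (chains_within r F)}"
    unfolding simprels_eq_span_swap simplex_tuples_chains_within_Un[OF assms] swap_rel_gens_Un
    by (simp add: chain.span_Un)
  then show "\<exists>w\<in>simprels (Suc n) (chains_within r (E \<union> F)). \<exists>u\<in>simprels n (chains_within r E).
      \<exists>v\<in>simprels n (chains_within r F). b + simpboundary (Suc n) w = u + v"
    by (rule_tac bexI[of _ 0]) (auto simp: simpboundary_eq chain.subspace_0[OF subspace_simprels])
qed

text \<open>Prepending \<open>x\<close> sends relations to relations, so it contracts their complex
  too. In degree 0, where an augmentation would otherwise enter, the only relation is 0.\<close>

lemma acyclic_simprels_principal:
  assumes "(x, x) \<in> r"
  shows "acyclic_at (\<lambda>D n. simprels n (chains_within r D)) simpboundary (r\<inverse> `` {x})"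
  unfolding acyclic_at_def
proof (intro allI ballI impI)
  let ?K = "chains_within r (r\<inverse> `` {x})"
  fix n and z :: "('a, 'b) simpchain"
  assume z: "z \<in> simprels n ?K" "simpboundary n z = 0"
  show "\<exists>w\<in>simprels (Suc n) ?K. simpboundary (Suc n) w = z"
  proof (cases n)
    case 0
    then have "z = 0"
      using z simprels_0 by blast
    then show ?thesis
      by (intro bexI[of _ 0]) (auto simp: simpboundary_eq chain.subspace_0[OF subspace_simprels])
  next
    case (Suc m)
    have w: "cons_chain x z \<in> simprels (Suc n) ?K"
      using z(1) unfolding simprels_eq_span_swap
      by (rule cons_chain_in_span_swap_rel_gens) (rule Cons_top_in_simplex_tuples[OF _ assms])
    \<comment> \<open>In positive degree \<open>simpboundary\<close> agrees with
      \<open>tuple_boundary\<close>, so the second term of the cone formula vanishes.\<close>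
    have "chain_extend tuple_boundary z = 0"
      using z simpboundary_simpchains[of z m ?K] simprels_subset_simpchains[of n ?K] Suc by auto
    then have "simpboundary (Suc n) (cons_chain x z) = z"
      using simpboundary_simpchains[OF subsetD[OF simprels_subset_simpchains w]]
      by (simp add: chain_extend_tuple_boundary_cons)
    with w show ?thesis
      by blast
  qed
qed

context finite_poset
begin

lemma acyclic_simprels:
  assumes "z \<in> simprels n (order_complex r)" "simpboundary n z = 0"
  shows "\<exists>w\<in>simprels (Suc n) (order_complex r). simpboundary (Suc n) w = z"
proof -
  interpret complex_family "\<lambda>D n. simprels n (chains_within r D)" simpboundary
    by (rule complex_family_simprels)
  have "acyclic_at (\<lambda>D n. simprels n (chains_within r D)) simpboundary (Field r)"
  proof (rule acyclic_on_down_sets[OF fin po Field_down_sets])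
    show "simprels n (chains_within r {}) \<subseteq> {0}" for n
      using simprels_subset_simpchains simpchains_empty by (rule subset_trans)
  qed (simp_all add: acyclic_simprels_principal refl excisive_simprels)
  then show ?thesis
    using assms unfolding acyclic_at_def chains_within_Field by blast
qed

end

subsection \<open>From the order complex to the down-set topology\<close>

definition chain_min :: "'p rel \<Rightarrow> 'p set \<Rightarrow> 'p" where
  "chain_min r C = (THE m. m \<in> C \<and> (\<forall>y\<in>C. (m, y) \<in> r))"

text \<open>The vertices of the carrier of the point \<open>t\<close>, that is, of the smallest face
  containing it; entries of \<open>l\<close> that repeat are merged.\<close>

definition positive_entries :: "nat \<Rightarrow> 'p list \<Rightarrow> (nat \<Rightarrow> real) \<Rightarrow> 'p set" where
  "positive_entries n l t = (\<lambda>i. l ! i) ` {i. i \<le> n \<and> 0 < t i}"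

text \<open>
  This is McCord's map from the geometric realization of the order complex: a point goes to the least
  vertex of its carrier.
\<close>

definition order_simplex :: "'p rel \<Rightarrow> nat \<Rightarrow> 'p list \<Rightarrow> (nat \<Rightarrow> real) \<Rightarrow> 'p" where
  "order_simplex r n l = restrict (\<lambda>t. chain_min r (positive_entries n l t)) (standard_simplex n)"

definition order_schain :: "'p rel \<Rightarrow> nat \<Rightarrow> ('p, 'k::field) simpchain \<Rightarrow> ('p, 'k) schain" where
  "order_schain r n = chain_extend (\<lambda>l. Poly_Mapping.single (order_simplex r n l) 1)"

lemma positive_entries_nonempty:
  assumes "t \<in> standard_simplex n"
  shows "positive_entries n l t \<noteq> {}"
proof
  assume "positive_entries n l t = {}"
  then have "t i = 0" if "i \<le> n" for i
    using assms that by (auto simp: positive_entries_def standard_simplex_def order.strict_iff_order)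
  then have "(\<Sum>i\<le>n. t i) = 0"
    by simp
  then show False
    using assms by (simp add: standard_simplex_def)
qed

lemma positive_entries_subset: "length l = Suc n \<Longrightarrow> positive_entries n l t \<subseteq> set l"
  by (auto simp: positive_entries_def)

lemma positive_entries_map: "length l = Suc n \<Longrightarrow> positive_entries n (map f l) t = f ` positive_entries n l t"
  by (auto simp: positive_entries_def image_image)

text \<open>The face map inserts a zero at coordinate \<open>k\<close>, which hides exactly the
  entry at position \<open>k\<close>. This is what makes the comparison commute with faces.\<close>

lemma positive_entries_face:
  assumes "length l = Suc (Suc n)" "k \<le> Suc n"
  shows "positive_entries (Suc n) l (simplical_face k t) = positive_entries n (take k l @ drop (Suc k) l) t"
proof
  have nth: "(take k l @ drop (Suc k) l) ! i = l ! (if i < k then i else Suc i)" if "i \<le> n" for i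
    using assms that by (auto simp: nth_append min_def)
  show "positive_entries (Suc n) l (simplical_face k t) \<subseteq> positive_entries n (take k l @ drop (Suc k) l) t"
  proof
    fix x assume "x \<in> positive_entries (Suc n) l (simplical_face k t)"
    then obtain i where i: "x = l ! i" "i \<le> Suc n" "0 < simplical_face k t i"
      by (auto simp: positive_entries_def)
    show "x \<in> positive_entries n (take k l @ drop (Suc k) l) t"
    proof (cases "i < k")
      case True
      then show ?thesis
        using i assms nth[of i] unfolding positive_entries_def
        by (intro image_eqI[of _ _ i]) (auto simp: simplical_face_def)
    next
      case False
      then have "k < i"
        using i(3) by (cases "i = k") (auto simp: simplical_face_def)
      then show ?thesis
        using i assms nth[of "i - 1"] unfolding positive_entries_def
        by (intro image_eqI[of _ _ "i - 1"]) (auto simp: simplical_face_def)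
    qed
  qed
  show "positive_entries n (take k l @ drop (Suc k) l) t \<subseteq> positive_entries (Suc n) l (simplical_face k t)"
  proof
    fix x assume "x \<in> positive_entries n (take k l @ drop (Suc k) l) t"
    then obtain i where "x = (take k l @ drop (Suc k) l) ! i" "i \<le> n" "0 < t i"
      by (auto simp: positive_entries_def)
    then show "x \<in> positive_entries (Suc n) l (simplical_face k t)"
      using nth[of i] unfolding positive_entries_def
      by (intro image_eqI[of _ _ "if i < k then i else Suc i"]) (auto simp: simplical_face_def)
  qed
qed

lemma singular_face_order_simplex:
  assumes "length l = Suc (Suc n)" "k \<le> Suc n"
  shows "singular_face (Suc n) k (order_simplex r (Suc n) l) = order_simplex r n (take k l @ drop (Suc k) l)"
proof (rule extensionalityI[of _ "standard_simplex n"])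
  fix t :: "nat \<Rightarrow> real" assume t: "t \<in> standard_simplex n"
  then have "simplical_face k t \<in> standard_simplex (Suc n)"
    using assms by (intro simplical_face_in_standard_simplex) auto
  then show "singular_face (Suc n) k (order_simplex r (Suc n) l) t = order_simplex r n (take k l @ drop (Suc k) l) t"
    using t by (simp add: singular_face_def order_simplex_def positive_entries_face[OF assms])
qed (auto simp: singular_face_def order_simplex_def)

lemma order_schain_simpboundary:
  assumes "c \<in> simpchains (Suc n) K"
  shows "order_schain r n (simpboundary (Suc n) c) = sboundary (Suc n) (order_schain r (Suc n) c)"
  unfolding order_schain_def sboundary_eq simpboundary_eq chain_extend_compose
proof (rule chain_extend_cong)
  fix l assume "l \<in> Poly_Mapping.keys c"
  then have "length l = Suc (Suc n)"
    using assms by (auto simp: simpchains_def simplex_tuples_def)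
  then show "chain_extend (\<lambda>l. Poly_Mapping.single (order_simplex r n l) 1)
      (if Suc n = 0 then 0
       else \<Sum>k\<le>Suc n. Poly_Mapping.single (take k l @ drop (Suc k) l) ((- 1) ^ k)) =
      chain_extend (sboundary_simplex (Suc n)) (Poly_Mapping.single (order_simplex r (Suc n) l) 1)"
    by (simp add: sboundary_simplex_def chain_extend_sum singular_face_order_simplex del: sum.atMost_Suc)
qed

context finite_poset
begin

lemma chain_min_eqI: "m \<in> C \<Longrightarrow> (\<And>y. y \<in> C \<Longrightarrow> (m, y) \<in> r) \<Longrightarrow> chain_min r C = m"
  unfolding chain_min_def using antisym by (intro the_equality) (auto dest: antisymD)

lemma chain_has_min:
  assumes "finite C" "C \<noteq> {}" "C \<in> Chains r"
  shows "\<exists>m\<in>C. \<forall>y\<in>C. (m, y) \<in> r"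
  using assms
proof (induction C rule: finite_ne_induct)
  case (singleton x)
  then show ?case by (auto simp: Chains_def)
next
  case (insert x C)
  then obtain m where m: "m \<in> C" "\<forall>y\<in>C. (m, y) \<in> r"
    by (auto simp: Chains_def)
  have xx: "(x, x) \<in> r"
    using insert.prems by (auto simp: Chains_def)
  have "(x, m) \<in> r \<or> (m, x) \<in> r"
    using insert.prems m(1) by (auto simp: Chains_def)
  then show ?case
  proof
    assume xm: "(x, m) \<in> r"
    have "(x, y) \<in> r" if "y \<in> C" for y
      using transD[OF trans xm] m(2) that by blast
    then show ?case
      using xx by blast
  next
    assume "(m, x) \<in> r"
    then show ?case
      using m by blast
  qed
qed

lemma
  assumes "finite C" "C \<noteq> {}" "C \<in> Chains r"
  shows chain_min_in: "chain_min r C \<in> C"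
    and chain_min_le: "y \<in> C \<Longrightarrow> (chain_min r C, y) \<in> r"
  using chain_has_min[OF assms] chain_min_eqI by auto

lemma positive_entries_chain:
  assumes "l \<in> simplex_tuples n (order_complex r)" "t \<in> standard_simplex n"
  shows "finite (positive_entries n l t)" "positive_entries n l t \<noteq> {}" "positive_entries n l t \<in> Chains r"
proof -
  have l: "length l = Suc n" "set l \<in> Chains r"
    using assms(1) by (auto simp: simplex_tuples_def order_complex_def)
  show "finite (positive_entries n l t)"
    by (simp add: positive_entries_def)
  show "positive_entries n l t \<noteq> {}"
    by (rule positive_entries_nonempty[OF assms(2)])
  show "positive_entries n l t \<in> Chains r"
    using positive_entries_subset[OF l(1), of t] l(2) unfolding Chains_def by blast
qed

text \<open>The least vertex of a carrier lies in a down-set exactly when some vertex of the carrier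
  does. The preimage of an open set is therefore a union of sets given by positivity of one
  coordinate.\<close>

lemma singular_simplex_order_simplex:
  assumes l: "l \<in> simplex_tuples n (chains_within r D)"
  shows "singular_simplex n (subtopology (down_topology r) D) (order_simplex r n l)"
proof -
  let ?S = "subtopology (powertop_real UNIV) (standard_simplex n)"
  let ?\<sigma> = "order_simplex r n l"
  have len: "length l = Suc n" and lD: "set l \<subseteq> D" and l': "l \<in> simplex_tuples n (order_complex r)"
    using l by (auto simp: simplex_tuples_def chains_within_def)
  have lF: "set l \<subseteq> Field r"
    using l' by (auto simp: simplex_tuples_def order_complex_def Chains_def intro: FieldI1)
  have \<sigma>_in: "?\<sigma> t \<in> positive_entries n l t"
    and \<sigma>_le: "y \<in> positive_entries n l t \<Longrightarrow> (?\<sigma> t, y) \<in> r" if t: "t \<in> standard_simplex n" for t y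
    using chain_min_in[OF positive_entries_chain[OF l' t]] chain_min_le[OF positive_entries_chain[OF l' t], of y] t
    by (auto simp: order_simplex_def)
  have \<sigma>_set: "?\<sigma> t \<in> set l" if t: "t \<in> standard_simplex n" for t
    using \<sigma>_in[OF t] positive_entries_subset[OF len, of t] by blast
  have "continuous_map ?S (down_topology r) ?\<sigma>"
    unfolding continuous_map_def
  proof (intro conjI allI impI)
    show "?\<sigma> \<in> topspace ?S \<rightarrow> topspace (down_topology r)"
      using \<sigma>_set lF by auto
    fix U assume "openin (down_topology r) U"
    then have U: "U \<in> down_sets r"
      by simp
    have "{t \<in> topspace ?S. ?\<sigma> t \<in> U} = (\<Union>i\<in>{i. i \<le> n \<and> l ! i \<in> U}. {t \<in> topspace ?S. t i \<in> {0<..}})"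
    proof
      show "{t \<in> topspace ?S. ?\<sigma> t \<in> U} \<subseteq> (\<Union>i\<in>{i. i \<le> n \<and> l ! i \<in> U}. {t \<in> topspace ?S. t i \<in> {0<..}})"
        using \<sigma>_in by (fastforce simp: positive_entries_def)
      show "(\<Union>i\<in>{i. i \<le> n \<and> l ! i \<in> U}. {t \<in> topspace ?S. t i \<in> {0<..}}) \<subseteq> {t \<in> topspace ?S. ?\<sigma> t \<in> U}"
      proof
        fix t assume "t \<in> (\<Union>i\<in>{i. i \<le> n \<and> l ! i \<in> U}. {t \<in> topspace ?S. t i \<in> {0<..}})"
        then obtain i where i: "i \<le> n" "l ! i \<in> U" "t \<in> standard_simplex n" "0 < t i"
          by auto
        then have "(?\<sigma> t, l ! i) \<in> r"
          by (intro \<sigma>_le) (auto simp: positive_entries_def)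
        then show "t \<in> {t \<in> topspace ?S. ?\<sigma> t \<in> U}"
          using U i unfolding down_sets_def by auto
      qed
    qed
    moreover have "openin ?S {t \<in> topspace ?S. t i \<in> {0<..}}" for i
      by (rule openin_continuous_map_preimage[of _ euclideanreal])
         (auto intro: continuous_map_from_subtopology continuous_map_product_projection)
    ultimately show "openin ?S {t \<in> topspace ?S. ?\<sigma> t \<in> U}"
      by auto
  qed
  then show ?thesis
    using \<sigma>_set lD unfolding singular_simplex_subtopology
    by (auto simp: singular_simplex_def order_simplex_def)
qed

lemma order_schain_in_schains:
  "c \<in> simpchains n (chains_within r D) \<Longrightarrow> order_schain r n c \<in> schains n (subtopology (down_topology r) D)"
  unfolding order_schain_def simpchains_eq schains_eq
  by (rule chain_extend_in_chains_on) (auto intro!: single_in_chains_on singular_simplex_order_simplex)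

lemma family_map_order_schain:
  "family_map (\<lambda>D n. simpchains n (chains_within r D)) simpboundary
    (\<lambda>D n. schains n (subtopology (down_topology r) (id -` D))) sboundary (order_schain r)"
proof (intro family_map.intro family_map_axioms.intro complex_family_schains complex_family_simpchains)
  show "order_schain r n (a - b) = order_schain r n a - order_schain r n b" for n a b
    by (simp add: order_schain_def chain_extend_diff)
  show "order_schain r n a \<in> schains n (subtopology (down_topology r) (id -` D))"
    if "a \<in> simpchains n (chains_within r D)" for a D n
    using order_schain_in_schains[OF that] by simp
  show "order_schain r n (simpboundary (Suc n) a) = sboundary (Suc n) (order_schain r (Suc n) a)"
    if "a \<in> simpchains (Suc n) (chains_within r D)" for a D n
    by (rule order_schain_simpboundary[OF that])
qed

lemma acyclic_cone_order_schain:
  assumes D: "D \<in> down_sets r"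
  shows "acyclic_at
    (cone_carrier (\<lambda>D n. simpchains n (chains_within r D)) (\<lambda>D n. schains n (subtopology (down_topology r) (id -` D))))
    (cone_d simpboundary sboundary (order_schain r :: nat \<Rightarrow> ('p, 'k::field) simpchain \<Rightarrow> ('p, 'k) schain)) D"
proof -
  interpret family_map "\<lambda>D n. simpchains n (chains_within r D)" simpboundary
    "\<lambda>D n. schains n (subtopology (down_topology r) (id -` D))" sboundary
    "order_schain r :: nat \<Rightarrow> ('p, 'k::field) simpchain \<Rightarrow> ('p, 'k) schain"
    by (rule family_map_order_schain)
  interpret cone: complex_family mcone dmcone
    by (rule complex_family_cone)
  show ?thesis
  proof (rule cone.acyclic_on_down_sets[OF fin po D])
    show "mcone {} n \<subseteq> {0}" for n
      using simpchains_empty[of _ r] schains_vimage_empty[of _ "down_topology r" id]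
      by (cases n) (fastforce simp: cone_carrier_def zero_prod_def)+
    have "continuous_map (down_topology r) (down_topology r) id"
      by simp
    then show "excisive mcone dmcone E F" if "E \<in> down_sets r" "F \<in> down_sets r" for E F
      by (intro excisive_cone excisive_schains[of _ r] excisive_simpchains that)
    fix x assume x: "x \<in> Field r"
    show "acyclic_at mcone dmcone (r\<inverse> `` {x})"
    proof (rule acyclic_at_coneI[where \<epsilon>G = augment and \<epsilon>H = augment])
      show "\<exists>a\<in>simpchains 0 (chains_within r (r\<inverse> `` {x})). augment a = augment b" for b :: "('p, 'k) schain"
        unfolding simpchains_eq
        by (rule augment_surj[of "[x]"])
           (use refl[OF x] in \<open>auto simp: simplex_tuples_def chains_within_def order_complex_def Chains_def\<close>)
      show "augment (order_schain r 0 a) = augment a" for a :: "('p, 'k) simpchain"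
        by (simp add: order_schain_def augment_chain_extend_single)
    qed (rule aug_acyclic_simpchains[OF refl[OF x]] aug_acyclic_schains[OF poset_model_id x refl[OF x]]
        augment_sboundary augment_diff)+
  qed
qed

lemma
  fixes a :: "('p, 'k::field) simpchain" and b :: "('p, 'k) schain"
  shows order_schain_homology_surj: "b \<in> scycles n (down_topology r) \<Longrightarrow>
      \<exists>a\<in>simpchains n (order_complex r). simpboundary n a = 0 \<and>
        b - order_schain r n a \<in> sboundaries n (down_topology r)"
    and order_schain_homology_inj: "a \<in> simpchains n (order_complex r) \<Longrightarrow> simpboundary n a = 0 \<Longrightarrow>
      order_schain r n a \<in> sboundaries n (down_topology r) \<Longrightarrow>
      a \<in> simpboundary (Suc n) ` simpchains (Suc n) (order_complex r)"
proof -
  interpret family_map "\<lambda>D n. simpchains n (chains_within r D)" simpboundary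
    "\<lambda>D n. schains n (subtopology (down_topology r) (id -` D))" sboundary
    "order_schain r :: nat \<Rightarrow> ('p, 'k) simpchain \<Rightarrow> ('p, 'k) schain"
    by (rule family_map_order_schain)
  have P_eq: "subtopology (down_topology r) (id -` Field r) = down_topology r"
    by (intro subtopology_superset) auto
  note ac = acyclic_cone_order_schain[OF Field_down_sets]
  show "\<exists>a\<in>simpchains n (order_complex r). simpboundary n a = 0 \<and>
      b - order_schain r n a \<in> sboundaries n (down_topology r)"
    if b: "b \<in> scycles n (down_topology r)"
  proof -
    obtain a w where "a \<in> simpchains n (order_complex r)" "simpboundary n a = 0"
      "w \<in> schains (Suc n) (down_topology r)" "b = sboundary (Suc n) w + order_schain r n a"
      by (rule acyclic_cone_surj[OF ac, of b n, unfolded chains_within_Field P_eq])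
         (use b in \<open>auto simp: scycles_def intro: that\<close>)
    then show ?thesis
      by (intro bexI[of _ a]) (auto simp: sboundaries_def)
  qed
  show "a \<in> simpboundary (Suc n) ` simpchains (Suc n) (order_complex r)"
    if a: "a \<in> simpchains n (order_complex r)" "simpboundary n a = 0"
      "order_schain r n a \<in> sboundaries n (down_topology r)"
  proof -
    obtain w where "w \<in> schains (Suc n) (down_topology r)" "sboundary (Suc n) w = order_schain r n a"
      using a(3) by (auto simp: sboundaries_def)
    then obtain v where "v \<in> simpchains (Suc n) (order_complex r)" "simpboundary (Suc n) v = a"
      by (rule acyclic_cone_inj[OF ac, of a n w, unfolded chains_within_Field P_eq, rotated 2])
         (use a in \<open>auto intro: that\<close>)
    then show ?thesis
      by auto
  qed
qed

text \<open>An order-preserving map sends the least element of a chain to the least element of its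
  image, even if it merges elements. Naturality thus holds on chains and not merely up to
  homotopy.\<close>

lemma simplex_map_order_simplex:
  assumes l: "l \<in> simplex_tuples n (order_complex r)"
    and r': "finite_poset r'" and f: "\<And>x y. (x, y) \<in> r \<Longrightarrow> (f x, f y) \<in> r'"
  shows "simplex_map n f (order_simplex r n l) = order_simplex r' n (map f l)"
proof (rule extensionalityI[of _ "standard_simplex n"])
  fix t assume t: "t \<in> standard_simplex n"
  let ?C = "positive_entries n l t"
  note C = positive_entries_chain[OF l t]
  have "chain_min r' (f ` ?C) = f (chain_min r ?C)"
    by (rule finite_poset.chain_min_eqI[OF r']) (auto intro: chain_min_in[OF C] f chain_min_le[OF C])
  then show "simplex_map n f (order_simplex r n l) t = order_simplex r' n (map f l) t"
    using t l by (simp add: simplex_map_def order_simplex_def positive_entries_map simplex_tuples_def)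
qed (auto simp: simplex_map_def order_simplex_def)

lemma schain_map_order_schain:
  assumes c: "c \<in> simpchains n (order_complex r)"
    and r': "finite_poset r'" and f: "\<And>x y. (x, y) \<in> r \<Longrightarrow> (f x, f y) \<in> r'"
  shows "schain_map n f (order_schain r n c) = order_schain r' n (tuple_map f c)"
  unfolding schain_map_def order_schain_def tuple_map_def chain_extend_compose
proof (rule chain_extend_cong)
  fix l assume "l \<in> Poly_Mapping.keys c"
  then have "l \<in> simplex_tuples n (order_complex r)"
    using c by (auto simp: simpchains_def)
  then show "chain_extend (\<lambda>\<sigma>. Poly_Mapping.single (simplex_map n f \<sigma>) 1) (Poly_Mapping.single (order_simplex r n l) 1) =
      chain_extend (\<lambda>l. Poly_Mapping.single (order_simplex r' n l) 1) (Poly_Mapping.single (map f l) 1)"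
    by (simp add: simplex_map_order_simplex[OF _ r' f])
qed

end

section \<open>Natural isomorphisms of persistence modules\<close>

text \<open>The zigzag contains an arrow pointing backwards, which is inverted on homology.\<close>

lemma vect_iso_inverse:
  fixes V :: "('k::field, 'v) module"
  assumes V: "vect V" and h: "h \<in> vect_iso V W"
  shows "inv_into (carrier V) h \<in> vect_iso W V"
proof -
  interpret module "field_ring :: 'k ring" V
    using V by (simp add: vect_def)
  let ?g = "inv_into (carrier V) h"
  have bij: "bij_betw h (carrier V) (carrier W)"
    and add: "\<And>x y. x \<in> carrier V \<Longrightarrow> y \<in> carrier V \<Longrightarrow> h (x \<oplus>\<^bsub>V\<^esub> y) = h x \<oplus>\<^bsub>W\<^esub> h y"
    and scale: "\<And>a x. x \<in> carrier V \<Longrightarrow> h (a \<odot>\<^bsub>V\<^esub> x) = a \<odot>\<^bsub>W\<^esub> h x"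
    using h by (auto simp: vect_iso_def vect_hom_def)
  have g_in: "?g x \<in> carrier V" and hg: "h (?g x) = x" if "x \<in> carrier W" for x
    using bij that by (auto simp: bij_betw_def inv_into_into f_inv_into_f)
  have gh: "?g (h x) = x" if "x \<in> carrier V" for x
    using bij that by (simp add: bij_betw_def)
  have smult: "a \<odot>\<^bsub>V\<^esub> x \<in> carrier V" if "x \<in> carrier V" for a x
    using that by (intro smult_closed) (simp_all add: field_ring_def)
  have "?g (x \<oplus>\<^bsub>W\<^esub> y) = ?g x \<oplus>\<^bsub>V\<^esub> ?g y" if "x \<in> carrier W" "y \<in> carrier W" for x y
    using gh[of "?g x \<oplus>\<^bsub>V\<^esub> ?g y"] add[OF g_in[OF that(1)] g_in[OF that(2)]] that by (simp add: g_in hg)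
  moreover have "?g (a \<odot>\<^bsub>W\<^esub> x) = a \<odot>\<^bsub>V\<^esub> ?g x" if "x \<in> carrier W" for a x
    using gh[of "a \<odot>\<^bsub>V\<^esub> ?g x"] scale[OF g_in[OF that], of a] that by (simp add: g_in hg smult)
  ultimately show ?thesis
    using bij_betw_inv_into[OF bij] g_in by (auto simp: vect_iso_def vect_hom_def)
qed

lemma vect_iso_compose:
  assumes "h \<in> vect_iso V W" "h' \<in> vect_iso W U"
  shows "h' \<circ> h \<in> vect_iso V U"
proof -
  have "bij_betw (h' \<circ> h) (carrier V) (carrier U)"
    using assms by (intro bij_betw_trans[of h _ "carrier W"]) (auto simp: vect_iso_def)
  moreover have "h x \<in> carrier W" if "x \<in> carrier V" for x
    using assms(1) that by (auto simp: vect_iso_def vect_hom_def)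
  ultimately show ?thesis
    using assms by (simp add: vect_iso_def vect_hom_def Pi_iff)
qed

lemma naturally_isomorphicE:
  assumes "naturally_isomorphic I F G"
  obtains \<eta> where "persistence_module I F" "persistence_module I G"
    "\<And>i. i \<in> I \<Longrightarrow> \<eta> i \<in> vect_iso (dob F i) (dob G i)"
    "\<And>i j v. i \<in> I \<Longrightarrow> j \<in> I \<Longrightarrow> i \<le> j \<Longrightarrow> v \<in> carrier (dob F i) \<Longrightarrow>
      \<eta> j (dmor F i j v) = dmor G i j (\<eta> i v)"
proof -
  from assms obtain \<eta> where
    "(\<forall>i\<in>I. \<eta> i \<in> vect_iso (dob F i) (dob G i)) \<and>
     (\<forall>i\<in>I. \<forall>j\<in>I. i \<le> j \<longrightarrow>
        (\<forall>v \<in> carrier (dob F i). \<eta> j (dmor F i j v) = dmor G i j (\<eta> i v)))"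
    unfolding naturally_isomorphic_def by (elim conjE exE) (rule that, intro conjI)
  then show ?thesis
    using assms by (intro that[of \<eta>]) (simp_all add: naturally_isomorphic_def)
qed

lemma naturally_isomorphic_sym:
  assumes "naturally_isomorphic I F G"
  shows "naturally_isomorphic I G F"
proof -
  obtain \<eta> where F: "persistence_module I F" and G: "persistence_module I G"
    and \<eta>: "\<And>i. i \<in> I \<Longrightarrow> \<eta> i \<in> vect_iso (dob F i) (dob G i)"
    and nat: "\<And>i j v. i \<in> I \<Longrightarrow> j \<in> I \<Longrightarrow> i \<le> j \<Longrightarrow> v \<in> carrier (dob F i) \<Longrightarrow>
      \<eta> j (dmor F i j v) = dmor G i j (\<eta> i v)"
    by (rule naturally_isomorphicE[OF assms]; rule that)
  let ?\<theta> = "\<lambda>i. inv_into (carrier (dob F i)) (\<eta> i)"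
  have bij: "bij_betw (\<eta> i) (carrier (dob F i)) (carrier (dob G i))" if "i \<in> I" for i
    using \<eta>[OF that] by (simp add: vect_iso_def)
  have "?\<theta> i \<in> vect_iso (dob G i) (dob F i)" if "i \<in> I" for i
    using F \<eta>[OF that] that by (intro vect_iso_inverse) (auto simp: persistence_module_def)
  moreover have "?\<theta> j (dmor G i j v) = dmor F i j (?\<theta> i v)"
    if ij: "i \<in> I" "j \<in> I" "i \<le> j" and v: "v \<in> carrier (dob G i)" for i j v
  proof -
    have u: "?\<theta> i v \<in> carrier (dob F i)" "\<eta> i (?\<theta> i v) = v"
      using bij[OF ij(1)] v by (auto simp: bij_betw_def inv_into_into f_inv_into_f)
    have "dmor F i j \<in> vect_hom (dob F i) (dob F j)"
      using F ij by (simp add: persistence_module_def)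
    then have "dmor F i j (?\<theta> i v) \<in> carrier (dob F j)"
      using u(1) by (auto simp: vect_hom_def)
    then have "?\<theta> j (\<eta> j (dmor F i j (?\<theta> i v))) = dmor F i j (?\<theta> i v)"
      using bij[OF ij(2)] by (simp add: bij_betw_def)
    then show ?thesis
      using nat[OF ij u(1)] u(2) by simp
  qed
  ultimately show ?thesis
    unfolding naturally_isomorphic_def using F G by (intro conjI exI[of _ ?\<theta>]) simp_all
qed

lemma naturally_isomorphic_trans:
  assumes "naturally_isomorphic I F G" "naturally_isomorphic I G H"
  shows "naturally_isomorphic I F H"
proof -
  obtain \<eta> where F: "persistence_module I F" and "persistence_module I G"
    and \<eta>: "\<And>i. i \<in> I \<Longrightarrow> \<eta> i \<in> vect_iso (dob F i) (dob G i)"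
    and \<eta>_nat: "\<And>i j v. i \<in> I \<Longrightarrow> j \<in> I \<Longrightarrow> i \<le> j \<Longrightarrow> v \<in> carrier (dob F i) \<Longrightarrow>
      \<eta> j (dmor F i j v) = dmor G i j (\<eta> i v)"
    by (rule naturally_isomorphicE[OF assms(1)]; rule that)
  obtain \<theta> where "persistence_module I G" and H: "persistence_module I H"
    and \<theta>: "\<And>i. i \<in> I \<Longrightarrow> \<theta> i \<in> vect_iso (dob G i) (dob H i)"
    and \<theta>_nat: "\<And>i j v. i \<in> I \<Longrightarrow> j \<in> I \<Longrightarrow> i \<le> j \<Longrightarrow> v \<in> carrier (dob G i) \<Longrightarrow>
      \<theta> j (dmor G i j v) = dmor H i j (\<theta> i v)"
    by (rule naturally_isomorphicE[OF assms(2)]; rule that)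
  have "\<eta> i v \<in> carrier (dob G i)" if "i \<in> I" "v \<in> carrier (dob F i)" for i v
    using \<eta>[OF that(1)] that(2) by (auto simp: vect_iso_def vect_hom_def)
  then show ?thesis
    unfolding naturally_isomorphic_def using F H
    by (intro conjI exI[of _ "\<lambda>i. \<theta> i \<circ> \<eta> i"]) (auto simp: \<eta>_nat \<theta>_nat intro: vect_iso_compose \<eta> \<theta>)
qed

subsection \<open>Subquotients of spaces of chains\<close>

lemma coset_eq_iff:
  assumes "chain.subspace B"
  shows "x +o B = y +o B \<longleftrightarrow> x - y \<in> B"
proof
  assume "x +o B = y +o B"
  moreover have "x \<in> x +o B"
    using chain.subspace_0[OF assms] by (force simp: elt_set_plus_def)
  ultimately show "x - y \<in> B"
    by (auto simp: elt_set_plus_def)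
next
  assume xy: "x - y \<in> B"
  show "x +o B = y +o B"
  proof (intro subset_antisym subsetI)
    fix z assume "z \<in> x +o B"
    then obtain b where "b \<in> B" "z = y + ((x - y) + b)"
      by (auto simp: elt_set_plus_def)
    then show "z \<in> y +o B"
      using chain.subspace_add[OF assms xy] unfolding elt_set_plus_def by blast
  next
    fix z assume "z \<in> y +o B"
    then obtain b where "b \<in> B" "z = x + (b - (x - y))"
      by (auto simp: elt_set_plus_def)
    then show "z \<in> x +o B"
      using chain.subspace_diff[OF assms _ xy] unfolding elt_set_plus_def by blast
  qed
qed

lemma coset_add:
  assumes "chain.subspace B"
  shows "(x +o B) + (y +o B) = (x + y) +o B"
proof (intro subset_antisym subsetI)
  fix z assume "z \<in> (x +o B) + (y +o B)"
  then obtain b c where "b \<in> B" "c \<in> B" "z = (x + y) + (b + c)"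
    by (auto simp: elt_set_plus_def set_plus_def algebra_simps)
  then show "z \<in> (x + y) +o B"
    using chain.subspace_add[OF assms] unfolding elt_set_plus_def by blast
next
  fix z assume "z \<in> (x + y) +o B"
  then obtain b where b: "b \<in> B" "z = (x + b) + (y + 0)"
    by (auto simp: elt_set_plus_def algebra_simps)
  show "z \<in> (x +o B) + (y +o B)"
    unfolding b(2) using b(1) chain.subspace_0[OF assms]
    by (intro set_plus_intro) (auto simp: elt_set_plus_def)
qed

text \<open>The summand \<open>B'\<close> absorbs the image of \<open>B\<close>, so the formula in
  \<open>subquotient_map\<close> really yields a coset.\<close>

lemma coset_map:
  assumes f: "module_hom chain_scale chain_scale f" and B: "chain.subspace B" and B': "chain.subspace B'"
    and fB: "f ` B \<subseteq> B'"
  shows "f ` (x +o B) + B' = f x +o B'"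
proof (intro subset_antisym subsetI)
  fix z assume "z \<in> f ` (x +o B) + B'"
  then obtain b c where bc: "b \<in> B" "c \<in> B'" "z = f x + (f b + c)"
    by (auto simp: elt_set_plus_def set_plus_def module_hom.add[OF f] algebra_simps)
  then have "f b + c \<in> B'"
    using fB by (intro chain.subspace_add[OF B']) auto
  then show "z \<in> f x +o B'"
    using bc by (auto simp: elt_set_plus_def)
next
  fix z assume "z \<in> f x +o B'"
  then obtain c where c: "c \<in> B'" "z = f x + c"
    by (auto simp: elt_set_plus_def)
  have "x \<in> x +o B"
    using chain.subspace_0[OF B] by (force simp: elt_set_plus_def)
  then show "z \<in> f ` (x +o B) + B'"
    unfolding c(2) using c(1) by (intro set_plus_intro imageI)
qed

lemma module_hom_chain_scale: "module_hom chain_scale chain_scale (chain_scale a)"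
  by unfold_locales (simp_all add: chain.scale_right_distrib chain.scale_left_commute)

lemma subquotient_simps:
  "carrier (subquotient Z B) = (\<lambda>z. z +o B) ` Z"
  "zero (subquotient Z B) = B"
  "add (subquotient Z B) S T = S + T"
  "smult (subquotient Z B) a S = chain_scale a ` S + B"
  by (simp_all add: subquotient_def)

lemma coset_scale:
  assumes "chain.subspace B"
  shows "chain_scale a ` (x +o B) + B = chain_scale a x +o B"
  using assms chain.subspace_scale[OF assms] by (intro coset_map module_hom_chain_scale) auto

lemma vect_subquotient:
  fixes Z B :: "('b \<Rightarrow>\<^sub>0 'a::field) set"
  assumes Z: "chain.subspace Z" and B: "chain.subspace B"
  shows "vect (subquotient Z B)"
  unfolding vect_def
proof (rule moduleI)
  interpret K: field "field_ring :: 'a ring"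
    by (rule field_field_ring)
  show "cring (field_ring :: 'a ring)"
    by (rule K.cring_axioms)
  have zero: "0 +o B = B"
    by (auto simp: elt_set_plus_def)
  show "abelian_group (subquotient Z B)"
  proof (rule abelian_groupI, unfold subquotient_simps)
    show "x + y \<in> (\<lambda>z. z +o B) ` Z" if "x \<in> (\<lambda>z. z +o B) ` Z" "y \<in> (\<lambda>z. z +o B) ` Z" for x y
      using that chain.subspace_add[OF Z] by (auto simp: coset_add[OF B])
    show "B \<in> (\<lambda>z. z +o B) ` Z"
      using chain.subspace_0[OF Z] zero by (metis imageI)
    show "x + y + z = x + (y + z)" for x y z :: "('b \<Rightarrow>\<^sub>0 'a) set"
      by (rule add.assoc)
    show "x + y = y + x" for x y :: "('b \<Rightarrow>\<^sub>0 'a) set"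
      by (rule add.commute)
    show "B + x = x" if "x \<in> (\<lambda>z. z +o B) ` Z" for x
      using that coset_add[OF B, of 0] by (auto simp: zero)
    show "\<exists>y\<in>(\<lambda>z. z +o B) ` Z. y + x = B" if x: "x \<in> (\<lambda>z. z +o B) ` Z" for x
    proof -
      obtain z where z: "z \<in> Z" "x = z +o B"
        using x by blast
      then show ?thesis
        using chain.subspace_neg[OF Z] by (intro bexI[of _ "(- z) +o B"]) (auto simp: coset_add[OF B] zero)
    qed
  qed
next
  fix a b :: 'a and x y assume "x \<in> carrier (subquotient Z B)" "y \<in> carrier (subquotient Z B)"
  then obtain u v where uv: "u \<in> Z" "x = u +o B" "v \<in> Z" "y = v +o B"
    by (auto simp: subquotient_simps)
  note scale = coset_scale[OF B]
  show "a \<odot>\<^bsub>subquotient Z B\<^esub> x \<in> carrier (subquotient Z B)"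
    unfolding subquotient_simps uv scale using chain.subspace_scale[OF Z uv(1)] by blast
  show "(a \<oplus>\<^bsub>field_ring\<^esub> b) \<odot>\<^bsub>subquotient Z B\<^esub> x =
      a \<odot>\<^bsub>subquotient Z B\<^esub> x \<oplus>\<^bsub>subquotient Z B\<^esub> b \<odot>\<^bsub>subquotient Z B\<^esub> x"
    unfolding subquotient_simps uv scale coset_add[OF B] by (simp add: field_ring_def chain.scale_left_distrib)
  show "a \<odot>\<^bsub>subquotient Z B\<^esub> (x \<oplus>\<^bsub>subquotient Z B\<^esub> y) =
      a \<odot>\<^bsub>subquotient Z B\<^esub> x \<oplus>\<^bsub>subquotient Z B\<^esub> a \<odot>\<^bsub>subquotient Z B\<^esub> y"
    unfolding subquotient_simps uv scale coset_add[OF B] by (simp add: chain.scale_right_distrib)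
  show "(a \<otimes>\<^bsub>field_ring\<^esub> b) \<odot>\<^bsub>subquotient Z B\<^esub> x =
      a \<odot>\<^bsub>subquotient Z B\<^esub> (b \<odot>\<^bsub>subquotient Z B\<^esub> x)"
    unfolding subquotient_simps uv scale by (simp add: field_ring_def)
  show "\<one>\<^bsub>field_ring\<^esub> \<odot>\<^bsub>subquotient Z B\<^esub> x = x"
    unfolding subquotient_simps uv scale by (simp add: field_ring_def)
qed

lemma subquotient_map_hom:
  assumes f: "module_hom chain_scale chain_scale f"
    and sub: "chain.subspace B" "chain.subspace B'"
    and fZ: "f ` Z \<subseteq> Z'" and fB: "f ` B \<subseteq> B'"
  shows "subquotient_map B' f \<in> vect_hom (subquotient Z B) (subquotient Z' B')"
  using fZ unfolding vect_hom_def subquotient_simps subquotient_map_def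
  by (auto simp: coset_map[OF f sub fB] coset_add sub coset_scale module_hom.add[OF f] module_hom.scale[OF f])

definition subquotient_persistence ::
  "('i \<Rightarrow> ('b \<Rightarrow>\<^sub>0 'k::field) set) \<Rightarrow> ('i \<Rightarrow> ('b \<Rightarrow>\<^sub>0 'k) set) \<Rightarrow>
    ('i \<Rightarrow> 'i \<Rightarrow> ('b \<Rightarrow>\<^sub>0 'k) \<Rightarrow> ('b \<Rightarrow>\<^sub>0 'k)) \<Rightarrow> ('i, 'k, ('b \<Rightarrow>\<^sub>0 'k) set) persistence" where
  "subquotient_persistence Z B g =
     \<lparr> dob = (\<lambda>i. subquotient (Z i) (B i)), dmor = (\<lambda>i j. subquotient_map (B j) (g i j)) \<rparr>"

text \<open>The functor laws are demanded on \<open>Z i\<close> only, because the underlying maps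
  are controlled only on the points or vertices of the object at \<open>i\<close>.\<close>

locale subquotient_diagram =
  fixes I :: "'i::linorder set" and Z B :: "'i \<Rightarrow> ('b \<Rightarrow>\<^sub>0 'k::field) set"
    and g :: "'i \<Rightarrow> 'i \<Rightarrow> ('b \<Rightarrow>\<^sub>0 'k) \<Rightarrow> ('b \<Rightarrow>\<^sub>0 'k)"
  assumes Z: "i \<in> I \<Longrightarrow> chain.subspace (Z i)"
    and B: "i \<in> I \<Longrightarrow> chain.subspace (B i)"
    and g: "i \<in> I \<Longrightarrow> j \<in> I \<Longrightarrow> i \<le> j \<Longrightarrow> module_hom chain_scale chain_scale (g i j)"
    and gZ: "i \<in> I \<Longrightarrow> j \<in> I \<Longrightarrow> i \<le> j \<Longrightarrow> g i j ` Z i \<subseteq> Z j"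
    and gB: "i \<in> I \<Longrightarrow> j \<in> I \<Longrightarrow> i \<le> j \<Longrightarrow> g i j ` B i \<subseteq> B j"
    and g_id: "i \<in> I \<Longrightarrow> z \<in> Z i \<Longrightarrow> g i i z = z"
    and g_comp: "i \<in> I \<Longrightarrow> j \<in> I \<Longrightarrow> k \<in> I \<Longrightarrow> i \<le> j \<Longrightarrow> j \<le> k \<Longrightarrow> z \<in> Z i \<Longrightarrow>
      g j k (g i j z) = g i k z"
begin

lemma dmor_coset:
  "i \<in> I \<Longrightarrow> j \<in> I \<Longrightarrow> i \<le> j \<Longrightarrow> subquotient_map (B j) (g i j) (z +o B i) = g i j z +o B j"
  by (simp add: subquotient_map_def coset_map[OF g B B gB])

lemma persistence_module: "persistence_module I (subquotient_persistence Z B g)"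
  unfolding persistence_module_def subquotient_persistence_def diagram.simps
proof (intro conjI ballI allI impI)
  show "vect (subquotient (Z i) (B i))" if "i \<in> I" for i
    by (intro vect_subquotient Z B that)
  show "subquotient_map (B j) (g i j) \<in> vect_hom (subquotient (Z i) (B i)) (subquotient (Z j) (B j))"
    if "i \<in> I" "j \<in> I" "i \<le> j" for i j
    by (intro subquotient_map_hom g B gZ gB that)
  show "subquotient_map (B i) (g i i) v = v" if "i \<in> I" "v \<in> carrier (subquotient (Z i) (B i))" for i v
    using that by (auto simp: subquotient_simps dmor_coset g_id)
  show "subquotient_map (B k) (g j k) (subquotient_map (B j) (g i j) v) = subquotient_map (B k) (g i k) v"
    if "i \<in> I" "j \<in> I" "k \<in> I" "i \<le> j" "j \<le> k" "v \<in> carrier (subquotient (Z i) (B i))" for i j k v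
    using that by (auto simp: subquotient_simps dmor_coset g_comp)
qed

end

text \<open>A criterion in terms of representatives: \<open>inj\<close> says that only boundaries
  become boundaries, \<open>surj\<close> that each target cycle is homologous to an image.
  Commutation of the squares is required on cycles, before passing to classes.\<close>

lemma naturally_isomorphic_subquotient:
  assumes D: "subquotient_diagram I Z B g" and D': "subquotient_diagram I Z' B' g'"
    and \<phi>: "\<And>i. i \<in> I \<Longrightarrow> module_hom chain_scale chain_scale (\<phi> i)"
    and \<phi>Z: "\<And>i z. i \<in> I \<Longrightarrow> z \<in> Z i \<Longrightarrow> \<phi> i z \<in> Z' i"
    and \<phi>B: "\<And>i z. i \<in> I \<Longrightarrow> z \<in> B i \<Longrightarrow> \<phi> i z \<in> B' i"
    and inj: "\<And>i z. i \<in> I \<Longrightarrow> z \<in> Z i \<Longrightarrow> \<phi> i z \<in> B' i \<Longrightarrow> z \<in> B i"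
    and surj: "\<And>i z'. i \<in> I \<Longrightarrow> z' \<in> Z' i \<Longrightarrow> \<exists>z\<in>Z i. z' - \<phi> i z \<in> B' i"
    and nat: "\<And>i j z. i \<in> I \<Longrightarrow> j \<in> I \<Longrightarrow> i \<le> j \<Longrightarrow> z \<in> Z i \<Longrightarrow> \<phi> j (g i j z) = g' i j (\<phi> i z)"
  shows "naturally_isomorphic I (subquotient_persistence Z B g) (subquotient_persistence Z' B' g')"
proof -
  interpret D: subquotient_diagram I Z B g
    by (rule D)
  interpret D': subquotient_diagram I Z' B' g'
    by (rule D')
  let ?\<eta> = "\<lambda>i. subquotient_map (B' i) (\<phi> i)"
  have \<eta>: "?\<eta> i (z +o B i) = \<phi> i z +o B' i" if "i \<in> I" for i z
    unfolding subquotient_map_def using that \<phi>B by (intro coset_map \<phi> D.B D'.B) auto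
  have "?\<eta> i \<in> vect_iso (subquotient (Z i) (B i)) (subquotient (Z' i) (B' i))" if i: "i \<in> I" for i
  proof -
    have "?\<eta> i \<in> vect_hom (subquotient (Z i) (B i)) (subquotient (Z' i) (B' i))"
      using i \<phi>Z \<phi>B by (intro subquotient_map_hom \<phi> D.B D'.B) auto
    moreover have "inj_on (?\<eta> i) ((\<lambda>z. z +o B i) ` Z i)"
    proof (rule inj_onI)
      fix S T assume "S \<in> (\<lambda>z. z +o B i) ` Z i" "T \<in> (\<lambda>z. z +o B i) ` Z i" and eq: "?\<eta> i S = ?\<eta> i T"
      then obtain x y where xy: "x \<in> Z i" "S = x +o B i" "y \<in> Z i" "T = y +o B i"
        by blast
      have "\<phi> i (x - y) \<in> B' i"
        using eq by (simp add: xy \<eta>[OF i] coset_eq_iff[OF D'.B[OF i]] module_hom.diff[OF \<phi>[OF i]])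
      then have "x - y \<in> B i"
        using xy by (intro inj[OF i] chain.subspace_diff[OF D.Z[OF i]])
      then show "S = T"
        by (simp add: xy coset_eq_iff[OF D.B[OF i]])
    qed
    moreover have "?\<eta> i ` (\<lambda>z. z +o B i) ` Z i = (\<lambda>z. z +o B' i) ` Z' i"
    proof (intro subset_antisym subsetI)
      show "S \<in> (\<lambda>z. z +o B' i) ` Z' i" if "S \<in> ?\<eta> i ` (\<lambda>z. z +o B i) ` Z i" for S
        using that \<phi>Z[OF i] by (auto simp: \<eta>[OF i])
      fix S assume "S \<in> (\<lambda>z. z +o B' i) ` Z' i"
      then obtain z' where z': "z' \<in> Z' i" "S = z' +o B' i"
        by blast
      obtain z where z: "z \<in> Z i" "z' - \<phi> i z \<in> B' i"
        using surj[OF i z'(1)] by blast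
      have "S = ?\<eta> i (z +o B i)"
        using z(2) by (simp add: z'(2) \<eta>[OF i] coset_eq_iff[OF D'.B[OF i]])
      then show "S \<in> ?\<eta> i ` (\<lambda>z. z +o B i) ` Z i"
        using z(1) by blast
    qed
    ultimately show ?thesis
      by (simp add: vect_iso_def bij_betw_def subquotient_simps)
  qed
  moreover have "?\<eta> j (subquotient_map (B j) (g i j) v) = subquotient_map (B' j) (g' i j) (?\<eta> i v)"
    if "i \<in> I" "j \<in> I" "i \<le> j" "v \<in> carrier (subquotient (Z i) (B i))" for i j v
    using that nat by (auto simp: subquotient_simps \<eta> D.dmor_coset D'.dmor_coset)
  ultimately show ?thesis
    unfolding naturally_isomorphic_def using D.persistence_module D'.persistence_module
    by (intro conjI exI[of _ ?\<eta>]) (auto simp: subquotient_persistence_def)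
qed

section \<open>The persistence modules of the theorem\<close>

lemma module_hom_sboundary: "module_hom chain_scale chain_scale (sboundary n)"
  unfolding sboundary_eq by (rule module_hom_chain_extend)

lemma module_hom_simpboundary: "module_hom chain_scale chain_scale (simpboundary n)"
  unfolding simpboundary_eq by (rule module_hom_chain_extend)

lemma module_hom_schain_map: "module_hom chain_scale chain_scale (schain_map n f)"
  unfolding schain_map_def by (rule module_hom_chain_extend)

lemma module_hom_tuple_map: "module_hom chain_scale chain_scale (tuple_map f)"
  unfolding tuple_map_def by (rule module_hom_chain_extend)

lemma subspace_scycles: "chain.subspace (scycles n X)"
  unfolding scycles_def Collect_conj_eq Collect_mem_eq
  by (intro chain.subspace_inter subspace_schains module_hom.subspace_kernel[OF module_hom_sboundary])

lemma subspace_sboundaries: "chain.subspace (sboundaries n X)"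
  unfolding sboundaries_def
  by (rule module_hom.subspace_image[OF module_hom_sboundary subspace_schains])

section \<open>Functoriality of singular cycles and boundaries\<close>

lemma schain_map_scycles:
  assumes f: "continuous_map X Y f" and c: "c \<in> scycles n X"
  shows "schain_map n f c \<in> scycles n Y"
proof -
  have "sboundary n (schain_map n f c) = 0"
    using c schain_map_sboundary[of "n - 1" f c]
    by (cases n) (auto simp: scycles_def schain_map_def sboundary_def)
  then show ?thesis
    using c schain_map_in_schains[OF _ f] by (auto simp: scycles_def)
qed

lemma schain_map_sboundaries:
  assumes f: "continuous_map X Y f" and c: "c \<in> sboundaries n X"
  shows "schain_map n f c \<in> sboundaries n Y"
  using c schain_map_in_schains[OF _ f] by (auto simp: sboundaries_def schain_map_sboundary intro!: imageI)

lemma schain_map_ident: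
  assumes "c \<in> schains n X" "\<And>x. x \<in> topspace X \<Longrightarrow> f x = x"
  shows "schain_map n f c = c"
proof -
  have "schain_map n f c = chain_extend (\<lambda>\<sigma>. Poly_Mapping.single \<sigma> 1) c"
    unfolding schain_map_def
    by (rule chain_extend_cong) (use assms simplex_map_id_gen in \<open>fastforce simp: schains_def\<close>)
  then show ?thesis
    by simp
qed

lemma schain_map_compose:
  assumes "c \<in> schains n X" "\<And>x. x \<in> topspace X \<Longrightarrow> f' (f x) = h x"
  shows "schain_map n f' (schain_map n f c) = schain_map n h c"
  unfolding schain_map_def chain_extend_compose
proof (rule chain_extend_cong)
  fix \<sigma> assume "\<sigma> \<in> Poly_Mapping.keys c"
  then have "singular_simplex n X \<sigma>"
    using assms(1) by (auto simp: schains_def)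
  then have "simplex_map n (f' \<circ> f) \<sigma> = simplex_map n h \<sigma>"
    by (rule simplex_map_eq) (simp add: assms(2))
  then show "chain_extend (\<lambda>\<sigma>. Poly_Mapping.single (simplex_map n f' \<sigma>) 1)
      (Poly_Mapping.single (simplex_map n f \<sigma>) 1) = Poly_Mapping.single (simplex_map n h \<sigma>) 1"
    by (simp add: simplex_map_compose)
qed

lemma singular_persistence_eq:
  "singular_persistence n F = subquotient_persistence (\<lambda>i. scycles n (dob F i)) (\<lambda>i. sboundaries n (dob F i))
     (\<lambda>i j. schain_map n (dmor F i j))"
  by (simp add: singular_persistence_def subquotient_persistence_def singular_homology_def
      singular_homology_map_def[abs_def] schain_map_def[abs_def])

lemma subquotient_diagram_singular:
  fixes F :: "('i::linorder, 'a topology, 'a \<Rightarrow> 'a) diagram"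
  assumes cont: "\<And>i j. i \<in> I \<Longrightarrow> j \<in> I \<Longrightarrow> i \<le> j \<Longrightarrow> continuous_map (dob F i) (dob F j) (dmor F i j)"
    and ident: "\<And>i x. i \<in> I \<Longrightarrow> x \<in> topspace (dob F i) \<Longrightarrow> dmor F i i x = x"
    and comp: "\<And>i j k x. i \<in> I \<Longrightarrow> j \<in> I \<Longrightarrow> k \<in> I \<Longrightarrow> i \<le> j \<Longrightarrow> j \<le> k \<Longrightarrow> x \<in> topspace (dob F i) \<Longrightarrow>
      dmor F j k (dmor F i j x) = dmor F i k x"
  shows "subquotient_diagram I (\<lambda>i. scycles n (dob F i)) (\<lambda>i. sboundaries n (dob F i))
    (\<lambda>i j. schain_map n (dmor F i j) :: ('a, 'k::field) schain \<Rightarrow> _)"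
proof (rule subquotient_diagram.intro)
  fix i j k and z :: "('a, 'k) schain"
  show "module_hom chain_scale chain_scale (schain_map n (dmor F i j) :: ('a, 'k) schain \<Rightarrow> _)"
    by (rule module_hom_schain_map)
  show "schain_map n (dmor F i j) ` scycles n (dob F i) \<subseteq> (scycles n (dob F j) :: ('a, 'k) schain set)"
    "schain_map n (dmor F i j) ` sboundaries n (dob F i) \<subseteq> (sboundaries n (dob F j) :: ('a, 'k) schain set)"
    if "i \<in> I" "j \<in> I" "i \<le> j"
    using schain_map_scycles[OF cont[OF that]] schain_map_sboundaries[OF cont[OF that]] by blast+
  show "schain_map n (dmor F i i) z = z" if "i \<in> I" "z \<in> scycles n (dob F i)"
    using that ident by (intro schain_map_ident) (auto simp: scycles_def)
  show "schain_map n (dmor F j k) (schain_map n (dmor F i j) z) = schain_map n (dmor F i k) z"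
    if "i \<in> I" "j \<in> I" "k \<in> I" "i \<le> j" "j \<le> k" "z \<in> scycles n (dob F i)"
    using that comp by (intro schain_map_compose) (auto simp: scycles_def)
qed (rule subspace_scycles subspace_sboundaries)+

lemma subspace_simpcycles: "chain.subspace (simpcycles n K)"
  unfolding simpcycles_def Collect_conj_eq Collect_mem_eq
  by (intro chain.subspace_inter subspace_simpchains
      module_hom.subspace_vimage[OF module_hom_simpboundary subspace_simprels, unfolded vimage_def])

lemma subspace_simpboundary_image: "chain.subspace (simpboundary (Suc n) ` simpchains (Suc n) K)"
  by (rule module_hom.subspace_image[OF module_hom_simpboundary subspace_simpchains])

lemma subspace_set_plus:
  assumes "chain.subspace A" "chain.subspace B"
  shows "chain.subspace (A + B)"
proof -
  have "A + B = {x + y | x y. x \<in> A \<and> y \<in> B}"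
    by (auto simp: set_plus_def)
  then show ?thesis
    using chain.subspace_sums[OF assms] by simp
qed

lemma subspace_simpboundaries: "chain.subspace (simpboundaries n K)"
  unfolding simpboundaries_def by (rule subspace_set_plus[OF subspace_simpboundary_image subspace_simprels])

text \<open>Genuine cycles of tuples, as opposed to \<open>simpcycles\<close>, where the boundary
  may be any relation. They give the term of the zigzag between singular chains of the poset and
  oriented chains.\<close>

definition tuple_cycles :: "nat \<Rightarrow> 'v set set \<Rightarrow> ('v, 'k::field) simpchain set" where
  "tuple_cycles n K = {c \<in> simpchains n K. simpboundary n c = 0}"

definition tuple_boundaries :: "nat \<Rightarrow> 'v set set \<Rightarrow> ('v, 'k::field) simpchain set" where
  "tuple_boundaries n K = simpboundary (Suc n) ` simpchains (Suc n) K"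

lemma subspace_tuple_cycles: "chain.subspace (tuple_cycles n K)"
  unfolding tuple_cycles_def Collect_conj_eq Collect_mem_eq
  by (intro chain.subspace_inter subspace_simpchains module_hom.subspace_kernel[OF module_hom_simpboundary])

lemma subspace_tuple_boundaries: "chain.subspace (tuple_boundaries n K)"
  unfolding tuple_boundaries_def by (rule subspace_simpboundary_image)

lemma tuple_map_0 [simp]: "tuple_map f 0 = 0"
  by (simp add: tuple_map_def)

lemma tuple_map_tuple_cycles:
  "simplicial_map K L f \<Longrightarrow> c \<in> tuple_cycles n K \<Longrightarrow> tuple_map f c \<in> tuple_cycles n L"
  unfolding tuple_cycles_def using tuple_map_in_simpchains[of K L f c n] by (auto simp flip: tuple_map_simpboundary)

lemma tuple_map_tuple_boundaries:
  "simplicial_map K L f \<Longrightarrow> c \<in> tuple_boundaries n K \<Longrightarrow> tuple_map f c \<in> tuple_boundaries n L"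
  unfolding tuple_boundaries_def by (auto simp: tuple_map_simpboundary intro: tuple_map_in_simpchains)

lemma tuple_map_simpcycles:
  "simplicial_map K L f \<Longrightarrow> c \<in> simpcycles n K \<Longrightarrow> tuple_map f c \<in> simpcycles n L"
  unfolding simpcycles_def
  by (auto simp: tuple_map_in_simpchains tuple_map_in_simprels simp flip: tuple_map_simpboundary)

lemma tuple_map_simpboundaries:
  assumes f: "simplicial_map K L f" and c: "c \<in> simpboundaries n K"
  shows "tuple_map f c \<in> simpboundaries n L"
proof -
  obtain b \<rho> where "b \<in> simpchains (Suc n) K" "\<rho> \<in> simprels n K" "c = simpboundary (Suc n) b + \<rho>"
    using c by (auto simp: simpboundaries_def set_plus_def)
  then have "tuple_map f c = simpboundary (Suc n) (tuple_map f b) + tuple_map f \<rho>"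
    "tuple_map f b \<in> simpchains (Suc n) L" "tuple_map f \<rho> \<in> simprels n L"
    using tuple_map_in_simpchains[OF f] tuple_map_in_simprels[OF f]
    by (auto simp: tuple_map_def chain_extend_add simp flip: tuple_map_simpboundary[unfolded tuple_map_def])
  then show ?thesis
    unfolding simpboundaries_def by (auto intro!: set_plus_intro)
qed

lemma tuple_map_ident:
  assumes "c \<in> simpchains n K" "\<And>x. x \<in> \<Union>K \<Longrightarrow> f x = x"
  shows "tuple_map f c = c"
proof -
  have "tuple_map f c = chain_extend (\<lambda>l. Poly_Mapping.single l 1) c"
    unfolding tuple_map_def
  proof (rule chain_extend_cong)
    fix l assume "l \<in> Poly_Mapping.keys c"
    then have "set l \<in> K"
      using assms(1) by (auto simp: simpchains_def simplex_tuples_def)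
    then have "map f l = l"
      using assms(2) by (intro map_idI) auto
    then show "Poly_Mapping.single (map f l) (1 :: 'b) = Poly_Mapping.single l 1"
      by simp
  qed
  then show ?thesis
    by simp
qed

lemma tuple_map_compose:
  assumes "c \<in> simpchains n K" "\<And>x. x \<in> \<Union>K \<Longrightarrow> f' (f x) = h x"
  shows "tuple_map f' (tuple_map f c) = tuple_map h c"
  unfolding tuple_map_def chain_extend_compose
proof (rule chain_extend_cong)
  fix l assume "l \<in> Poly_Mapping.keys c"
  then have "set l \<in> K"
    using assms(1) by (auto simp: simpchains_def simplex_tuples_def)
  then have eq: "map f' (map f l) = map h l"
    using assms(2) by auto
  show "chain_extend (\<lambda>l. Poly_Mapping.single (map f' l) 1) (Poly_Mapping.single (map f l) 1) =
      Poly_Mapping.single (map h l) 1"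
    by (simp only: chain_extend_single chain_scale_single mult_1 eq)
qed

lemma simplicial_persistence_eq:
  "simplicial_persistence n F = subquotient_persistence (\<lambda>i. simpcycles n (dob F i)) (\<lambda>i. simpboundaries n (dob F i))
     (\<lambda>i j. tuple_map (dmor F i j))"
  by (simp add: simplicial_persistence_def subquotient_persistence_def simplicial_homology_def
      simplicial_homology_map_def[abs_def] tuple_map_def[abs_def])

lemma
  fixes K :: "'i::linorder \<Rightarrow> 'v set set"
  assumes simp: "\<And>i j. i \<in> I \<Longrightarrow> j \<in> I \<Longrightarrow> i \<le> j \<Longrightarrow> simplicial_map (K i) (K j) (f i j)"
    and ident: "\<And>i x. i \<in> I \<Longrightarrow> x \<in> \<Union>(K i) \<Longrightarrow> f i i x = x"
    and comp: "\<And>i j k x. i \<in> I \<Longrightarrow> j \<in> I \<Longrightarrow> k \<in> I \<Longrightarrow> i \<le> j \<Longrightarrow> j \<le> k \<Longrightarrow> x \<in> \<Union>(K i) \<Longrightarrow>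
      f j k (f i j x) = f i k x"
  shows subquotient_diagram_simplicial:
      "subquotient_diagram I (\<lambda>i. simpcycles n (K i)) (\<lambda>i. simpboundaries n (K i))
        (\<lambda>i j. tuple_map (f i j) :: ('v, 'k::field) simpchain \<Rightarrow> _)" (is ?simplicial)
    and subquotient_diagram_tuples:
      "subquotient_diagram I (\<lambda>i. tuple_cycles n (K i)) (\<lambda>i. tuple_boundaries n (K i))
        (\<lambda>i j. tuple_map (f i j) :: ('v, 'k::field) simpchain \<Rightarrow> _)" (is ?tuples)
proof -
  have id: "tuple_map (f i i) z = z"
    if "i \<in> I" "z \<in> simpchains n (K i)" for i and z :: "('v, 'k) simpchain"
    using that ident by (intro tuple_map_ident)
  have co: "tuple_map (f j k) (tuple_map (f i j) z) = tuple_map (f i k) z"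
    if "i \<in> I" "j \<in> I" "k \<in> I" "i \<le> j" "j \<le> k" "z \<in> simpchains n (K i)"
    for i j k and z :: "('v, 'k) simpchain"
    using that comp by (intro tuple_map_compose)
  show ?simplicial
  proof (rule subquotient_diagram.intro)
    fix i j k and z :: "('v, 'k) simpchain"
    show "tuple_map (f i j) ` simpcycles n (K i) \<subseteq> (simpcycles n (K j) :: ('v, 'k) simpchain set)"
      "tuple_map (f i j) ` simpboundaries n (K i) \<subseteq> (simpboundaries n (K j) :: ('v, 'k) simpchain set)"
      if "i \<in> I" "j \<in> I" "i \<le> j"
      using tuple_map_simpcycles[OF simp[OF that]] tuple_map_simpboundaries[OF simp[OF that]] by blast+
    show "tuple_map (f i i) z = z" if "i \<in> I" "z \<in> simpcycles n (K i)"
      using that id by (simp add: simpcycles_def)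
    show "tuple_map (f j k) (tuple_map (f i j) z) = tuple_map (f i k) z"
      if "i \<in> I" "j \<in> I" "k \<in> I" "i \<le> j" "j \<le> k" "z \<in> simpcycles n (K i)"
      using that co by (simp add: simpcycles_def)
  qed (rule subspace_simpcycles subspace_simpboundaries module_hom_tuple_map)+
  show ?tuples
  proof (rule subquotient_diagram.intro)
    fix i j k and z :: "('v, 'k) simpchain"
    show "tuple_map (f i j) ` tuple_cycles n (K i) \<subseteq> (tuple_cycles n (K j) :: ('v, 'k) simpchain set)"
      "tuple_map (f i j) ` tuple_boundaries n (K i) \<subseteq> (tuple_boundaries n (K j) :: ('v, 'k) simpchain set)"
      if "i \<in> I" "j \<in> I" "i \<le> j"
      using tuple_map_tuple_cycles[OF simp[OF that]] tuple_map_tuple_boundaries[OF simp[OF that]] by blast+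
    show "tuple_map (f i i) z = z" if "i \<in> I" "z \<in> tuple_cycles n (K i)"
      using that id by (simp add: tuple_cycles_def)
    show "tuple_map (f j k) (tuple_map (f i j) z) = tuple_map (f i k) z"
      if "i \<in> I" "j \<in> I" "k \<in> I" "i \<le> j" "j \<le> k" "z \<in> tuple_cycles n (K i)"
      using that co by (simp add: tuple_cycles_def)
  qed (rule subspace_tuple_cycles subspace_tuple_boundaries module_hom_tuple_map)+
qed

lemma tuple_boundaries_subset: "tuple_boundaries n K \<subseteq> simpboundaries n K"
proof
  fix c assume "c \<in> tuple_boundaries n K"
  then have "c + 0 \<in> simpboundaries n K"
    unfolding simpboundaries_def tuple_boundaries_def
    by (intro set_plus_intro chain.subspace_0[OF subspace_simprels])
  then show "c \<in> simpboundaries n K"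
    by simp
qed

lemma simprels_subset_simpboundaries: "simprels n K \<subseteq> simpboundaries n K"
proof
  fix c assume "c \<in> simprels n K"
  then have "0 + c \<in> simpboundaries n K"
    unfolding simpboundaries_def
    by (intro set_plus_intro chain.subspace_0[OF subspace_simpboundary_image])
  then show "c \<in> simpboundaries n K"
    by simp
qed

section \<open>Dividing out the acyclic relations preserves homology\<close>

context finite_poset
begin

text \<open>The boundary of \<open>c\<close> is a cycle among the relations, hence also the boundary
  of a relation \<open>w\<close>; subtracting \<open>w\<close> gives a genuine cycle in the same
  class.\<close>

lemma tuple_cycles_homology_surj:
  assumes c: "c \<in> simpcycles n (order_complex r)"
  shows "\<exists>a\<in>tuple_cycles n (order_complex r). c - a \<in> simpboundaries n (order_complex r)"
proof (cases n)
  case 0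
  then show ?thesis
    using c chain.subspace_0[OF subspace_simpboundaries]
    by (intro bexI[of _ c]) (auto simp: simpcycles_def tuple_cycles_def simpboundary_eq_0)
next
  case (Suc m)
  let ?K = "order_complex r"
  have c': "c \<in> simpchains (Suc m) ?K" "simpboundary (Suc m) c \<in> simprels m ?K"
    using c Suc by (auto simp: simpcycles_def)
  have "simpboundary m (simpboundary (Suc m) c) = 0"
    by (rule simpboundary_simpboundary[OF simplicial_complex_order_complex c'(1)])
  then obtain w where w: "w \<in> simprels (Suc m) ?K" "simpboundary (Suc m) w = simpboundary (Suc m) c"
    using acyclic_simprels[OF c'(2)] by blast
  have "c - w \<in> tuple_cycles n ?K"
    using c'(1) w simprels_subset_simpchains[of "Suc m" ?K] Suc
    by (auto simp: tuple_cycles_def simpboundary_diff intro!: chain.subspace_diff[OF subspace_simpchains])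
  moreover have "c - (c - w) \<in> simpboundaries n ?K"
    using w(1) simprels_subset_simpboundaries[of n ?K] Suc by auto
  ultimately show ?thesis
    by blast
qed

text \<open>The leftover relation \<open>\<rho>\<close> is a cycle, because \<open>c\<close> and the
  boundary of \<open>b\<close> are, so it is the boundary of a relation that can be absorbed into
  \<open>b\<close>.\<close>

lemma tuple_cycles_homology_inj:
  assumes c: "c \<in> tuple_cycles n (order_complex r)" "c \<in> simpboundaries n (order_complex r)"
  shows "c \<in> tuple_boundaries n (order_complex r)"
proof -
  let ?K = "order_complex r"
  obtain b \<rho> where b: "b \<in> simpchains (Suc n) ?K" and \<rho>: "\<rho> \<in> simprels n ?K"
    and eq: "c = simpboundary (Suc n) b + \<rho>"
    using c(2) by (auto simp: simpboundaries_def set_plus_def)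
  have "simpboundary n \<rho> = simpboundary n c - simpboundary n (simpboundary (Suc n) b)"
    by (simp add: eq flip: simpboundary_diff)
  also have "\<dots> = 0"
    using c(1) simpboundary_simpboundary[OF simplicial_complex_order_complex b] by (simp add: tuple_cycles_def)
  finally obtain w where w: "w \<in> simprels (Suc n) ?K" "simpboundary (Suc n) w = \<rho>"
    using acyclic_simprels[OF \<rho>] by blast
  have "b + w \<in> simpchains (Suc n) ?K"
    using b w(1) simprels_subset_simpchains[of "Suc n" ?K] by (auto intro!: chain.subspace_add[OF subspace_simpchains])
  moreover have "simpboundary (Suc n) (b + w) = c"
    using w(2) by (simp add: simpboundary_eq chain_extend_add eq)
  ultimately show ?thesis
    unfolding tuple_boundaries_def by blast
qed

lemma tuple_cycles_subset: "tuple_cycles n K \<subseteq> simpcycles n K"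
  using chain.subspace_0[OF subspace_simprels] by (auto simp: tuple_cycles_def simpcycles_def)

end

subsection \<open>The poset of a finite space\<close>

text \<open>Finiteness of the space makes this an intersection of finitely many open sets.\<close>

lemma openin_minimal_open:
  assumes "finite (topspace T)" "y \<in> topspace T"
  shows "openin T (minimal_open T y)"
  unfolding minimal_open_def
proof (rule openin_Inter)
  have "{U. openin T U \<and> y \<in> U} \<subseteq> Pow (topspace T)"
    using openin_subset by blast
  then show "finite {U. openin T U \<and> y \<in> U}"
    using assms(1) by (meson finite_Pow_iff finite_subset)
  show "{U. openin T U \<and> y \<in> U} \<noteq> {}"
    using assms(2) by blast
qed auto

lemma associated_poset_cases:
  assumes "A \<in> Field (associated_poset T)"
  obtains x where "x \<in> topspace T" "A = point_class T x"
  using assms by (auto simp: Field_associated_poset quotient_def point_class_def)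

lemma point_class_in_Field: "x \<in> topspace T \<Longrightarrow> point_class T x \<in> Field (associated_poset T)"
  by (auto simp: Field_associated_poset point_class_def intro: quotientI)

lemma finite_poset_associated_poset:
  assumes "finite (topspace T)"
  shows "finite_poset (associated_poset T)"
proof
  show "finite (Field (associated_poset T))"
    unfolding Field_associated_poset
    by (rule finite_quotient[OF assms]) (auto simp: point_equiv_def point_preorder_def)
  show "partial_order_on (Field (associated_poset T)) (associated_poset T)"
    by (rule partial_order_associated_poset)
qed

text \<open>Any \<open>x\<close> in a class serves as the required point: each open set around it
  contains its minimal open set, which is the preimage of the principal down-set of its class.
  Preimages of down-sets are open because they contain the minimal open set of each of their
  points.\<close>

lemma poset_model_point_class:
  assumes fin: "finite (topspace T)"
  shows "poset_model (associated_poset T) T (point_class T)"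
  unfolding poset_model_def
proof (intro conjI ballI)
  show "continuous_map T (down_topology (associated_poset T)) (point_class T)"
    unfolding continuous_map_def
  proof (intro conjI allI impI)
    show "point_class T \<in> topspace T \<rightarrow> topspace (down_topology (associated_poset T))"
      using point_class_in_Field by auto
    fix V assume "openin (down_topology (associated_poset T)) V"
    then have V: "V \<in> down_sets (associated_poset T)"
      by simp
    show "openin T {x \<in> topspace T. point_class T x \<in> V}"
    proof (subst openin_subopen, intro ballI)
      fix y assume y: "y \<in> {x \<in> topspace T. point_class T x \<in> V}"
      have "minimal_open T y \<subseteq> {x \<in> topspace T. point_class T x \<in> V}"
      proof
        fix x assume x: "x \<in> minimal_open T y"
        then have "x \<in> topspace T"
          using y by (auto simp: minimal_open_def)
        moreover from this have "(point_class T x, point_class T y) \<in> associated_poset T"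
          using x y by (simp add: associated_poset_class_iff point_preorder_def)
        ultimately show "x \<in> {x \<in> topspace T. point_class T x \<in> V}"
          using V y by (auto simp: down_sets_def)
      qed
      moreover have "y \<in> minimal_open T y"
        by (simp add: minimal_open_def)
      ultimately show "\<exists>U. openin T U \<and> y \<in> U \<and> U \<subseteq> {x \<in> topspace T. point_class T x \<in> V}"
        using openin_minimal_open[OF fin] y by blast
    qed
  qed
  fix A assume "A \<in> Field (associated_poset T)"
  then obtain x where x: "x \<in> topspace T" "A = point_class T x"
    by (rule associated_poset_cases)
  have "{y \<in> topspace T. (point_class T y, A) \<in> associated_poset T} \<subseteq> U" if "openin T U" "x \<in> U" for U
    using that x by (auto simp: associated_poset_class_iff point_preorder_def minimal_open_def)
  then show "\<exists>v\<in>topspace T. point_class T v = A \<and> (\<forall>U. openin T U \<longrightarrow> v \<in> U \<longrightarrow>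
      {y \<in> topspace T. (point_class T y, A) \<in> associated_poset T} \<subseteq> U)"
    using x by blast
qed

lemma associated_map_mono:
  assumes f: "continuous_map T T' f" and AB: "(A, B) \<in> associated_poset T"
  shows "(associated_map T' f A, associated_map T' f B) \<in> associated_poset T'"
proof -
  obtain x y where xy: "x \<in> topspace T" "A = point_class T x" "y \<in> topspace T" "B = point_class T y"
    using associated_poset_cases[OF FieldI1[OF AB]] associated_poset_cases[OF FieldI2[OF AB]] by metis
  have "f x \<in> topspace T'" "f y \<in> topspace T'"
    using f xy by (auto simp: continuous_map_def)
  then show ?thesis
    using AB point_preorder_continuous[OF f] xy by (simp add: associated_map_class[OF f] associated_poset_class_iff)
qed

lemma continuous_map_associated_map:
  assumes f: "continuous_map T T' f"
  shows "continuous_map (down_topology (associated_poset T)) (down_topology (associated_poset T')) (associated_map T' f)"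
  unfolding continuous_map_def
proof (intro conjI allI impI)
  have F: "associated_map T' f A \<in> Field (associated_poset T')" if "A \<in> Field (associated_poset T)" for A
    using that associated_map_mono[OF f] by (auto simp: Field_def)
  then show "associated_map T' f \<in> topspace (down_topology (associated_poset T)) \<rightarrow>
      topspace (down_topology (associated_poset T'))"
    by simp
  fix U assume "openin (down_topology (associated_poset T')) U"
  then show "openin (down_topology (associated_poset T))
      {A \<in> topspace (down_topology (associated_poset T)). associated_map T' f A \<in> U}"
    using associated_map_mono[OF f] by (auto simp: down_sets_def intro: FieldI1)
qed

lemma Union_order_complex: "\<Union>(order_complex r) \<subseteq> Field r"
  by (auto simp: order_complex_def Chains_def intro: FieldI1)

theorem proposition5:
  fixes X :: "'a set" and d :: "'a \<Rightarrow> 'a \<Rightarrow> real"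
    and m n :: nat and T :: "nat \<Rightarrow> 'a topology"
  assumes "Metric_space X d" and "finite X"
    and "\<And>i. i \<in> {1..m} \<Longrightarrow> topspace (T i) = X"
    and "\<And>i j. i \<in> {1..m} \<Longrightarrow> j \<in> {1..m} \<Longrightarrow> i \<le> j \<Longrightarrow>
           {U. openin (T j) U} \<subseteq> {U. openin (T i) U}"
  shows "naturally_isomorphic {1..m}
           (singular_persistence n (identity_diagram T)
              :: (nat, 'k::field, ('a, 'k) schain set) persistence)
           (simplicial_persistence n (order_complex_diagram (identity_diagram T))
              :: (nat, 'k, ('a set, 'k) simpchain set) persistence)"
proof -
  define I where "I = {1..m}"
  define r where "r i = associated_poset (T i)" for i
  define \<phi> where "\<phi> i j = associated_map (T j) id" for i j :: nat
  define K where "K i = order_complex (r i)" for i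
  have top: "topspace (T i) = X" if "i \<in> I" for i
    using that assms(3) by (simp add: I_def)
  have cont: "continuous_map (T i) (T j) id" if "i \<in> I" "j \<in> I" "i \<le> j" for i j
  proof -
    have "openin (T i) (X \<inter> U)" if "openin (T j) U" for U
      using assms(4)[of i j] openin_subset[OF that] that \<open>i \<in> I\<close> \<open>j \<in> I\<close> \<open>i \<le> j\<close> top[of j]
      by (auto simp: I_def Int_absorb1)
    moreover have "{x \<in> X. x \<in> U} = X \<inter> U" for U
      by auto
    ultimately show ?thesis
      using that by (simp add: continuous_map_def top)
  qed
  have fp: "finite_poset (r i)" if "i \<in> I" for i
    using assms(2) that by (simp add: r_def finite_poset_associated_poset top)
  have model: "poset_model (r i) (T i) (point_class (T i))" if "i \<in> I" for i
    using assms(2) that by (simp add: r_def poset_model_point_class top)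
  have \<phi>_class: "\<phi> i j (point_class (T i) x) = point_class (T j) x" if "i \<in> I" "j \<in> I" "i \<le> j" "x \<in> X" for i j x
    using that associated_map_class[OF cont, of i j x] by (simp add: \<phi>_def top)
  have \<phi>_mono: "(\<phi> i j A, \<phi> i j B) \<in> r j" if "i \<in> I" "j \<in> I" "i \<le> j" "(A, B) \<in> r i" for i j A B
    using that associated_map_mono[OF cont] by (simp add: \<phi>_def r_def)
  have Field_r: "\<exists>x\<in>X. A = point_class (T i) x" if "i \<in> I" "A \<in> Field (r i)" for i A
    using that associated_poset_cases[of A "T i"] top by (metis r_def)
  have \<phi>_id: "\<phi> i i A = A" if "i \<in> I" "A \<in> Field (r i)" for i A
    using that Field_r \<phi>_class by fastforce
  have \<phi>_comp: "\<phi> j k (\<phi> i j A) = \<phi> i k A"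
    if "i \<in> I" "j \<in> I" "k \<in> I" "i \<le> j" "j \<le> k" "A \<in> Field (r i)" for i j k A
    using that Field_r[of i A] \<phi>_class by fastforce
  have \<phi>_simp: "simplicial_map (K i) (K j) (\<phi> i j)" if "i \<in> I" "j \<in> I" "i \<le> j" for i j
    using simplicial_map_associated_map[OF cont[OF that]] by (simp add: K_def r_def \<phi>_def)
  \<comment> \<open>The identity and composition laws for \<open>\<phi>\<close> hold on classes;
    this says that all vertices of the order complex are such classes.\<close>
  have UK: "x \<in> Field (r i)" if "x \<in> \<Union>(K i)" for x i
    using that unfolding K_def by (rule subsetD[OF Union_order_complex])

  \<comment> \<open>The middle diagram of topological spaces, to which
    \<open>subquotient_diagram_singular\<close> is applied.\<close>
  define P where "P = \<lparr> dob = (\<lambda>i. down_topology (r i)), dmor = \<phi> \<rparr>"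
  have dX: "subquotient_diagram I (\<lambda>i. scycles n (T i)) (\<lambda>i. sboundaries n (T i))
      (\<lambda>i j. schain_map n id :: ('a, 'k) schain \<Rightarrow> _)"
    using subquotient_diagram_singular[of I "identity_diagram T"] cont by (simp add: identity_diagram_def)
  have dP: "subquotient_diagram I (\<lambda>i. scycles n (down_topology (r i))) (\<lambda>i. sboundaries n (down_topology (r i)))
      (\<lambda>i j. schain_map n (\<phi> i j) :: ('a set, 'k) schain \<Rightarrow> _)"
    using subquotient_diagram_singular[of I P] continuous_map_associated_map[OF cont] \<phi>_id \<phi>_comp
    by (simp add: P_def r_def \<phi>_def)
  have dK: "subquotient_diagram I (\<lambda>i. tuple_cycles n (K i)) (\<lambda>i. tuple_boundaries n (K i))
      (\<lambda>i j. tuple_map (\<phi> i j) :: ('a set, 'k) simpchain \<Rightarrow> _)"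
    by (rule subquotient_diagram_tuples[OF \<phi>_simp \<phi>_id[OF _ UK] \<phi>_comp[OF _ _ _ _ _ UK]])
  have dR: "subquotient_diagram I (\<lambda>i. simpcycles n (K i)) (\<lambda>i. simpboundaries n (K i))
      (\<lambda>i j. tuple_map (\<phi> i j) :: ('a set, 'k) simpchain \<Rightarrow> _)"
    by (rule subquotient_diagram_simplicial[OF \<phi>_simp \<phi>_id[OF _ UK] \<phi>_comp[OF _ _ _ _ _ UK]])

  have XP: "naturally_isomorphic I
      (subquotient_persistence (\<lambda>i. scycles n (T i)) (\<lambda>i. sboundaries n (T i)) (\<lambda>i j. schain_map n id :: ('a, 'k) schain \<Rightarrow> _))
      (subquotient_persistence (\<lambda>i. scycles n (down_topology (r i))) (\<lambda>i. sboundaries n (down_topology (r i)))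
        (\<lambda>i j. schain_map n (\<phi> i j)))"
  proof (rule naturally_isomorphic_subquotient[OF dX dP, where \<phi> = "\<lambda>i. schain_map n (point_class (T i))"])
    fix i j and z :: "('a, 'k) schain" assume i: "i \<in> I"
    have g: "continuous_map (T i) (down_topology (r i)) (point_class (T i))"
      using model[OF i] by (simp add: poset_model_def)
    show "module_hom chain_scale chain_scale (schain_map n (point_class (T i)))"
      by (rule module_hom_schain_map)
    show "schain_map n (point_class (T i)) z \<in> sboundaries n (down_topology (r i))" if "z \<in> sboundaries n (T i)"
      by (rule schain_map_sboundaries[OF g that])
    show "\<exists>z\<in>scycles n (T i). z' - schain_map n (point_class (T i)) z \<in> sboundaries n (down_topology (r i))"
      if "z' \<in> scycles n (down_topology (r i))" for z' :: "('a set, 'k) schain"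
      by (rule finite_poset.schain_map_homology_surj[OF fp[OF i] model[OF i] that])
    assume z: "z \<in> scycles n (T i)"
    show "schain_map n (point_class (T i)) z \<in> scycles n (down_topology (r i))"
      by (rule schain_map_scycles[OF g z])
    show "z \<in> sboundaries n (T i)" if "schain_map n (point_class (T i)) z \<in> sboundaries n (down_topology (r i))"
      by (rule finite_poset.schain_map_homology_inj[OF fp[OF i] model[OF i] z that])
    assume j: "j \<in> I" "i \<le> j"
    have z': "z \<in> schains n (T i)"
      using z by (simp add: scycles_def)
    \<comment> \<open>Both composites send a point of \<open>X\<close> to its class in
      \<open>T j\<close>, so they agree on every singular simplex.\<close>
    have "schain_map n (point_class (T j)) (schain_map n id z) = schain_map n (point_class (T j)) z"
      by (rule schain_map_compose[OF z']) simp
    also have "\<dots> = schain_map n (\<phi> i j) (schain_map n (point_class (T i)) z)"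
      by (rule schain_map_compose[OF z', symmetric]) (simp add: \<phi>_class[OF i j] top[OF i])
    finally show "schain_map n (point_class (T j)) (schain_map n id z) =
        schain_map n (\<phi> i j) (schain_map n (point_class (T i)) z)" .
  qed
  have KP: "naturally_isomorphic I
      (subquotient_persistence (\<lambda>i. tuple_cycles n (K i)) (\<lambda>i. tuple_boundaries n (K i)) (\<lambda>i j. tuple_map (\<phi> i j) :: ('a set, 'k) simpchain \<Rightarrow> _))
      (subquotient_persistence (\<lambda>i. scycles n (down_topology (r i))) (\<lambda>i. sboundaries n (down_topology (r i)))
        (\<lambda>i j. schain_map n (\<phi> i j)))"
  proof (rule naturally_isomorphic_subquotient[OF dK dP, where \<phi> = "\<lambda>i. order_schain (r i) n"])
    fix i j and z :: "('a set, 'k) simpchain" assume i: "i \<in> I"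
    interpret finite_poset "r i"
      by (rule fp[OF i])
    have in_schains: "order_schain (r i) p c \<in> schains p (down_topology (r i))"
      if "c \<in> simpchains p (K i)" for p and c :: "('a set, 'k) simpchain"
      using order_schain_in_schains[of c p "Field (r i)"] that subtopology_topspace[of "down_topology (r i)"]
      by (simp add: chains_within_Field K_def)
    have comm: "order_schain (r i) p (simpboundary (Suc p) c) = sboundary (Suc p) (order_schain (r i) (Suc p) c)"
      if "c \<in> simpchains (Suc p) (K i)" for p and c :: "('a set, 'k) simpchain"
      by (rule order_schain_simpboundary[OF that])
    show "module_hom chain_scale chain_scale (order_schain (r i) n)"
      unfolding order_schain_def by (rule module_hom_chain_extend)
    show "order_schain (r i) n z \<in> sboundaries n (down_topology (r i))" if "z \<in> tuple_boundaries n (K i)"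
      using that in_schains comm by (auto simp: tuple_boundaries_def sboundaries_def)
    show "\<exists>z\<in>tuple_cycles n (K i). z' - order_schain (r i) n z \<in> sboundaries n (down_topology (r i))"
      if "z' \<in> scycles n (down_topology (r i))" for z' :: "('a set, 'k) schain"
      using order_schain_homology_surj[OF that] by (auto simp: tuple_cycles_def K_def)
    assume z: "z \<in> tuple_cycles n (K i)"
    then have z': "z \<in> simpchains n (K i)" "simpboundary n z = 0"
      by (auto simp: tuple_cycles_def)
    have "sboundary n (order_schain (r i) n z) = 0"
      using comm[of z "n - 1"] z' by (cases n) (auto simp: sboundary_def order_schain_def)
    then show "order_schain (r i) n z \<in> scycles n (down_topology (r i))"
      using in_schains[OF z'(1)] by (simp add: scycles_def)
    show "z \<in> tuple_boundaries n (K i)" if "order_schain (r i) n z \<in> sboundaries n (down_topology (r i))"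
      using order_schain_homology_inj[OF z'[unfolded K_def] that] by (simp add: tuple_boundaries_def K_def)
    assume j: "j \<in> I" "i \<le> j"
    show "order_schain (r j) n (tuple_map (\<phi> i j) z) = schain_map n (\<phi> i j) (order_schain (r i) n z)"
      by (rule schain_map_order_schain[OF z'(1)[unfolded K_def] fp[OF j(1)] \<phi>_mono[OF i j], symmetric])
  qed
  \<comment> \<open>The chain map is the identity, so the induced map sends the class of a tuple
    cycle to the class of the oriented chain that it represents.\<close>
  have KR: "naturally_isomorphic I
      (subquotient_persistence (\<lambda>i. tuple_cycles n (K i)) (\<lambda>i. tuple_boundaries n (K i)) (\<lambda>i j. tuple_map (\<phi> i j) :: ('a set, 'k) simpchain \<Rightarrow> _))
      (subquotient_persistence (\<lambda>i. simpcycles n (K i)) (\<lambda>i. simpboundaries n (K i)) (\<lambda>i j. tuple_map (\<phi> i j)))"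
  proof (rule naturally_isomorphic_subquotient[OF dK dR, where \<phi> = "\<lambda>i z. z"])
    show "module_hom chain_scale chain_scale (\<lambda>z :: ('a set, 'k) simpchain. z)"
      by unfold_locales simp_all
    fix i and z :: "('a set, 'k) simpchain" assume i: "i \<in> I"
    show "z \<in> simpcycles n (K i)" if "z \<in> tuple_cycles n (K i)"
      using that finite_poset.tuple_cycles_subset[OF fp[OF i]] by blast
    show "z \<in> simpboundaries n (K i)" if "z \<in> tuple_boundaries n (K i)"
      using that tuple_boundaries_subset by blast
    show "z \<in> tuple_boundaries n (K i)" if "z \<in> tuple_cycles n (K i)" "z \<in> simpboundaries n (K i)"
      using that finite_poset.tuple_cycles_homology_inj[OF fp[OF i]] by (simp add: K_def)
    show "\<exists>a\<in>tuple_cycles n (K i). z - a \<in> simpboundaries n (K i)" if "z \<in> simpcycles n (K i)"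
      using that finite_poset.tuple_cycles_homology_surj[OF fp[OF i]] by (simp add: K_def)
  qed (rule refl)
  \<comment> \<open>Only the comparison from tuples to singular chains of the poset points the wrong
    way and is reversed.\<close>
  have "naturally_isomorphic I
      (subquotient_persistence (\<lambda>i. scycles n (T i)) (\<lambda>i. sboundaries n (T i)) (\<lambda>i j. schain_map n id :: ('a, 'k) schain \<Rightarrow> _))
      (subquotient_persistence (\<lambda>i. simpcycles n (K i)) (\<lambda>i. simpboundaries n (K i))
        (\<lambda>i j. tuple_map (\<phi> i j) :: ('a set, 'k) simpchain \<Rightarrow> _))"
    by (rule naturally_isomorphic_trans[OF XP naturally_isomorphic_trans[OF naturally_isomorphic_sym[OF KP] KR]])
  then show ?thesis
    by (simp add: singular_persistence_eq simplicial_persistence_eq identity_diagram_def order_complex_diagram_def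
        I_def K_def r_def[abs_def] \<phi>_def[abs_def])
qed

end
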